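(* Let $F$ be a differential field of characteristic zero with algebraically closed field of constants $C$, and let $F_\infty$ be a complete Picard--Vessiot closure of $F$. Let $E$ be a locally iterated Picard--Vessiot extension of $F$ contained in $F_\infty$. Then the following conditions are equivalent: (1) Every differential automorphism of $F_\infty$ over $F$ carries $E$ to itself. (2) For any differential field extension $K$ of $F$ with no new constants, all differential embeddings $E \to K$ over $F$ have the same image.
   Context: Differential fields are ordinary (one derivation), of characteristic zero. A linear homogeneous differential equation over a differential field $M$ with constants $C$ is an equation $Y^{(n)}+a_{n-1}Y^{(n-1)}+\dots+a_0Y=0$ with $a_i\in M$. It has a full set of solutions in a differential extension with the same constants $C$ if its solution space there has dimension $n$ over $C$. A Picard--Vessiot extension of $M$ is a differential field extension $N\supseteq M$ with the same constants as $M$, such that for some linear homogeneous differential equation over $M$ there is a full set of solutions in $N$ and $N$ is generated over $M$ as a differential field by these solutions. A Picard--Vessiot closure of $M$ (with algebraically closed constants) is a differential extension $M_1\supseteq M$ with the same constants as $M$, in which every linear homogeneous differential equation over $M$ has a full set of solutions, and which is generated as a differential field over $M$ by solutions of such equations. A complete Picard--Vessiot closure of $F$ is the union $F_\infty=\bigcup_{i\ge 0}F_i$ of a tower $F=F_0\subseteq F_1\subseteq\cdots$ in which each $F_{i+1}$ is a Picard--Vessiot closure of $F_i$. A differential extension $E$ of $F$ is an iterated Picard--Vessiot extension if there is a chain of differential subfields $F=E_0\subseteq E_1\subseteq\dots\subseteq E_n=E$ such that for each $i$, $E_{i+1}$ is a Picard--Vessiot extension of $E_i$. A differential extension $E$ of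 $F$ is a locally iterated Picard--Vessiot extension if every finite subset of $E$ belongs to an iterated Picard--Vessiot extension of $F$ contained in $E$. An extension $K\supseteq F$ has no new constants if the constants of $K$ are those of $F$. Embeddings and automorphisms over $F$ are maps of differential fields that are the identity on $F$. *)

theory Defs
  imports "HOL-Algebra.Algebra"
begin

record 'a diff_ring = "'a ring" +
  deriv :: "'a \<Rightarrow> 'a" (\<open>\<partial>\<index>\<close>)

locale differential_field = field R for R :: "('a, 'm) diff_ring_scheme" (structure) +
  assumes char_zero: "(n :: nat) > 0 \<Longrightarrow> [n] \<cdot> \<one> \<noteq> \<zero>"
    and deriv_closed: "x \<in> carrier R \<Longrightarrow> \<partial> x \<in> carrier R"
    and deriv_add: "\<lbrakk> x \<in> carrier R; y \<in> carrier R \<rbrakk> \<Longrightarrow> \<partial> (x \<oplus> y) = \<partial> x \<oplus> \<partial> y"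
    and deriv_mult:
      "\<lbrakk> x \<in> carrier R; y \<in> carrier R \<rbrakk> \<Longrightarrow> \<partial> (x \<otimes> y) = (\<partial> x \<otimes> y) \<oplus> (x \<otimes> \<partial> y)"

definition diff_subfield :: "'a set \<Rightarrow> ('a, 'm) diff_ring_scheme \<Rightarrow> bool" where
  "diff_subfield M R \<longleftrightarrow> subfield M R \<and> (\<forall>x\<in>M. \<partial>\<^bsub>R\<^esub> x \<in> M)"

definition constants :: "('a, 'm) diff_ring_scheme \<Rightarrow> 'a set \<Rightarrow> 'a set" where
  "constants R M = {x \<in> M. \<partial>\<^bsub>R\<^esub> x = \<zero>\<^bsub>R\<^esub>}"

text \<open>The smallest differential subfield of \<open>R\<close> that contains \<open>S\<close> (for \<open>S \<subseteq> carrier R\<close>).\<close>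

definition diff_field_generated :: "('a, 'm) diff_ring_scheme \<Rightarrow> 'a set \<Rightarrow> 'a set" where
  "diff_field_generated R S = \<Inter> {L. diff_subfield L R \<and> S \<subseteq> L}"

text \<open>
  A pair \<open>n\<close>, \<open>a\<close> with \<open>a i \<in> M\<close> for \<open>i < n\<close> stands for the monic linear homogeneous
  equation \<open>Y^(n) + a (n-1) Y^(n-1) + ... + a 0 Y = 0\<close> over \<open>M\<close>; the values of \<open>a\<close> at
  indices \<open>\<ge> n\<close> are irrelevant.
\<close>

definition lin_diff_solutions ::
    "('a, 'm) diff_ring_scheme \<Rightarrow> 'a set \<Rightarrow> nat \<Rightarrow> (nat \<Rightarrow> 'a) \<Rightarrow> 'a set" where
  "lin_diff_solutions R N n a =
    {y \<in> N. (deriv R ^^ n) y \<oplus>\<^bsub>R\<^esub> (\<Oplus>\<^bsub>R\<^esub>i\<in>{..<n}. a i \<otimes>\<^bsub>R\<^esub> (deriv R ^^ i) y) = \<zero>\<^bsub>R\<^esub>}"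

definition full_set_of_solutions ::
    "('a, 'm) diff_ring_scheme \<Rightarrow> 'a set \<Rightarrow> nat \<Rightarrow> (nat \<Rightarrow> 'a) \<Rightarrow> bool" where
  "full_set_of_solutions R N n a \<longleftrightarrow>
    ring.dimension R n (constants R N) (lin_diff_solutions R N n a)"

definition no_new_constants_subext ::
    "('a, 'm) diff_ring_scheme \<Rightarrow> 'a set \<Rightarrow> 'a set \<Rightarrow> bool" where
  "no_new_constants_subext R M N \<longleftrightarrow>
    diff_subfield M R \<and> diff_subfield N R \<and> M \<subseteq> N \<and> constants R N = constants R M"

definition picard_vessiot_extension ::
    "('a, 'm) diff_ring_scheme \<Rightarrow> 'a set \<Rightarrow> 'a set \<Rightarrow> bool" where
  "picard_vessiot_extension R M N \<longleftrightarrow>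
    no_new_constants_subext R M N \<and>
    (\<exists>n a. (\<forall>i<n. a i \<in> M) \<and> full_set_of_solutions R N n a \<and>
           N = diff_field_generated R (M \<union> lin_diff_solutions R N n a))"

definition picard_vessiot_closure ::
    "('a, 'm) diff_ring_scheme \<Rightarrow> 'a set \<Rightarrow> 'a set \<Rightarrow> bool" where
  "picard_vessiot_closure R M N \<longleftrightarrow>
    no_new_constants_subext R M N \<and>
    (\<forall>n a. (\<forall>i<n. a i \<in> M) \<longrightarrow> full_set_of_solutions R N n a) \<and>
    N = diff_field_generated R
          (M \<union> \<Union> {lin_diff_solutions R N n a | n a. \<forall>i<n. a i \<in> M})"

definition complete_picard_vessiot_closure ::
    "('a, 'm) diff_ring_scheme \<Rightarrow> 'a set \<Rightarrow> bool" where
  "complete_picard_vessiot_closure R F \<longleftrightarrow>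
    (\<exists>Fs :: nat \<Rightarrow> 'a set. Fs 0 = F \<and>
      (\<forall>i. picard_vessiot_closure R (Fs i) (Fs (Suc i))) \<and> carrier R = (\<Union>i. Fs i))"

definition iterated_picard_vessiot ::
    "('a, 'm) diff_ring_scheme \<Rightarrow> 'a set \<Rightarrow> 'a set \<Rightarrow> bool" where
  "iterated_picard_vessiot R F E \<longleftrightarrow>
    diff_subfield F R \<and>
    (\<exists>n (Es :: nat \<Rightarrow> 'a set). Es 0 = F \<and> Es n = E \<and>
      (\<forall>i<n. picard_vessiot_extension R (Es i) (Es (Suc i))))"

definition locally_iterated_picard_vessiot ::
    "('a, 'm) diff_ring_scheme \<Rightarrow> 'a set \<Rightarrow> 'a set \<Rightarrow> bool" where
  "locally_iterated_picard_vessiot R F E \<longleftrightarrow>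
    diff_subfield F R \<and> diff_subfield E R \<and> F \<subseteq> E \<and>
    (\<forall>S. finite S \<and> S \<subseteq> E \<longrightarrow> (\<exists>L. iterated_picard_vessiot R F L \<and> S \<subseteq> L \<and> L \<subseteq> E))"

definition diff_embeddings ::
    "('a, 'm) diff_ring_scheme \<Rightarrow> 'a set \<Rightarrow> ('k, 'l) diff_ring_scheme \<Rightarrow> ('a \<Rightarrow> 'k) set" where
  "diff_embeddings R E K =
    {h \<in> ring_hom (R\<lparr>carrier := E\<rparr>) K. inj_on h E \<and> (\<forall>x\<in>E. h (\<partial>\<^bsub>R\<^esub> x) = \<partial>\<^bsub>K\<^esub> (h x))}"

definition diff_automorphisms_over ::
    "('a, 'm) diff_ring_scheme \<Rightarrow> 'a set \<Rightarrow> ('a \<Rightarrow> 'a) set" where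
  "diff_automorphisms_over R F =
    {h \<in> ring_iso R R. (\<forall>x\<in>carrier R. h (\<partial>\<^bsub>R\<^esub> x) = \<partial>\<^bsub>R\<^esub> (h x)) \<and> (\<forall>x\<in>F. h x = x)}"

text \<open>
  An extension \<open>K\<close> of \<open>F\<close> need not live in the same type as \<open>F\<close>, so it is given together with
  its structure map \<open>j\<close>, and being the identity on \<open>F\<close> means agreeing with \<open>j\<close> on \<open>F\<close>.
\<close>

definition no_new_constants_extension ::
    "('a, 'm) diff_ring_scheme \<Rightarrow> 'a set \<Rightarrow> ('k, 'l) diff_ring_scheme \<Rightarrow> ('a \<Rightarrow> 'k) \<Rightarrow> bool" where
  "no_new_constants_extension R F K j \<longleftrightarrow>
    differential_field K \<and> j \<in> diff_embeddings R F K \<and>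
    constants K (carrier K) = j ` constants R F"

definition diff_embeddings_over ::
    "('a, 'm) diff_ring_scheme \<Rightarrow> 'a set \<Rightarrow> 'a set \<Rightarrow> ('k, 'l) diff_ring_scheme \<Rightarrow> ('a \<Rightarrow> 'k)
      \<Rightarrow> ('a \<Rightarrow> 'k) set" where
  "diff_embeddings_over R F E K j = {h \<in> diff_embeddings R E K. \<forall>x\<in>F. h x = j x}"

definition automorphism_stable :: "('a, 'm) diff_ring_scheme \<Rightarrow> 'a set \<Rightarrow> 'a set \<Rightarrow> bool" where
  "automorphism_stable R F E \<longleftrightarrow> (\<forall>h \<in> diff_automorphisms_over R F. h ` E = E)"

text \<open>
  HOL cannot quantify over all types inside a formula, so the quantifier over all extensions
  \<open>K\<close> ranges over those whose elements come from the type \<open>'k\<close>. For an equivalence with a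
  condition \<open>A\<close> in which \<open>K\<close> is unrestricted, one therefore needs that \<open>A\<close> implies this predicate
  for an arbitrary type \<open>'k\<close>, while the converse is strongest when it uses the predicate at a
  single type only.
\<close>

definition embeddings_have_same_image ::
    "('a, 'm) diff_ring_scheme \<Rightarrow> 'a set \<Rightarrow> 'a set \<Rightarrow> 'k itself \<Rightarrow> bool" where
  "embeddings_have_same_image R F E (_ :: 'k itself) \<longleftrightarrow>
    (\<forall>(K :: 'k diff_ring) j. no_new_constants_extension R F K j \<longrightarrow>
      (\<forall>f \<in> diff_embeddings_over R F E K j. \<forall>g \<in> diff_embeddings_over R F E K j. f ` E = g ` E))"

end

theory Submission
  imports Defs
begin

text \<open>
  Write \<open>U\<close> for the complete Picard--Vessiot closure and \<open>C\<close> for its field of constants, which are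
  those of \<open>F\<close>.

  That equal images imply stability is seen by taking \<open>K = U\<close>: the inclusion of \<open>E\<close> and the
  restriction of an automorphism are two embeddings of \<open>E\<close> (\<open>same_image_imp_stable\<close>).

  Conversely, let \<open>E\<close> be stable and \<open>f, g : E \<rightarrow> K\<close> embeddings over \<open>F\<close>. Every element of \<open>E\<close> lies in
  the last stage of a tower of Picard--Vessiot extensions inside \<open>E\<close>, and \<open>f ` M \<subseteq> g ` E\<close> is proved for each
  stage \<open>M\<close> of the tower in turn (\<open>stable_image_step\<close>). If it holds for \<open>M\<close>, then \<open>g\<inverse> \<circ> f\<close> embeds
  \<open>M\<close> into \<open>U\<close>; it extends to an automorphism \<open>\<sigma>\<close> of \<open>U\<close>, and \<open>\<sigma>\<close> maps \<open>E\<close> to itself. The next stage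
  is generated by a full solution space \<open>V\<close> of an equation over \<open>M\<close>. Both \<open>f ` V\<close> and \<open>g ` \<sigma> ` V\<close>
  consist of solutions in \<open>K\<close> of the same equation. The second space has the largest dimension that
  the Wronskian permits over the constants of \<open>K\<close>, which are those of \<open>F\<close>; so it contains the
  first, and \<open>f ` V \<subseteq> g ` E\<close>.

  The main work is therefore to extend an embedding over \<open>F\<close> of a differential subfield of \<open>U\<close> that
  contains \<open>F\<close> to an automorphism of \<open>U\<close> (\<open>extend_to_automorphism\<close>). By Zorn's lemma there is a maximal
  extension \<open>\<theta> : D \<rightarrow> U\<close>. If \<open>D\<close> is not \<open>U\<close>, some equation over \<open>D\<close> has a solution outside \<open>D\<close>. It
  suffices to find such a solution \<open>u\<close> and a solution \<open>v\<close> of the transported equation with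
  corresponding algebraic relations over \<open>D\<close> and \<open>\<theta> ` D\<close> (\<open>corresponding_solutions\<close>), since then
  \<open>u \<mapsto> v\<close> extends \<open>\<theta>\<close>. So \<open>D = U\<close>, and the image is \<open>U\<close> by the same dimension count as above.

  For the two solutions, consider \<open>D[Y\<^sub>0, \<dots>, Y\<^sub>n\<^sub>-\<^sub>1]\<close> with the derivation of the companion system. There
  is a nonzero linear form \<open>W\<close> over \<open>D\<close> that vanishes at the jets of all solutions in \<open>D\<close>. Let \<open>M\<close> be
  maximal among the differential ideals that contain no power of \<open>W\<close>. If the jet of a solution is a
  zero of \<open>M\<close> but not of \<open>W\<close>, then its ideal of relations contains \<open>M\<close> and no power of \<open>W\<close>, hence equals
  \<open>M\<close>; and the same can be done for the image of \<open>M\<close> under \<open>\<theta>\<close>. What is left is that every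
  differential ideal \<open>M\<close> without powers of \<open>W\<close> has such a zero in \<open>U\<close> (\<open>zero_of_diff_ideal\<close>).

  A fundamental system in \<open>U\<close> parametrises the solutions by \<open>C\<^sup>n\<close>, and the elements of \<open>M\<close> become
  polynomial functions on \<open>C\<^sup>n\<close> with coefficients in \<open>U\<close>. Their \<open>U\<close>-span is an ideal stable under the
  derivation of the values, and it contains no power of \<open>W\<close>: a linear relation over \<open>U\<close> between
  polynomials over \<open>D\<close> can be replaced by one over \<open>D\<close> (\<open>elimination_of_coefficients\<close>). So some prime
  ideal \<open>Q\<close> contains the span but not \<open>W\<close>. As \<open>C\<close> is algebraically closed, a Nullstellensatz provides
  points of \<open>C\<^sup>n\<close> at which all polynomials over \<open>C\<close> in \<open>Q\<close> vanish. By stability under the derivation,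
  the span is generated by polynomials over \<open>C\<close> (\<open>derivation_stable_subspace_annihilated\<close>), so it
  vanishes there as well, and the point can be chosen such that \<open>W\<close> does not.
\<close>

section \<open>Linear algebra over differential fields\<close>

lemma (in abelian_monoid) finsum_swap:
  assumes "finite A" "finite B" and "\<And>i j. i \<in> A \<Longrightarrow> j \<in> B \<Longrightarrow> f i j \<in> carrier G"
  shows "(\<Oplus>i\<in>A. \<Oplus>j\<in>B. f i j) = (\<Oplus>j\<in>B. \<Oplus>i\<in>A. f i j)"
  using assms(1,3)
proof (induction A rule: finite_induct)
  case empty
  then show ?case by (simp add: finsum_zero)
next
  case (insert x A)
  have "(\<Oplus>j\<in>B. \<Oplus>i\<in>insert x A. f i j) = (\<Oplus>j\<in>B. f x j \<oplus> (\<Oplus>i\<in>A. f i j))"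
    using insert by (intro finsum_cong') (auto intro!: finsum_closed)
  also have "\<dots> = (\<Oplus>j\<in>B. f x j) \<oplus> (\<Oplus>j\<in>B. \<Oplus>i\<in>A. f i j)"
    using insert by (intro finsum_addf) (auto intro!: finsum_closed)
  finally show ?case using insert by (simp add: Pi_def)
qed

lemma (in cring) finsum_lincomb:
  assumes "s \<in> carrier R" "t \<in> carrier R"
    and "\<And>j. j \<in> J \<Longrightarrow> u j \<in> carrier R" "\<And>j. j \<in> J \<Longrightarrow> v j \<in> carrier R"
    and "\<And>j. j \<in> J \<Longrightarrow> w j \<in> carrier R"
  shows "(\<Oplus>j\<in>J. (s \<otimes> u j \<oplus> t \<otimes> v j) \<otimes> w j) = s \<otimes> (\<Oplus>j\<in>J. u j \<otimes> w j) \<oplus> t \<otimes> (\<Oplus>j\<in>J. v j \<otimes> w j)"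
proof (cases "finite J")
  case True
  have "(\<Oplus>j\<in>J. (s \<otimes> u j \<oplus> t \<otimes> v j) \<otimes> w j) = (\<Oplus>j\<in>J. s \<otimes> (u j \<otimes> w j) \<oplus> t \<otimes> (v j \<otimes> w j))"
    using assms by (intro finsum_cong') (auto simp: l_distr m_assoc)
  also have "\<dots> = (\<Oplus>j\<in>J. s \<otimes> (u j \<otimes> w j)) \<oplus> (\<Oplus>j\<in>J. t \<otimes> (v j \<otimes> w j))"
    using assms by (intro finsum_addf) auto
  finally show ?thesis using assms True by (simp add: finsum_rdistr Pi_def)
qed (use assms in auto)

text \<open>
  Induction on the number \<open>r\<close> of equations. With one unknown set to zero, the first \<open>r\<close> equations of
  \<open>Suc r\<close> still have a nontrivial solution. Doing this a second time, for an unknown \<open>j1\<close> at which the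
  first solution \<open>d\<close> is nonzero, gives a solution \<open>e\<close> independent of \<open>d\<close>, and a combination of the two
  also solves the last equation.
\<close>

lemma (in field) homogeneous_system_nontrivial_solution:
  assumes K: "subfield K R"
    and "finite J" and "r < card J"
    and "\<And>k j. k < r \<Longrightarrow> j \<in> J \<Longrightarrow> M k j \<in> K"
  shows "\<exists>d :: 'i \<Rightarrow> 'a. (\<forall>j. d j \<in> K) \<and> (\<exists>j\<in>J. d j \<noteq> \<zero>) \<and>
    (\<forall>k<r. (\<Oplus>j\<in>J. M k j \<otimes> d j) = \<zero>)"
  using assms(2-4)
proof (induction r arbitrary: J)
  case 0
  then obtain j where "j \<in> J" by fastforce
  with subringE[OF subfieldE(1)[OF K]] show ?case
    by (intro exI[of _ "\<lambda>_. \<one>"]) auto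
next
  case (Suc r)
  note K_props [simp, intro] = subringE(2,3,5-7)[OF subfieldE(1)[OF K]]
  have KR: "\<And>x. x \<in> K \<Longrightarrow> x \<in> carrier R" using subfieldE(3)[OF K] by blast
  have MR: "\<And>k j. k < Suc r \<Longrightarrow> j \<in> J \<Longrightarrow> M k j \<in> carrier R" using Suc.prems KR by blast
  have zero_out: "\<exists>d. (\<forall>j. d j \<in> K) \<and> (\<exists>j\<in>J. d j \<noteq> \<zero>) \<and> d j0 = \<zero> \<and>
      (\<forall>k<r. (\<Oplus>j\<in>J. M k j \<otimes> d j) = \<zero>)" if "j0 \<in> J" for j0
  proof -
    have "r < card (J - {j0})" using that Suc.prems by simp
    then obtain d where d: "\<forall>j. d j \<in> K" "\<exists>j\<in>J - {j0}. d j \<noteq> \<zero>"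
        "\<forall>k<r. (\<Oplus>j\<in>J - {j0}. M k j \<otimes> d j) = \<zero>"
      using Suc.IH[of "J - {j0}"] Suc.prems by auto
    define e where "e = d(j0 := \<zero>)"
    have "(\<Oplus>j\<in>J. M k j \<otimes> e j) = \<zero>" if "k < r" for k
    proof -
      have "(\<Oplus>j\<in>insert j0 (J - {j0}). M k j \<otimes> e j)
          = M k j0 \<otimes> e j0 \<oplus> (\<Oplus>j\<in>J - {j0}. M k j \<otimes> e j)"
        using that Suc.prems \<open>j0 \<in> J\<close> d(1) by (intro finsum_insert) (auto simp: e_def KR MR)
      also have "(\<Oplus>j\<in>J - {j0}. M k j \<otimes> e j) = (\<Oplus>j\<in>J - {j0}. M k j \<otimes> d j)"
        using that d(1) by (intro finsum_cong') (auto simp: e_def KR MR)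
      finally show ?thesis using that d(3) MR[of k j0] \<open>j0 \<in> J\<close>
        by (simp add: insert_absorb e_def)
    qed
    then show ?thesis using d by (intro exI[of _ e]) (auto simp: e_def)
  qed
  obtain j0 where "j0 \<in> J" using Suc.prems by fastforce
  then obtain d j1 where d: "\<And>j. d j \<in> K" "j1 \<in> J" "d j1 \<noteq> \<zero>"
      "\<forall>k<r. (\<Oplus>j\<in>J. M k j \<otimes> d j) = \<zero>" using zero_out by blast
  then obtain e where e: "\<And>j. e j \<in> K" "\<exists>j\<in>J. e j \<noteq> \<zero>" "e j1 = \<zero>"
      "\<forall>k<r. (\<Oplus>j\<in>J. M k j \<otimes> e j) = \<zero>" using zero_out[of j1] by blast
  define s where "s f = (\<Oplus>j\<in>J. M r j \<otimes> f j)" for f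
  have sK: "s f \<in> K" if "\<And>j. f j \<in> K" for f
  proof -
    have "A \<subseteq> J \<Longrightarrow> (\<Oplus>j\<in>A. M r j \<otimes> f j) \<in> K" if "finite A" for A
      using that
    proof (induction A rule: finite_induct)
      case (insert x F)
      then show ?case using \<open>\<And>j. f j \<in> K\<close> Suc.prems
        by (subst finsum_insert) (auto simp: KR MR)
    qed auto
    then show ?thesis using Suc.prems unfolding s_def by blast
  qed
  show ?case
  proof (cases "s e = \<zero>")
    case True
    then have "\<forall>k<Suc r. (\<Oplus>j\<in>J. M k j \<otimes> e j) = \<zero>" using e by (auto simp: less_Suc_eq s_def)
    then show ?thesis using e by blast
  next
    case False
    \<comment> \<open>The entry of \<open>f\<close> at \<open>j1\<close> is nonzero since \<open>e\<close> vanishes there, \<open>d\<close> does not, and \<open>s e\<close> is nonzero.\<close>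
    define f where "f j = s e \<otimes> d j \<ominus> s d \<otimes> e j" for j
    have carr: "s e \<in> carrier R" "s d \<in> carrier R" "\<And>j. e j \<in> carrier R" "\<And>j. d j \<in> carrier R"
      using d e sK KR by blast+
    have "(\<Oplus>j\<in>J. M k j \<otimes> f j)
        = s e \<otimes> (\<Oplus>j\<in>J. M k j \<otimes> d j) \<oplus> (\<ominus> s d) \<otimes> (\<Oplus>j\<in>J. M k j \<otimes> e j)" if "k < Suc r" for k
    proof -
      have "(\<Oplus>j\<in>J. M k j \<otimes> f j)
          = (\<Oplus>j\<in>J. s e \<otimes> (M k j \<otimes> d j) \<oplus> (\<ominus> s d) \<otimes> (M k j \<otimes> e j))"
        using that carr
        by (intro finsum_cong') (auto simp: f_def MR a_minus_def r_distr m_lcomm l_minus r_minus)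
      also have "\<dots> = (\<Oplus>j\<in>J. s e \<otimes> (M k j \<otimes> d j)) \<oplus> (\<Oplus>j\<in>J. (\<ominus> s d) \<otimes> (M k j \<otimes> e j))"
        using that carr by (intro finsum_addf) (auto simp: MR)
      finally show ?thesis
        using that carr Suc.prems(1) by (simp add: finsum_rdistr MR Pi_def)
    qed
    moreover have "\<forall>k<Suc r. s e \<otimes> (\<Oplus>j\<in>J. M k j \<otimes> d j) \<oplus> (\<ominus> s d) \<otimes> (\<Oplus>j\<in>J. M k j \<otimes> e j) = \<zero>"
    proof (intro allI impI)
      fix k assume "k < Suc r"
      then consider "k < r" | "k = r" by linarith
      then show "s e \<otimes> (\<Oplus>j\<in>J. M k j \<otimes> d j) \<oplus> (\<ominus> s d) \<otimes> (\<Oplus>j\<in>J. M k j \<otimes> e j) = \<zero>"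
      proof cases
        case 1
        then show ?thesis using d(4) e(4) carr by simp
      next
        case 2
        have "s e \<otimes> s d \<oplus> (\<ominus> s d) \<otimes> s e = \<zero>" using carr(1,2) by algebra
        then show ?thesis using 2 by (simp add: s_def)
      qed
    qed
    moreover have "f j1 \<noteq> \<zero>" using False d e carr by (simp add: f_def integral_iff a_minus_def)
    moreover have "f j \<in> K" for j using sK d e carr unfolding f_def a_minus_def by auto
    ultimately show ?thesis using d(2) by (intro exI[of _ f]) auto
  qed
qed

context differential_field
begin

lemma deriv_zero [simp]: "\<partial> \<zero> = \<zero>"
proof -
  have "\<partial> \<zero> \<oplus> \<partial> \<zero> = \<partial> \<zero>" using deriv_add[of \<zero> \<zero>] by simp
  then show ?thesis using deriv_closed[of \<zero>] by (metis local.add.r_cancel_one' zero_closed)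
qed

lemma deriv_one [simp]: "\<partial> \<one> = \<zero>"
proof -
  have "\<partial> \<one> \<oplus> \<partial> \<one> = \<partial> \<one>" using deriv_mult[of \<one> \<one>] deriv_closed[of \<one>] by simp
  then show ?thesis using deriv_closed[of \<one>] by (metis local.add.r_cancel_one' one_closed)
qed

lemma deriv_minus: "x \<in> carrier R \<Longrightarrow> \<partial> (\<ominus> x) = \<ominus> \<partial> x"
  using deriv_add[of x "\<ominus> x"] deriv_closed[of x] deriv_closed[of "\<ominus> x"]
  by (metis a_comm add.inv_closed deriv_zero minus_equality r_neg)

lemma deriv_finsum:
  assumes "\<And>j. j \<in> J \<Longrightarrow> f j \<in> carrier R"
  shows "\<partial> (\<Oplus>j\<in>J. f j) = (\<Oplus>j\<in>J. \<partial> (f j))"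
  using assms
  by (induction J rule: infinite_finite_induct) (auto simp: deriv_add deriv_closed Pi_def)

lemma deriv_inv:
  assumes "x \<in> carrier R" "x \<noteq> \<zero>"
  shows "\<partial> (inv x) = \<ominus> (\<partial> x \<otimes> (inv x \<otimes> inv x))"
proof -
  have x: "inv x \<in> carrier R" "x \<otimes> inv x = \<one>" using assms field_Units by auto
  have d: "\<partial> x \<in> carrier R" "\<partial> (inv x) \<in> carrier R" using assms x by (auto intro: deriv_closed)
  have "\<partial> x \<otimes> inv x \<oplus> x \<otimes> \<partial> (inv x) = \<zero>"
    using deriv_mult[OF assms(1) x(1)] x by simp
  then have "inv x \<otimes> (\<partial> x \<otimes> inv x \<oplus> x \<otimes> \<partial> (inv x)) = \<zero>" using x by simp
  moreover have "inv x \<otimes> (\<partial> x \<otimes> inv x \<oplus> x \<otimes> \<partial> (inv x))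
      = \<partial> x \<otimes> (inv x \<otimes> inv x) \<oplus> (x \<otimes> inv x) \<otimes> \<partial> (inv x)"
    using assms x(1) d by algebra
  ultimately have "\<partial> x \<otimes> (inv x \<otimes> inv x) \<oplus> \<partial> (inv x) = \<zero>" using x d by simp
  then show ?thesis using x d by (metis a_comm m_closed minus_equality)
qed

lemma deriv_iterate_closed: "x \<in> carrier R \<Longrightarrow> (deriv R ^^ i) x \<in> carrier R"
  by (induction i) (auto intro: deriv_closed)

lemma deriv_constant_mult:
  "c \<in> carrier R \<Longrightarrow> \<partial> c = \<zero> \<Longrightarrow> x \<in> carrier R \<Longrightarrow> \<partial> (c \<otimes> x) = c \<otimes> \<partial> x"
  by (simp add: deriv_mult deriv_closed)

lemma subfield_constants: "subfield (constants R (carrier R)) R"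
proof (rule subfieldI')
  show "subring (constants R (carrier R)) R"
    by (rule subringI) (auto simp: constants_def deriv_minus deriv_mult deriv_add)
  fix k assume k: "k \<in> constants R (carrier R) - {\<zero>}"
  then have "inv k \<in> carrier R" by (auto simp: constants_def field_Units)
  then show "inv k \<in> constants R (carrier R)" using k by (auto simp: constants_def deriv_inv)
qed

definition derivation_stable_subspace :: "(('b \<Rightarrow> 'a) \<Rightarrow> bool) \<Rightarrow> bool" where
  "derivation_stable_subspace P \<longleftrightarrow>
    (\<forall>u j. P u \<longrightarrow> u j \<in> carrier R) \<and>
    (\<forall>u v s t. P u \<longrightarrow> P v \<longrightarrow> s \<in> carrier R \<longrightarrow> t \<in> carrier R \<longrightarrow> P (\<lambda>j. s \<otimes> u j \<oplus> t \<otimes> v j)) \<and>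
    (\<forall>u. P u \<longrightarrow> P (\<lambda>j. \<partial> (u j)))"

lemma derivation_stable_subspaceD:
  assumes "derivation_stable_subspace P" and "P u"
  shows "u j \<in> carrier R"
    and "P v \<Longrightarrow> s \<in> carrier R \<Longrightarrow> t \<in> carrier R \<Longrightarrow> P (\<lambda>j. s \<otimes> u j \<oplus> t \<otimes> v j)"
    and "P (\<lambda>j. \<partial> (u j))"
  using assms unfolding derivation_stable_subspace_def by blast+

text \<open>
  Subtract from \<open>u\<close> the multiple \<open>u i / \<partial> (u i)\<close> of its derivative, where \<open>u i\<close> is not constant. This
  makes entry \<open>i\<close> zero and leaves all constant entries as they are, in particular the zeros and the
  entry \<open>\<one>\<close>; so the number of nonconstant entries decreases.
\<close>

lemma constant_vector_with_unit_entry: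
  assumes "finite J"
    and P: "derivation_stable_subspace P"
    and "P u" "l \<in> J" "u l = \<one>"
  shows "\<exists>e. P e \<and> e l = \<one> \<and> (\<forall>j\<in>J. \<partial> (e j) = \<zero>) \<and> (\<forall>j\<in>J. u j = \<zero> \<longrightarrow> e j = \<zero>)"
  using assms(3-5)
proof (induction "card {j \<in> J. \<partial> (u j) \<noteq> \<zero>}" arbitrary: u rule: less_induct)
  case less
  note carr = derivation_stable_subspaceD(1)[OF P]
    and lin = derivation_stable_subspaceD(2)[OF P]
    and der = derivation_stable_subspaceD(3)[OF P]
  show ?case
  proof (cases "\<forall>j\<in>J. \<partial> (u j) = \<zero>")
    case True
    then show ?thesis using less.prems by blast
  next
    case False
    then obtain i where i: "i \<in> J" "\<partial> (u i) \<noteq> \<zero>" by blast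
    have uc: "u j \<in> carrier R" "\<partial> (u j) \<in> carrier R" for j
      using carr less.prems(1) by (auto intro: deriv_closed)
    have inv: "inv (\<partial> (u i)) \<in> carrier R" "inv (\<partial> (u i)) \<otimes> \<partial> (u i) = \<one>"
      using i uc field_Units by auto
    define t where "t = \<ominus> (u i \<otimes> inv (\<partial> (u i)))"
    have tc: "t \<in> carrier R" unfolding t_def using inv uc by auto
    define v where "v j = \<one> \<otimes> u j \<oplus> t \<otimes> \<partial> (u j)" for j
    have "P v" unfolding v_def using lin[OF less.prems(1) der[OF less.prems(1)] one_closed tc] .
    have vl: "v l = \<one>" using less.prems tc by (simp add: v_def)
    have v0: "v j = u j" if "\<partial> (u j) = \<zero>" for j using that tc uc by (simp add: v_def)
    have v0': "v j = \<zero>" if "u j = \<zero>" for j using that tc uc by (simp add: v_def)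
    have vi: "v i = \<zero>"
      using uc inv by (simp add: v_def t_def l_minus m_assoc r_neg)
    have "\<partial> (v j) = \<zero>" if "\<partial> (u j) = \<zero>" for j using v0 that by simp
    moreover have "\<partial> (v i) = \<zero>" using vi by simp
    ultimately have "{j \<in> J. \<partial> (v j) \<noteq> \<zero>} \<subset> {j \<in> J. \<partial> (u j) \<noteq> \<zero>}"
      using i by blast
    then have "card {j \<in> J. \<partial> (v j) \<noteq> \<zero>} < card {j \<in> J. \<partial> (u j) \<noteq> \<zero>}"
      using \<open>finite J\<close> by (intro psubset_card_mono) auto
    from less.hyps[OF this \<open>P v\<close> less.prems(2) vl] show ?thesis using v0' by blast
  qed
qed

text \<open>
  A derivation-stable subspace is spanned by its constant vectors, expressed here by means of linear
  functionals. Indeed, subtracting from \<open>u\<close> the multiple \<open>u l\<close> of a constant vector whose entry at \<open>l\<close>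
  is \<open>\<one>\<close> and whose support lies in that of \<open>u\<close> shrinks the support.
\<close>

lemma derivation_stable_subspace_annihilated:
  assumes "finite J"
    and P: "derivation_stable_subspace P"
    and w: "\<And>j. j \<in> J \<Longrightarrow> w j \<in> carrier R"
    and const: "\<And>e. P e \<Longrightarrow> \<forall>j\<in>J. \<partial> (e j) = \<zero> \<Longrightarrow> (\<Oplus>j\<in>J. e j \<otimes> w j) = \<zero>"
    and "P u"
  shows "(\<Oplus>j\<in>J. u j \<otimes> w j) = \<zero>"
  using \<open>P u\<close>
proof (induction "card {j \<in> J. u j \<noteq> \<zero>}" arbitrary: u rule: less_induct)
  case less
  note carr = derivation_stable_subspaceD(1)[OF P]
    and lin = derivation_stable_subspaceD(2)[OF P]
    and der = derivation_stable_subspaceD(3)[OF P]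
  have uc: "u j \<in> carrier R" for j using carr less.prems by blast
  show ?case
  proof (cases "\<forall>j\<in>J. u j = \<zero>")
    case True
    then show ?thesis using w by (simp add: finsum_zero cong: finsum_cong)
  next
    case False
    then obtain l where l: "l \<in> J" "u l \<noteq> \<zero>" by blast
    have inv: "inv (u l) \<in> carrier R" "inv (u l) \<otimes> u l = \<one>" using l uc field_Units by auto
    have "P (\<lambda>j. inv (u l) \<otimes> u j \<oplus> \<zero> \<otimes> u j)" using lin less.prems inv by blast
    then obtain e where e: "P e" "e l = \<one>" "\<forall>j\<in>J. \<partial> (e j) = \<zero>" "\<forall>j\<in>J. u j = \<zero> \<longrightarrow> e j = \<zero>"
      using constant_vector_with_unit_entry[of J P "\<lambda>j. inv (u l) \<otimes> u j \<oplus> \<zero> \<otimes> u j" l,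
          OF \<open>finite J\<close> P] l inv uc by auto
    have ec: "e j \<in> carrier R" for j using carr e by blast
    define v where "v j = \<one> \<otimes> u j \<oplus> (\<ominus> u l) \<otimes> e j" for j
    have "P v" unfolding v_def using lin[OF less.prems e(1) one_closed a_inv_closed[OF uc]] .
    have vl: "v l = \<zero>" using uc e by (simp add: v_def r_neg)
    have v0: "v j = \<zero>" if "u j = \<zero>" "j \<in> J" for j using that e uc by (simp add: v_def)
    have "{j \<in> J. v j \<noteq> \<zero>} \<subset> {j \<in> J. u j \<noteq> \<zero>}" using v0 vl l by auto
    then have "card {j \<in> J. v j \<noteq> \<zero>} < card {j \<in> J. u j \<noteq> \<zero>}"
      using \<open>finite J\<close> by (intro psubset_card_mono) auto
    from less.hyps[OF this \<open>P v\<close>] have "(\<Oplus>j\<in>J. v j \<otimes> w j) = \<zero>" .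
    moreover have "(\<Oplus>j\<in>J. v j \<otimes> w j)
        = \<one> \<otimes> (\<Oplus>j\<in>J. u j \<otimes> w j) \<oplus> (\<ominus> u l) \<otimes> (\<Oplus>j\<in>J. e j \<otimes> w j)"
      unfolding v_def using uc ec w by (intro finsum_lincomb) auto
    ultimately show ?thesis using const[OF e(1,3)] uc w by (simp add: Pi_def)
  qed
qed

text \<open>
  The linear relations between the jets \<open>(y, \<partial> y, \<dots>)\<close> of length \<open>n\<close> of the \<open>y j\<close> form a
  derivation-stable subspace: the derivative of the relation between the \<open>i\<close>-th entries differs from
  the relation with differentiated coefficients by the one between the entries \<open>Suc i\<close>, and for
  \<open>Suc i = n\<close> the differential equation reduces the latter to relations already known. So a relation
  can be replaced by one with constant coefficients.
\<close>

lemma wronskian_dependence: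
  assumes "finite J"
    and y: "\<And>j. j \<in> J \<Longrightarrow> y j \<in> lin_diff_solutions R (carrier R) n a"
    and a: "\<And>i. i < n \<Longrightarrow> a i \<in> carrier R"
    and u: "\<And>j. u j \<in> carrier R" "l \<in> J" "u l \<noteq> \<zero>"
    and dep: "\<And>i. i < n \<Longrightarrow> (\<Oplus>j\<in>J. u j \<otimes> (deriv R ^^ i) (y j)) = \<zero>"
  shows "\<exists>e. (\<forall>j. e j \<in> carrier R) \<and> e l = \<one> \<and> (\<forall>j\<in>J. \<partial> (e j) = \<zero>) \<and>
    (\<forall>i<n. (\<Oplus>j\<in>J. e j \<otimes> (deriv R ^^ i) (y j)) = \<zero>)"
proof -
  have yc: "(deriv R ^^ i) (y j) \<in> carrier R" if "j \<in> J" for i j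
    using y[OF that] by (auto simp: lin_diff_solutions_def intro: deriv_iterate_closed)
  define P where "P u \<longleftrightarrow> (\<forall>j. u j \<in> carrier R) \<and>
    (\<forall>i<n. (\<Oplus>j\<in>J. u j \<otimes> (deriv R ^^ i) (y j)) = \<zero>)" for u
  have lin: "P (\<lambda>j. s \<otimes> u j \<oplus> t \<otimes> v j)"
    if "P u" "P v" "s \<in> carrier R" "t \<in> carrier R" for u v s t
    using that yc unfolding P_def by (simp add: finsum_lincomb)
  have der: "P (\<lambda>j. \<partial> (u j))" if "P u" for u
    unfolding P_def
  proof (intro conjI allI impI)
    have uc: "u j \<in> carrier R" "\<partial> (u j) \<in> carrier R" for j
      using that by (auto simp: P_def intro: deriv_closed)
    then show "\<partial> (u j) \<in> carrier R" for j by blast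
    have next0: "(\<Oplus>j\<in>J. u j \<otimes> (deriv R ^^ Suc i) (y j)) = \<zero>" if "i < n" for i
    proof (cases "Suc i < n")
      case True
      then show ?thesis using \<open>P u\<close> unfolding P_def by blast
    next
      case False
      then have n: "Suc i = n" using that by simp
      have sol: "(deriv R ^^ n) (y j) = \<ominus> (\<Oplus>k\<in>{..<n}. a k \<otimes> (deriv R ^^ k) (y j))" if "j \<in> J" for j
        using y[OF that] yc[OF that] a
        by (auto simp: lin_diff_solutions_def intro!: minus_equality[symmetric] finsum_closed)
      have "(\<Oplus>j\<in>J. u j \<otimes> (deriv R ^^ n) (y j))
          = (\<Oplus>j\<in>J. \<Oplus>k\<in>{..<n}. (\<ominus> a k) \<otimes> (u j \<otimes> (deriv R ^^ k) (y j)))"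
      proof (intro finsum_cong')
        fix j assume j: "j \<in> J"
        have "u j \<otimes> (deriv R ^^ n) (y j) = (\<ominus> u j) \<otimes> (\<Oplus>k\<in>{..<n}. a k \<otimes> (deriv R ^^ k) (y j))"
          using sol[OF j] uc yc[OF j] a by (simp add: l_minus r_minus Pi_def)
        also have "\<dots> = (\<Oplus>k\<in>{..<n}. (\<ominus> u j) \<otimes> (a k \<otimes> (deriv R ^^ k) (y j)))"
          using uc yc[OF j] a by (intro finsum_rdistr) auto
        also have "\<dots> = (\<Oplus>k\<in>{..<n}. (\<ominus> a k) \<otimes> (u j \<otimes> (deriv R ^^ k) (y j)))"
          using uc yc[OF j] a by (intro finsum_cong') (auto simp: l_minus r_minus m_lcomm)
        finally show "u j \<otimes> (deriv R ^^ n) (y j) = \<dots>" .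
      qed (use uc yc a in \<open>auto intro!: finsum_closed\<close>)
      also have "\<dots> = (\<Oplus>k\<in>{..<n}. \<Oplus>j\<in>J. (\<ominus> a k) \<otimes> (u j \<otimes> (deriv R ^^ k) (y j)))"
        using uc yc a \<open>finite J\<close> by (intro finsum_swap) auto
      also have "\<dots> = (\<Oplus>k\<in>{..<n}. (\<ominus> a k) \<otimes> (\<Oplus>j\<in>J. u j \<otimes> (deriv R ^^ k) (y j)))"
        using uc yc a \<open>finite J\<close>
        by (intro finsum_cong') (auto intro!: finsum_closed finsum_rdistr[symmetric])
      also have "\<dots> = (\<Oplus>k\<in>{..<n}. \<zero>)"
        using \<open>P u\<close> a by (intro finsum_cong') (auto simp: P_def)
      finally show ?thesis using n by (simp add: finsum_zero)
    qed
    fix i assume i: "i < n"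
    have "\<partial> (\<Oplus>j\<in>J. u j \<otimes> (deriv R ^^ i) (y j)) = (\<Oplus>j\<in>J. \<partial> (u j \<otimes> (deriv R ^^ i) (y j)))"
      using uc yc by (intro deriv_finsum) auto
    also have "\<dots> = (\<Oplus>j\<in>J. \<partial> (u j) \<otimes> (deriv R ^^ i) (y j) \<oplus> u j \<otimes> (deriv R ^^ Suc i) (y j))"
      using uc yc yc[of _ "Suc i"] by (intro finsum_cong') (auto simp: deriv_mult)
    also have "\<dots> = (\<Oplus>j\<in>J. \<partial> (u j) \<otimes> (deriv R ^^ i) (y j)) \<oplus> (\<Oplus>j\<in>J. u j \<otimes> (deriv R ^^ Suc i) (y j))"
      using uc yc yc[of _ "Suc i"] by (intro finsum_addf) auto
    finally have split: "\<partial> (\<Oplus>j\<in>J. u j \<otimes> (deriv R ^^ i) (y j))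
        = (\<Oplus>j\<in>J. \<partial> (u j) \<otimes> (deriv R ^^ i) (y j)) \<oplus> (\<Oplus>j\<in>J. u j \<otimes> (deriv R ^^ Suc i) (y j))" .
    have "(\<Oplus>j\<in>J. u j \<otimes> (deriv R ^^ i) (y j)) = \<zero>" using \<open>P u\<close> i unfolding P_def by blast
    moreover have "(\<Oplus>j\<in>J. \<partial> (u j) \<otimes> (deriv R ^^ i) (y j)) \<in> carrier R"
      using uc yc by (intro finsum_closed) auto
    ultimately show "(\<Oplus>j\<in>J. \<partial> (u j) \<otimes> (deriv R ^^ i) (y j)) = \<zero>"
      using split next0[OF i] by (metis deriv_zero r_zero)
  qed
  have P_stable: "derivation_stable_subspace P"
    unfolding derivation_stable_subspace_def using lin der by (auto simp: P_def)
  have inv: "inv (u l) \<in> carrier R" "inv (u l) \<otimes> u l = \<one>" using u field_Units by auto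
  have "P u" using u dep by (simp add: P_def)
  then have "P (\<lambda>j. inv (u l) \<otimes> u j \<oplus> \<zero> \<otimes> u j)" using lin inv by blast
  then show ?thesis
    using constant_vector_with_unit_entry[of J P "\<lambda>j. inv (u l) \<otimes> u j \<oplus> \<zero> \<otimes> u j" l,
          OF \<open>finite J\<close> P_stable] u inv unfolding P_def by auto
qed

end

text \<open>
  Row \<open>j\<close> of the inverse of \<open>Z\<close> comes from a nontrivial relation between the \<open>n\<close> rows of \<open>Z\<close> and the
  negative of the \<open>j\<close>-th unit vector; the last coefficient of the relation is nonzero because the rows
  are independent.
\<close>

lemma (in field) invertible_if_trivial_kernel:
  assumes Z: "\<And>k j. k < n \<Longrightarrow> j < n \<Longrightarrow> Z k j \<in> carrier R"
    and inj: "\<And>u k. (\<And>k. u k \<in> carrier R) \<Longrightarrow>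
      (\<And>j. j < n \<Longrightarrow> (\<Oplus>k\<in>{..<n}. u k \<otimes> Z k j) = \<zero>) \<Longrightarrow> k < n \<Longrightarrow> u k = \<zero>"
  shows "\<exists>B :: nat \<Rightarrow> nat \<Rightarrow> 'a. (\<forall>j k. B j k \<in> carrier R) \<and>
    (\<forall>x. (\<forall>j. x j \<in> carrier R) \<longrightarrow>
      (\<forall>i<n. (\<Oplus>k\<in>{..<n}. (\<Oplus>j\<in>{..<n}. x j \<otimes> B j k) \<otimes> Z k i) = x i))"
proof -
  have "\<exists>b. (\<forall>k. b k \<in> carrier R) \<and>
    (\<forall>i<n. (\<Oplus>k\<in>{..<n}. b k \<otimes> Z k i) = (if i = j then \<one> else \<zero>))" if "j < n" for j
  proof -
    define M where "M i k = (if k < n then Z k i else \<ominus> (if i = j then \<one> else \<zero>))" for i k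
    have "M i k \<in> carrier R" if "i < n" "k \<in> {..n}" for i k using Z that by (auto simp: M_def)
    then have "\<exists>d. (\<forall>k. d k \<in> carrier R) \<and> (\<exists>k\<in>{..n}. d k \<noteq> \<zero>) \<and>
        (\<forall>i<n. (\<Oplus>k\<in>{..n}. M i k \<otimes> d k) = \<zero>)"
      by (intro homogeneous_system_nontrivial_solution[OF carrier_is_subfield]) auto
    then obtain d where d: "\<And>k. d k \<in> carrier R" "\<exists>k\<in>{..n}. d k \<noteq> \<zero>"
      "\<And>i. i < n \<Longrightarrow> (\<Oplus>k\<in>{..n}. M i k \<otimes> d k) = \<zero>" by blast
    have sum: "(\<Oplus>k\<in>{..<n}. d k \<otimes> Z k i) = (if i = j then d n else \<zero>)" if "i < n" for i
    proof -
      have "(\<Oplus>k\<in>{..n}. M i k \<otimes> d k) = M i n \<otimes> d n \<oplus> (\<Oplus>k\<in>{..<n}. M i k \<otimes> d k)"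
        using that Z d by (intro add.finprod_Suc3) (auto simp: M_def)
      also have "(\<Oplus>k\<in>{..<n}. M i k \<otimes> d k) = (\<Oplus>k\<in>{..<n}. d k \<otimes> Z k i)"
        using that Z d by (intro finsum_cong') (auto simp: M_def m_comm)
      finally have "M i n \<otimes> d n \<oplus> (\<Oplus>k\<in>{..<n}. d k \<otimes> Z k i) = \<zero>" using d(3)[OF that] by simp
      moreover have "(\<Oplus>k\<in>{..<n}. d k \<otimes> Z k i) \<in> carrier R"
        using d(1) Z that by (intro finsum_closed) auto
      ultimately show ?thesis using d(1)
        by (auto simp: M_def l_minus split: if_splits)
          (metis minus_equality minus_minus a_comm add.inv_closed)
    qed
    have dn: "d n \<noteq> \<zero>"
    proof
      assume "d n = \<zero>"
      then have "d k = \<zero>" if "k < n" for k using inj[of d k] sum d(1) that by auto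
      then show False using d(2) \<open>d n = \<zero>\<close> by (metis atMost_iff le_neq_implies_less)
    qed
    then have inv: "inv (d n) \<in> carrier R" "inv (d n) \<otimes> d n = \<one>" using d(1) field_Units by auto
    have "(\<Oplus>k\<in>{..<n}. (inv (d n) \<otimes> d k) \<otimes> Z k i) = (if i = j then \<one> else \<zero>)" if "i < n" for i
    proof -
      have "(\<Oplus>k\<in>{..<n}. (inv (d n) \<otimes> d k) \<otimes> Z k i) = (\<Oplus>k\<in>{..<n}. inv (d n) \<otimes> (d k \<otimes> Z k i))"
        using that Z d inv by (intro finsum_cong') (auto simp: m_assoc)
      also have "\<dots> = inv (d n) \<otimes> (\<Oplus>k\<in>{..<n}. d k \<otimes> Z k i)"
        using that Z d inv by (intro finsum_rdistr[symmetric]) auto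
      finally show ?thesis using sum[OF that] inv by simp
    qed
    then show ?thesis using d(1) inv by (intro exI[of _ "\<lambda>k. inv (d n) \<otimes> d k"]) auto
  qed
  then obtain B where B: "\<And>j k. j < n \<Longrightarrow> B j k \<in> carrier R"
    "\<And>j i. j < n \<Longrightarrow> i < n \<Longrightarrow> (\<Oplus>k\<in>{..<n}. B j k \<otimes> Z k i) = (if i = j then \<one> else \<zero>)"
    by metis
  define B' where "B' j k = (if j < n then B j k else \<zero>)" for j k
  have "(\<Oplus>k\<in>{..<n}. (\<Oplus>j\<in>{..<n}. x j \<otimes> B' j k) \<otimes> Z k i) = x i"
    if x: "\<forall>j. x j \<in> carrier R" and i: "i < n" for x i
  proof -
    have "(\<Oplus>k\<in>{..<n}. (\<Oplus>j\<in>{..<n}. x j \<otimes> B' j k) \<otimes> Z k i)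
        = (\<Oplus>k\<in>{..<n}. \<Oplus>j\<in>{..<n}. x j \<otimes> (B j k \<otimes> Z k i))"
    proof (rule finsum_cong')
      fix k assume k: "k \<in> {..<n}"
      have "(\<Oplus>j\<in>{..<n}. x j \<otimes> B' j k) \<otimes> Z k i = (\<Oplus>j\<in>{..<n}. (x j \<otimes> B' j k) \<otimes> Z k i)"
        using x i k Z B by (intro finsum_ldistr) (auto simp: B'_def)
      also have "\<dots> = (\<Oplus>j\<in>{..<n}. x j \<otimes> (B j k \<otimes> Z k i))"
        using x i k Z B by (intro finsum_cong') (auto simp: B'_def m_assoc)
      finally show "(\<Oplus>j\<in>{..<n}. x j \<otimes> B' j k) \<otimes> Z k i = \<dots>" .
    qed (use x i Z B in \<open>auto intro!: finsum_closed\<close>)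
    also have "\<dots> = (\<Oplus>j\<in>{..<n}. \<Oplus>k\<in>{..<n}. x j \<otimes> (B j k \<otimes> Z k i))"
      using x i Z B by (intro finsum_swap) auto
    also have "\<dots> = (\<Oplus>j\<in>{..<n}. if i = j then x j else \<zero>)"
    proof (rule finsum_cong')
      fix j assume j: "j \<in> {..<n}"
      have "(\<Oplus>k\<in>{..<n}. x j \<otimes> (B j k \<otimes> Z k i)) = x j \<otimes> (\<Oplus>k\<in>{..<n}. B j k \<otimes> Z k i)"
        using x i j Z B by (intro finsum_rdistr[symmetric]) auto
      then show "(\<Oplus>k\<in>{..<n}. x j \<otimes> (B j k \<otimes> Z k i)) = (if i = j then x j else \<zero>)"
        using B(2) x i j by auto
    qed (use x in auto)
    also have "\<dots> = x i" using x i by (intro finsum_singleton) auto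
    finally show ?thesis .
  qed
  then show ?thesis using B(1) by (intro exI[of _ B']) (auto simp: B'_def)
qed

context differential_field
begin

lemma solution_deriv_closed:
  "y \<in> lin_diff_solutions R (carrier R) n a \<Longrightarrow> (deriv R ^^ i) y \<in> carrier R"
  by (auto simp: lin_diff_solutions_def intro: deriv_iterate_closed)

definition fundamental_system :: "nat \<Rightarrow> (nat \<Rightarrow> 'a) \<Rightarrow> (nat \<Rightarrow> 'a) \<Rightarrow> bool" where
  "fundamental_system n a z \<longleftrightarrow>
    (\<forall>k<n. z k \<in> lin_diff_solutions R (carrier R) n a) \<and>
    (\<forall>e. (\<forall>k. e k \<in> constants R (carrier R)) \<longrightarrow> (\<Oplus>k\<in>{..<n}. e k \<otimes> z k) = \<zero> \<longrightarrow> (\<forall>k<n. e k = \<zero>))"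

lemma fundamental_system_independent:
  assumes z: "fundamental_system n a z"
    and e: "\<And>k. k < n \<Longrightarrow> e k \<in> constants R (carrier R)"
    and sum: "(\<Oplus>k\<in>{..<n}. e k \<otimes> z k) = \<zero>" and "k < n"
  shows "e k = \<zero>"
proof -
  define e' where "e' j = (if j < n then e j else \<zero>)" for j
  have zc: "z k \<in> carrier R" if "k < n" for k
    using z that by (simp add: fundamental_system_def lin_diff_solutions_def)
  have ec: "e k \<in> carrier R" if "k < n" for k using e[OF that] by (simp add: constants_def)
  have "(\<Oplus>j\<in>{..<n}. e' j \<otimes> z j) = (\<Oplus>j\<in>{..<n}. e j \<otimes> z j)"
    using ec zc by (intro finsum_cong') (auto simp: e'_def)
  then have s: "(\<Oplus>j\<in>{..<n}. e' j \<otimes> z j) = \<zero>" using sum by simp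
  have "\<forall>j. e' j \<in> constants R (carrier R)" using e by (simp add: e'_def constants_def)
  then have "e' k = \<zero>" using z s \<open>k < n\<close> unfolding fundamental_system_def by blast
  then show ?thesis using \<open>k < n\<close> by (simp add: e'_def)
qed

text \<open>
  The Wronskian matrix of a fundamental system is invertible: a relation between its rows would yield
  one with constant coefficients, hence one between the solutions themselves.
\<close>

lemma wronskian_independent:
  assumes z: "fundamental_system n a z"
    and a: "\<And>i. i < n \<Longrightarrow> a i \<in> carrier R"
    and u: "\<And>k. u k \<in> carrier R"
    and "\<And>i. i < n \<Longrightarrow> (\<Oplus>k\<in>{..<n}. u k \<otimes> (deriv R ^^ i) (z k)) = \<zero>" and "k < n"
  shows "u k = \<zero>"
proof (rule ccontr)
  assume "u k \<noteq> \<zero>"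
  moreover have "z j \<in> lin_diff_solutions R (carrier R) n a" if "j \<in> {..<n}" for j
    using z that by (simp add: fundamental_system_def)
  ultimately obtain e where e:
    "\<forall>j. e j \<in> carrier R" "e k = \<one>" "\<forall>j\<in>{..<n}. \<partial> (e j) = \<zero>"
    "\<forall>i<n. (\<Oplus>j\<in>{..<n}. e j \<otimes> (deriv R ^^ i) (z j)) = \<zero>"
    using wronskian_dependence[of "{..<n}" z n a u k] assms by blast
  have "(\<Oplus>j\<in>{..<n}. e j \<otimes> z j) = \<zero>" using e(4)[rule_format, of 0] \<open>k < n\<close> by simp
  then have "e k = \<zero>"
    using fundamental_system_independent[OF z _ _ \<open>k < n\<close>, of e] e(1,3) by (simp add: constants_def)
  then show False using e(2) by simp
qed

text \<open>
  The jets of \<open>n + 1\<close> solutions are vectors of length \<open>n\<close>, so they are dependent, and then dependent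
  over the constants. The coefficient of \<open>y\<close> in the relation is nonzero because the \<open>z k\<close> are
  independent.
\<close>

lemma solution_in_span_of_fundamental_system:
  assumes z: "fundamental_system n a z"
    and a: "\<And>i. i < n \<Longrightarrow> a i \<in> carrier R"
    and y: "y \<in> lin_diff_solutions R (carrier R) n a"
  shows "\<exists>c. (\<forall>k. c k \<in> constants R (carrier R)) \<and> y = (\<Oplus>k\<in>{..<n}. c k \<otimes> z k)"
proof (cases "n = 0")
  case True
  then show ?thesis using y
    by (intro exI[of _ "\<lambda>_. \<zero>"]) (auto simp: lin_diff_solutions_def constants_def)
next
  case False
  define w where "w k = (if k < n then z k else y)" for k
  have w: "w k \<in> lin_diff_solutions R (carrier R) n a" for k
    using z y by (auto simp: w_def fundamental_system_def)
  have wc: "(deriv R ^^ i) (w k) \<in> carrier R" for i k using solution_deriv_closed[OF w] .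
  obtain u where u: "\<And>k. u k \<in> carrier R" "\<exists>k\<in>{..n}. u k \<noteq> \<zero>"
    "\<And>i. i < n \<Longrightarrow> (\<Oplus>k\<in>{..n}. (deriv R ^^ i) (w k) \<otimes> u k) = \<zero>"
    using homogeneous_system_nontrivial_solution[OF carrier_is_subfield, of "{..n}" n
        "\<lambda>i k. (deriv R ^^ i) (w k)"] wc by auto
  then obtain l where l: "l \<in> {..n}" "u l \<noteq> \<zero>" by blast
  have "(\<Oplus>k\<in>{..n}. u k \<otimes> (deriv R ^^ i) (w k)) = \<zero>" if "i < n" for i
  proof -
    have "(\<Oplus>k\<in>{..n}. u k \<otimes> (deriv R ^^ i) (w k)) = (\<Oplus>k\<in>{..n}. (deriv R ^^ i) (w k) \<otimes> u k)"
      using wc u(1) by (intro finsum_cong') (auto simp: m_comm)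
    then show ?thesis using u(3)[OF that] by simp
  qed
  with wronskian_dependence[of "{..n}" w n a u l] w a u l obtain e where e:
    "\<And>j. e j \<in> carrier R" "e l = \<one>" "\<forall>j\<in>{..n}. \<partial> (e j) = \<zero>"
    "\<forall>i<n. (\<Oplus>j\<in>{..n}. e j \<otimes> (deriv R ^^ i) (w j)) = \<zero>" by auto
  have yc: "y \<in> carrier R" using y by (simp add: lin_diff_solutions_def)
  have zc: "z k \<in> carrier R" if "k < n" for k
    using z that by (simp add: fundamental_system_def lin_diff_solutions_def)
  define S where "S = (\<Oplus>k\<in>{..<n}. e k \<otimes> z k)"
  have Sc: "S \<in> carrier R" using e(1) zc unfolding S_def by (intro finsum_closed) auto
  have "(\<Oplus>j\<in>{..n}. e j \<otimes> (deriv R ^^ 0) (w j)) = \<zero>" using e(4) False by blast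
  moreover have "(\<Oplus>j\<in>{..n}. e j \<otimes> (deriv R ^^ 0) (w j))
      = e n \<otimes> w n \<oplus> (\<Oplus>j\<in>{..<n}. e j \<otimes> w j)"
    using e(1) wc[of 0] by (simp add: add.finprod_Suc3 Pi_def)
  moreover have "(\<Oplus>j\<in>{..<n}. e j \<otimes> w j) = S"
    unfolding S_def using e(1) zc by (intro finsum_cong') (auto simp: w_def)
  ultimately have rel: "e n \<otimes> y \<oplus> S = \<zero>" by (simp add: w_def)
  have en: "e n \<noteq> \<zero>"
  proof
    assume 0: "e n = \<zero>"
    then have "S = \<zero>" using rel yc Sc by simp
    then have "e k = \<zero>" if "k < n" for k
      using fundamental_system_independent[OF z _ _ that, of e] e(1,3) by (simp add: constants_def S_def)
    then show False using e(2) l 0 by (cases "l = n") auto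
  qed
  then have inv: "inv (e n) \<in> carrier R" "inv (e n) \<otimes> e n = \<one>" using e(1) field_Units by auto
  have "inv (e n) \<otimes> (e n \<otimes> y \<oplus> S) = (inv (e n) \<otimes> e n) \<otimes> y \<oplus> inv (e n) \<otimes> S"
    using e(1) inv(1) yc Sc by algebra
  then have "y = (\<ominus> (inv (e n))) \<otimes> S"
    using rel inv yc Sc minus_equality[of y "inv (e n) \<otimes> S"] by (simp add: l_minus)
  also have "\<dots> = (\<Oplus>k\<in>{..<n}. (\<ominus> (inv (e n))) \<otimes> (e k \<otimes> z k))"
    unfolding S_def using e(1) zc inv by (intro finsum_rdistr) auto
  also have "\<dots> = (\<Oplus>k\<in>{..<n}. (if k < n then (\<ominus> (inv (e n))) \<otimes> e k else \<zero>) \<otimes> z k)"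
    using e(1) zc inv by (intro finsum_cong') (auto simp: m_assoc)
  finally have y_eq: "y = \<dots>" .
  have const: "e k \<in> constants R (carrier R)" if "k \<le> n" for k
    using e that by (auto simp: constants_def)
  have "inv (e n) \<in> constants R (carrier R)"
    using subfield_m_inv(1)[OF subfield_constants] const[of n] en by blast
  then have "\<forall>k. (if k < n then (\<ominus> (inv (e n))) \<otimes> e k else \<zero>) \<in> constants R (carrier R)"
    using const subringE[OF subfieldE(1)[OF subfield_constants]] by auto
  then show ?thesis using y_eq by (intro exI) auto
qed

lemma combine_take_eq_finsum:
  assumes "set Ks \<subseteq> carrier R" "set Us \<subseteq> carrier R" "m \<le> length Us" "length Ks = length Us"
  shows "combine (take m Ks) (take m Us) = (\<Oplus>k\<in>{..<m}. Ks ! k \<otimes> Us ! k)"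
  using assms(3)
proof (induction m)
  case (Suc m)
  have c: "Ks ! k \<in> carrier R" "Us ! k \<in> carrier R" if "k \<le> m" for k
    using assms Suc.prems that nth_mem[of k] by auto
  have "combine (take (Suc m) Ks) (take (Suc m) Us)
      = combine (take m Ks) (take m Us) \<oplus> combine [Ks ! m] [Us ! m]"
    using Suc.prems assms c set_take_subset[of m Ks] set_take_subset[of m Us]
    by (subst combine_append) (auto simp: take_Suc_conv_app_nth)
  then show ?case using Suc c by (simp add: lessThan_Suc Pi_def a_comm)
qed auto

text \<open>
  Turns the dimension in the notion of a full set of solutions into a basis. Since \<open>N\<close> has all
  constants of \<open>R\<close>, a basis of the solutions in \<open>N\<close> is one of all solutions in \<open>R\<close>.
\<close>

lemma full_set_imp_fundamental_system:
  assumes "constants R N = constants R (carrier R)" "N \<subseteq> carrier R"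
    and full: "full_set_of_solutions R N n a"
  shows "\<exists>z. fundamental_system n a z \<and> (\<forall>k<n. z k \<in> lin_diff_solutions R N n a)"
proof -
  let ?C = "constants R (carrier R)"
  note C = subfield_constants
  obtain Vs where Vs: "set Vs \<subseteq> carrier R" "independent ?C Vs" "length Vs = n"
      "Span ?C Vs = lin_diff_solutions R N n a"
    using full assms(1) exists_base[OF C] unfolding full_set_of_solutions_def by metis
  have mem: "Vs ! k \<in> lin_diff_solutions R N n a" if "k < n" for k
  proof -
    have "Vs ! k \<in> set Vs" using that Vs(3) by simp
    then show ?thesis using Span_base_incl[OF C Vs(1)] Vs(4) by (metis subsetD)
  qed
  have indep: "e k = \<zero>" if e: "\<forall>k. e k \<in> ?C" "(\<Oplus>k\<in>{..<n}. e k \<otimes> Vs ! k) = \<zero>" "k < n" for e k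
  proof -
    have ec: "e k \<in> carrier R" for k using e(1) by (auto simp: constants_def)
    have "(\<Oplus>k\<in>{..<n}. map e [0..<n] ! k \<otimes> Vs ! k) = (\<Oplus>k\<in>{..<n}. e k \<otimes> Vs ! k)"
      using ec Vs(1,3) by (intro finsum_cong') (auto simp: subset_iff)
    moreover have "combine (take n (map e [0..<n])) (take n Vs)
        = (\<Oplus>k\<in>{..<n}. map e [0..<n] ! k \<otimes> Vs ! k)"
      using ec Vs by (intro combine_take_eq_finsum) auto
    ultimately have 0: "combine (map e [0..<n]) Vs = \<zero>" using e(2) Vs(3) by simp
    have "set (take (length Vs) (map e [0..<n])) \<subseteq> {\<zero>}"
      by (rule independent_imp_trivial_combine[OF C Vs(2) _ 0]) (use e(1) in auto)
    moreover have "e k \<in> set (take (length Vs) (map e [0..<n]))" using \<open>k < n\<close> Vs(3) by simp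
    ultimately show ?thesis by blast
  qed
  have incl: "lin_diff_solutions R N n a \<subseteq> lin_diff_solutions R (carrier R) n a"
    using assms(2) by (auto simp: lin_diff_solutions_def)
  have "fundamental_system n a ((!) Vs)"
    unfolding fundamental_system_def
  proof (intro conjI allI impI)
    show "Vs ! k \<in> lin_diff_solutions R (carrier R) n a" if "k < n" for k
      using mem[OF that] incl by (rule subsetD[rotated])
    show "e k = \<zero>" if "\<forall>k. e k \<in> ?C" "(\<Oplus>k\<in>{..<n}. e k \<otimes> Vs ! k) = \<zero>" "k < n" for e k
      using indep[OF that] .
  qed
  then show ?thesis using mem by (intro exI[of _ "(!) Vs"]) simp
qed

end

section \<open>Polynomial expressions\<close>

text \<open>
  Expressions represent polynomials in countably many variables. Two expressions are regarded as the
  same polynomial when they have equal values on a sufficiently large set of points. The coefficients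
  of \<open>p\<close> are collected by \<open>set_pexp\<close>, so \<open>set_pexp p \<subseteq> D\<close> says that \<open>p\<close> is a polynomial over \<open>D\<close>.
\<close>

datatype 'a pexp = Const 'a | Var nat | Add "'a pexp" "'a pexp" | Mul "'a pexp" "'a pexp"

primrec psubst :: "(nat \<Rightarrow> 'a pexp) \<Rightarrow> 'a pexp \<Rightarrow> 'a pexp" where
  "psubst s (Const c) = Const c"
| "psubst s (Var i) = s i"
| "psubst s (Add p q) = Add (psubst s p) (psubst s q)"
| "psubst s (Mul p q) = Mul (psubst s p) (psubst s q)"

lemma set_psubst: "set_pexp p \<subseteq> K \<Longrightarrow> (\<And>i. set_pexp (s i) \<subseteq> K) \<Longrightarrow> set_pexp (psubst s p) \<subseteq> K"
  by (induction p) auto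

context ring
begin

primrec ev :: "(nat \<Rightarrow> 'a) \<Rightarrow> 'a pexp \<Rightarrow> 'a" where
  "ev x (Const c) = c"
| "ev x (Var i) = x i"
| "ev x (Add p q) = ev x p \<oplus> ev x q"
| "ev x (Mul p q) = ev x p \<otimes> ev x q"

primrec linear_form :: "(nat \<Rightarrow> 'a) \<Rightarrow> nat \<Rightarrow> 'a pexp" where
  "linear_form d 0 = Const \<zero>"
| "linear_form d (Suc k) = Add (Mul (Const (d k)) (Var k)) (linear_form d k)"

primrec pexp_power :: "'a pexp \<Rightarrow> nat \<Rightarrow> 'a pexp" where
  "pexp_power p 0 = Const \<one>"
| "pexp_power p (Suc k) = Mul p (pexp_power p k)"

text \<open>
  The affine space \<open>S\<^sup>n\<close>. Coordinates with index at least \<open>n\<close> are zero, so that points are equal as soon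
  as their first \<open>n\<close> coordinates are.
\<close>

definition points :: "nat \<Rightarrow> 'a set \<Rightarrow> (nat \<Rightarrow> 'a) set" where
  "points n S = {x. (\<forall>i<n. x i \<in> S) \<and> (\<forall>i\<ge>n. x i = \<zero>)}"

lemma points_mono: "S \<subseteq> T \<Longrightarrow> points n S \<subseteq> points n T"
  by (auto simp: points_def)

lemma points_in_subring: "subring K R \<Longrightarrow> x \<in> points n K \<Longrightarrow> x i \<in> K"
  using subringE(2)[of K R] by (cases "i < n") (auto simp: points_def)

lemma points_carrier: "x \<in> points n (carrier R) \<Longrightarrow> x i \<in> carrier R"
  using points_in_subring[OF carrier_is_subring] .

lemma ev_in_subring:
  assumes "subring K R" "\<And>i. x i \<in> K" "set_pexp p \<subseteq> K"
  shows "ev x p \<in> K"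
  using assms(3) subringE(6,7)[OF assms(1)] assms(2) by (induction p) auto

lemma ev_closed: "(\<And>i. x i \<in> carrier R) \<Longrightarrow> set_pexp p \<subseteq> carrier R \<Longrightarrow> ev x p \<in> carrier R"
  using ev_in_subring[OF carrier_is_subring] .

lemma ev_psubst: "ev x (psubst s p) = ev (\<lambda>i. ev x (s i)) p"
  by (induction p) auto

lemma ev_linear_form:
  "(\<And>k. k < m \<Longrightarrow> d k \<in> carrier R) \<Longrightarrow> (\<And>k. x k \<in> carrier R) \<Longrightarrow>
    ev x (linear_form d m) = (\<Oplus>k\<in>{..<m}. d k \<otimes> x k)"
  by (induction m) (auto simp: lessThan_Suc Pi_def)

lemma set_linear_form: "subring K R \<Longrightarrow> (\<And>k. k < m \<Longrightarrow> d k \<in> K) \<Longrightarrow> set_pexp (linear_form d m) \<subseteq> K"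
  using subringE(2)[of K R] by (induction m) auto

lemma set_pexp_power: "subring K R \<Longrightarrow> set_pexp p \<subseteq> K \<Longrightarrow> set_pexp (pexp_power p k) \<subseteq> K"
  using subringE(3)[of K R] by (induction k) auto

end

lemma (in cring) ev_pexp_power:
  "(\<And>k. x k \<in> carrier R) \<Longrightarrow> set_pexp p \<subseteq> carrier R \<Longrightarrow> ev x (pexp_power p k) = ev x p [^] k"
  using ev_closed by (induction k) (auto simp: m_comm)

context domain
begin

text \<open>
  Along a line parallel to a coordinate axis, an expression is a polynomial in one variable, to which
  the bound on the number of roots applies.
\<close>

lemma ev_univariate:
  assumes "set_pexp h \<subseteq> carrier R" "\<And>i. x i \<in> carrier R"
  shows "\<exists>q \<in> carrier (poly_ring R). \<forall>t \<in> carrier R. eval q t = ev (x(k := t)) h"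
  using assms(1)
proof (induction h)
  case (Const c)
  then show ?case
    by (intro bexI[of _ "if c = \<zero> then [] else [c]"])
      (auto simp: univ_poly_carrier[symmetric] polynomial_def)
next
  case (Var i)
  show ?case
  proof (cases "i = k")
    case True
    then show ?thesis using eval_var var_closed(1)[OF carrier_is_subring] by auto
  next
    case False
    then show ?thesis using assms(2)[of i]
      by (intro bexI[of _ "if x i = \<zero> then [] else [x i]"])
        (auto simp: univ_poly_carrier[symmetric] polynomial_def)
  qed
next
  case (Add p q)
  then have "set_pexp p \<subseteq> carrier R" "set_pexp q \<subseteq> carrier R" by simp_all
  with Add.IH obtain f g where "f \<in> carrier (poly_ring R)" "\<forall>t \<in> carrier R. eval f t = ev (x(k := t)) p"
    "g \<in> carrier (poly_ring R)" "\<forall>t \<in> carrier R. eval g t = ev (x(k := t)) q" by meson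
  moreover have "f \<oplus>\<^bsub>poly_ring R\<^esub> g \<in> carrier (poly_ring R)"
    using univ_poly_is_ring[OF carrier_is_subring] \<open>f \<in> _\<close> \<open>g \<in> _\<close> by (simp add: ring.ring_simprules)
  ultimately show ?case
    using ring_hom_memE(3)[OF eval_is_hom[OF carrier_is_subring]]
    by (intro bexI[of _ "f \<oplus>\<^bsub>poly_ring R\<^esub> g"]) (auto simp del: fun_upd_apply)
next
  case (Mul p q)
  then have "set_pexp p \<subseteq> carrier R" "set_pexp q \<subseteq> carrier R" by simp_all
  with Mul.IH obtain f g where "f \<in> carrier (poly_ring R)" "\<forall>t \<in> carrier R. eval f t = ev (x(k := t)) p"
    "g \<in> carrier (poly_ring R)" "\<forall>t \<in> carrier R. eval g t = ev (x(k := t)) q" by meson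
  moreover have "f \<otimes>\<^bsub>poly_ring R\<^esub> g \<in> carrier (poly_ring R)"
    using univ_poly_is_ring[OF carrier_is_subring] \<open>f \<in> _\<close> \<open>g \<in> _\<close> by (simp add: ring.ring_simprules)
  ultimately show ?case
    using ring_hom_memE(2)[OF eval_is_hom[OF carrier_is_subring]]
    by (intro bexI[of _ "f \<otimes>\<^bsub>poly_ring R\<^esub> g"]) (auto simp del: fun_upd_apply)
qed

text \<open>
  The coordinates are released from \<open>S\<close> one after the other; as a function of a single coordinate, the
  value is a polynomial with infinitely many roots.
\<close>

lemma vanishing_on_infinite_grid:
  assumes h: "set_pexp h \<subseteq> carrier R"
    and S: "S \<subseteq> carrier R" "infinite S"
    and zero: "\<And>x. x \<in> points n S \<Longrightarrow> ev x h = \<zero>"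
    and x: "x \<in> points n (carrier R)"
  shows "ev x h = \<zero>"
proof -
  have "\<forall>x. (\<forall>i<k. x i \<in> carrier R) \<longrightarrow> (\<forall>i. k \<le> i \<and> i < n \<longrightarrow> x i \<in> S) \<longrightarrow> (\<forall>i\<ge>n. x i = \<zero>) \<longrightarrow>
    ev x h = \<zero>" if "k \<le> n" for k
    using that
  proof (induction k)
    case 0
    then show ?case using zero by (simp add: points_def)
  next
    case (Suc k)
    show ?case
    proof (intro allI impI)
      fix x assume x: "\<forall>i<Suc k. x i \<in> carrier R" "\<forall>i. Suc k \<le> i \<and> i < n \<longrightarrow> x i \<in> S" "\<forall>i\<ge>n. x i = \<zero>"
      have xc: "x i \<in> carrier R" for i
        using x S(1) by (cases "i < Suc k"; cases "i < n") auto
      obtain q where q: "q \<in> carrier (poly_ring R)" "\<forall>t \<in> carrier R. eval q t = ev (x(k := t)) h"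
        using ev_univariate[OF h, of x k] xc by blast
      have root: "eval q t = \<zero>" if "t \<in> S" for t
      proof -
        have "ev (x(k := t)) h = \<zero>"
          using Suc.IH Suc.prems x that by auto
        then show ?thesis using q that S(1) by auto
      qed
      have "q = []"
      proof (rule ccontr)
        assume "q \<noteq> []"
        then have "S \<subseteq> {t. is_root q t}" using root S(1) by (auto simp: is_root_def)
        then show False using finite_number_of_roots[OF q(1)] S(2) finite_subset by blast
      qed
      then have "ev (x(k := x k)) h = \<zero>" using q(2) xc[of k] by (metis eval.simps(1))
      then show "ev x h = \<zero>" by simp
    qed
  qed
  from this[OF order_refl] x show ?thesis by (auto simp: points_def)
qed

end

section \<open>Formal derivation\<close>

context differential_field
begin

lemma infinite_constants: "infinite (constants R (carrier R))"
proof -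
  have d: "\<partial> (add_pow R k \<one>) = \<zero>" for k :: nat
    by (induction k) (auto simp: deriv_add)
  have "inj (\<lambda>k :: nat. add_pow R k \<one>)"
  proof (rule linorder_injI)
    fix m k :: nat assume "m < k"
    show "add_pow R m \<one> \<noteq> add_pow R k \<one>"
    proof
      assume eq: "add_pow R m \<one> = add_pow R k \<one>"
      have "add_pow R k \<one> = add_pow R m \<one> \<oplus> add_pow R (k - m) \<one>"
        using \<open>m < k\<close> by (simp add: add.nat_pow_mult)
      then have "add_pow R (k - m) \<one> = \<zero>" using eq
        by (simp add: add.l_cancel_one')
      then show False using char_zero[of "k - m"] \<open>m < k\<close> by simp
    qed
  qed
  then have "infinite (range (\<lambda>k :: nat. add_pow R k \<one>))" by (rule range_inj_infinite)
  moreover have "range (\<lambda>k :: nat. add_pow R k \<one>) \<subseteq> constants R (carrier R)"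
    using d by (auto simp: constants_def)
  ultimately show ?thesis using finite_subset by blast
qed

text \<open>
  The derivation of \<open>D[Y\<^sub>0, \<dots>, Y\<^sub>n\<^sub>-\<^sub>1]\<close> given by the companion system of the equation with coefficients
  \<open>a\<close>: \<open>Y\<^sub>i\<close> has the derivative \<open>Y\<^sub>i\<^sub>+\<^sub>1\<close> for \<open>i + 1 < n\<close>, and \<open>Y\<^sub>n\<^sub>-\<^sub>1\<close> has the derivative
  \<open>- (a\<^sub>0 Y\<^sub>0 + \<dots> + a\<^sub>n\<^sub>-\<^sub>1 Y\<^sub>n\<^sub>-\<^sub>1)\<close>. It is made so that evaluation at the jet of a solution commutes with
  the derivations. Variables with index at least \<open>n\<close> stand for zero.
\<close>

primrec formal_deriv :: "nat \<Rightarrow> (nat \<Rightarrow> 'a) \<Rightarrow> 'a pexp \<Rightarrow> 'a pexp" where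
  "formal_deriv n a (Const c) = Const (\<partial> c)"
| "formal_deriv n a (Var i) = (if Suc i < n then Var (Suc i)
    else if Suc i = n then linear_form (\<lambda>j. \<ominus> a j) n else Const \<zero>)"
| "formal_deriv n a (Add p q) = Add (formal_deriv n a p) (formal_deriv n a q)"
| "formal_deriv n a (Mul p q) = Add (Mul (formal_deriv n a p) q) (Mul p (formal_deriv n a q))"

definition jet :: "nat \<Rightarrow> 'a \<Rightarrow> nat \<Rightarrow> 'a" where
  "jet n y i = (if i < n then (deriv R ^^ i) y else \<zero>)"

lemma jet_closed: "y \<in> carrier R \<Longrightarrow> jet n y i \<in> carrier R"
  by (simp add: jet_def deriv_iterate_closed)

lemma ev_formal_deriv:
  assumes y: "y \<in> lin_diff_solutions R (carrier R) n a"
    and a: "\<And>i. i < n \<Longrightarrow> a i \<in> carrier R"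
    and "set_pexp p \<subseteq> carrier R"
  shows "ev (jet n y) (formal_deriv n a p) = \<partial> (ev (jet n y) p)"
  using assms(3)
proof (induction p)
  case (Var i)
  have yc: "y \<in> carrier R" using y by (simp add: lin_diff_solutions_def)
  consider "Suc i < n" | "Suc i = n" | "n < Suc i" by linarith
  then show ?case
  proof cases
    case 2
    have "ev (jet n y) (formal_deriv n a (Var i)) = (\<Oplus>j\<in>{..<n}. \<ominus> a j \<otimes> jet n y j)"
      using 2 a jet_closed[OF yc] by (simp add: ev_linear_form)
    also have "\<dots> = (\<Oplus>j\<in>{..<n}. (\<ominus> \<one>) \<otimes> (a j \<otimes> (deriv R ^^ j) y))"
      using a deriv_iterate_closed[OF yc] by (intro finsum_cong') (auto simp: jet_def l_minus)
    also have "\<dots> = (\<ominus> \<one>) \<otimes> (\<Oplus>j\<in>{..<n}. a j \<otimes> (deriv R ^^ j) y)"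
      using a deriv_iterate_closed[OF yc] by (intro finsum_rdistr[symmetric]) auto
    also have "\<dots> = \<ominus> (\<Oplus>j\<in>{..<n}. a j \<otimes> (deriv R ^^ j) y)"
      using a deriv_iterate_closed[OF yc] by (simp add: l_minus Pi_def)
    also have "\<dots> = (deriv R ^^ n) y"
      using y a deriv_iterate_closed[OF yc]
      by (auto simp: lin_diff_solutions_def intro!: minus_equality finsum_closed)
    also have "\<dots> = \<partial> (ev (jet n y) (Var i))" using 2 by (auto simp: jet_def)
    finally show ?thesis .
  qed (auto simp: jet_def)
next
  case (Add p q)
  have "y \<in> carrier R" using y by (simp add: lin_diff_solutions_def)
  then show ?case using Add by (simp add: deriv_add ev_closed jet_closed)
next
  case (Mul p q)
  have "y \<in> carrier R" using y by (simp add: lin_diff_solutions_def)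
  then show ?case using Mul by (simp add: deriv_mult ev_closed jet_closed)
qed simp

lemma set_formal_deriv:
  assumes D: "diff_subfield D R" and a: "\<And>i. i < n \<Longrightarrow> a i \<in> D" and "set_pexp p \<subseteq> D"
  shows "set_pexp (formal_deriv n a p) \<subseteq> D"
proof -
  have K: "subring D R" and d: "\<And>x. x \<in> D \<Longrightarrow> \<partial> x \<in> D"
    using D subfieldE(1) by (auto simp: diff_subfield_def)
  have l: "set_pexp (linear_form (\<lambda>j. \<ominus> a j) n) \<subseteq> D"
    using a subringE(5)[OF K] by (intro set_linear_form[OF K]) auto
  show ?thesis using assms(3) d subringE(2)[OF K] l by (induction p) auto
qed

text \<open>
  A differential ideal of the polynomial ring \<open>D[Y\<^sub>0, \<dots>, Y\<^sub>n\<^sub>-\<^sub>1]\<close>, described by expressions. The last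
  clause makes membership a property of the polynomial rather than of the expression: \<open>D\<close> is infinite
  in the applications, so polynomials over \<open>D\<close> are determined by their values on \<open>D\<^sup>n\<close>.
\<close>

definition diff_ideal :: "'a set \<Rightarrow> nat \<Rightarrow> (nat \<Rightarrow> 'a) \<Rightarrow> 'a pexp set \<Rightarrow> bool" where
  "diff_ideal D n a M \<longleftrightarrow>
    M \<subseteq> {p. set_pexp p \<subseteq> D} \<and> Const \<zero> \<in> M \<and>
    (\<forall>p\<in>M. \<forall>q\<in>M. Add p q \<in> M) \<and>
    (\<forall>p\<in>M. \<forall>q. set_pexp q \<subseteq> D \<longrightarrow> Mul q p \<in> M) \<and>
    (\<forall>p\<in>M. formal_deriv n a p \<in> M) \<and>
    (\<forall>p\<in>M. \<forall>q. set_pexp q \<subseteq> D \<longrightarrow> (\<forall>x\<in>points n D. ev x q = ev x p) \<longrightarrow> q \<in> M)"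

lemma diff_idealD:
  assumes "diff_ideal D n a M" "p \<in> M"
  shows "set_pexp p \<subseteq> D" and "q \<in> M \<Longrightarrow> Add p q \<in> M" and "set_pexp q \<subseteq> D \<Longrightarrow> Mul q p \<in> M"
    and "formal_deriv n a p \<in> M"
    and "set_pexp q \<subseteq> D \<Longrightarrow> (\<And>x. x \<in> points n D \<Longrightarrow> ev x q = ev x p) \<Longrightarrow> q \<in> M"
proof -
  note A = assms(1)[unfolded diff_ideal_def]
  show "set_pexp p \<subseteq> D" using A[THEN conjunct1] assms(2) by (rule subsetD[THEN CollectD])
  note A2 = A[THEN conjunct2, THEN conjunct2]
  show "q \<in> M \<Longrightarrow> Add p q \<in> M" using A2[THEN conjunct1] assms(2) by simp
  note A3 = A2[THEN conjunct2]
  show "set_pexp q \<subseteq> D \<Longrightarrow> Mul q p \<in> M" using A3[THEN conjunct1] assms(2) by simp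
  show "formal_deriv n a p \<in> M" using A3[THEN conjunct2, THEN conjunct1] assms(2) by simp
  show "q \<in> M" if "set_pexp q \<subseteq> D" "\<And>x. x \<in> points n D \<Longrightarrow> ev x q = ev x p"
    using A3[THEN conjunct2, THEN conjunct2, THEN bspec[OF _ assms(2)], THEN spec, of q] that by simp
qed

end

section \<open>Linear relations between polynomial values\<close>

context ring
begin

text \<open>
  A list of pairs \<open>(u, p)\<close> stands for the linear combination of the polynomials \<open>p\<close> with the coefficients
  \<open>u\<close>. The lists keep the two apart where the coefficients come from a large field and the polynomials
  are defined over a small one.
\<close>

primrec comb :: "('a \<times> 'a pexp) list \<Rightarrow> (nat \<Rightarrow> 'a) \<Rightarrow> 'a" where
  "comb [] x = \<zero>"
| "comb (t # L) x = fst t \<otimes> ev x (snd t) \<oplus> comb L x"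

primrec comb_pexp :: "('a \<times> 'a pexp) list \<Rightarrow> 'a pexp" where
  "comb_pexp [] = Const \<zero>"
| "comb_pexp (t # L) = Add (Mul (Const (fst t)) (snd t)) (comb_pexp L)"

lemma ev_comb_pexp: "ev x (comb_pexp L) = comb L x"
  by (induction L) auto

lemma set_comb_pexp: "(\<And>t. t \<in> set L \<Longrightarrow> fst t \<in> K \<and> set_pexp (snd t) \<subseteq> K) \<Longrightarrow> subring K R \<Longrightarrow>
    set_pexp (comb_pexp L) \<subseteq> K"
  using subringE(2)[of K R] by (induction L) auto

lemma comb_closed:
  assumes "\<And>t. t \<in> set L \<Longrightarrow> fst t \<in> carrier R \<and> set_pexp (snd t) \<subseteq> carrier R"
    and "\<And>i. x i \<in> carrier R"
  shows "comb L x \<in> carrier R"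
  using assms(1) by (induction L) (auto simp: ev_closed assms(2))

lemma comb_append:
  assumes "\<And>t. t \<in> set (L @ L') \<Longrightarrow> fst t \<in> carrier R \<and> set_pexp (snd t) \<subseteq> carrier R"
    and x: "\<And>i. x i \<in> carrier R"
  shows "comb (L @ L') x = comb L x \<oplus> comb L' x"
  using assms(1)
proof (induction L)
  case Nil
  then show ?case using comb_closed[OF _ x, of L'] by auto
next
  case (Cons t L)
  then have "fst t \<otimes> ev x (snd t) \<in> carrier R" using ev_closed[OF x] by auto
  moreover have "comb L x \<in> carrier R" "comb L' x \<in> carrier R"
    using Cons.prems by (auto intro!: comb_closed x)
  ultimately show ?case using Cons by (simp add: a_assoc)
qed

end

text \<open>
  If \<open>v\<close> is the inverse of the value of \<open>p\<close> at \<open>x0\<close>, this subtracts from \<open>r\<close> the multiple of \<open>p\<close> that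
  makes the difference vanish at \<open>x0\<close>.
\<close>

definition (in ring) reduce :: "(nat \<Rightarrow> 'a) \<Rightarrow> 'a \<Rightarrow> 'a pexp \<Rightarrow> 'a pexp \<Rightarrow> 'a pexp" where
  "reduce x0 v p r = Add r (Mul (Const (\<ominus> (ev x0 r \<otimes> v))) p)"

lemma (in cring) comb_reduce:
  assumes L: "\<And>t. t \<in> set L \<Longrightarrow> fst t \<in> carrier R \<and> set_pexp (snd t) \<subseteq> carrier R"
    and p: "set_pexp p \<subseteq> carrier R" and v: "v \<in> carrier R"
    and x: "\<And>i. x i \<in> carrier R" and x0: "\<And>i. x0 i \<in> carrier R"
  shows "comb (map (\<lambda>t. (fst t, reduce x0 v p (snd t))) L) x
    = comb L x \<oplus> (\<ominus> (comb L x0 \<otimes> v)) \<otimes> ev x p"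
  using L
proof (induction L)
  case Nil
  have "ev x p \<in> carrier R" using ev_closed[OF x p] .
  then show ?case using v by simp
next
  case (Cons t L)
  have c: "ev x (snd t) \<in> carrier R" "ev x0 (snd t) \<in> carrier R" "ev x p \<in> carrier R"
    "fst t \<in> carrier R"
    using Cons.prems[of t] p by (simp_all add: ev_closed x x0)
  have c2: "comb L x \<in> carrier R" "comb L x0 \<in> carrier R"
    using Cons.prems by (auto intro!: comb_closed x x0)
  show ?case using Cons c c2 v by (simp add: reduce_def) algebra
qed

text \<open>
  A linear relation over a field \<open>R\<close> between functions with values in a subfield \<open>D\<close> can be replaced by a
  relation over \<open>D\<close>. Take a point \<open>x0\<close> at which the first polynomial \<open>p\<close> of the combination is nonzero
  and reduce \<open>q\<close> and the other polynomials modulo \<open>p\<close> such that they vanish at \<open>x0\<close>. The multiples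
  of \<open>p\<close> used have coefficients in \<open>D\<close>, and \<open>p\<close> no longer occurs in the reduced relation, which is
  therefore shorter.
\<close>

lemma (in field) elimination_of_coefficients:
  assumes D: "subfield D R"
    and M_set: "\<And>p. p \<in> M \<Longrightarrow> set_pexp p \<subseteq> D"
    and M_zero: "Const \<zero> \<in> M"
    and M_lin: "\<And>p q d. p \<in> M \<Longrightarrow> q \<in> M \<Longrightarrow> d \<in> D \<Longrightarrow> Add p (Mul (Const d) q) \<in> M"
    and A: "\<And>x i. x \<in> A \<Longrightarrow> x i \<in> D"
    and L: "\<And>t. t \<in> set L \<Longrightarrow> fst t \<in> carrier R \<and> snd t \<in> M"
    and q: "set_pexp q \<subseteq> D" "\<And>x. x \<in> A \<Longrightarrow> ev x q = comb L x"
  shows "\<exists>m\<in>M. \<forall>x\<in>A. ev x q = ev x m"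
  using L q
proof (induction "length L" arbitrary: L q)
  case 0
  then show ?case using M_zero by (intro bexI[of _ "Const \<zero>"]) auto
next
  case (Suc l)
  then obtain u p L' where L_eq: "L = (u, p) # L'" by (metis length_Suc_conv surj_pair)
  have K: "subring D R" using subfieldE(1)[OF D] .
  have DR: "\<And>d. d \<in> D \<Longrightarrow> d \<in> carrier R" using subfieldE(3)[OF D] by blast
  have u: "u \<in> carrier R" and p: "p \<in> M" using Suc.prems(1)[of "(u, p)"] L_eq by auto
  have L': "fst t \<in> carrier R" "snd t \<in> M" if "t \<in> set L'" for t
    using Suc.prems(1)[of t] that L_eq by auto
  have evD: "ev x r \<in> D" if "x \<in> A" "set_pexp r \<subseteq> D" for x r
    using ev_in_subring[OF K A[OF that(1)] that(2)] .
  have evR: "ev x r \<in> carrier R" if "x \<in> A" "set_pexp r \<subseteq> D" for x r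
    using evD[OF that] by (rule DR)
  have X_R: "x i \<in> carrier R" if "x \<in> A" for x i using A[OF that] by (rule DR)
  have Dsub: "set_pexp r \<subseteq> carrier R" if "r \<in> M" for r
    using M_set[OF that] subfieldE(3)[OF D] by (rule subset_trans)
  have comb_R: "comb LL x \<in> carrier R"
    if "\<And>t. t \<in> set LL \<Longrightarrow> fst t \<in> carrier R \<and> snd t \<in> M" "x \<in> A" for LL x
  proof (rule comb_closed)
    show "fst t \<in> carrier R \<and> set_pexp (snd t) \<subseteq> carrier R" if "t \<in> set LL" for t
      using \<open>\<And>t. t \<in> set LL \<Longrightarrow> fst t \<in> carrier R \<and> snd t \<in> M\<close>[OF that] M_set[of "snd t"]
        subfieldE(3)[OF D] by auto
    show "x i \<in> carrier R" for i using A[OF \<open>x \<in> A\<close>] by (rule DR)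
  qed
  show ?case
  proof (cases "\<forall>x\<in>A. ev x p = \<zero>")
    case True
    have "ev x q = comb L' x" if "x \<in> A" for x
    proof -
      have "comb L' x \<in> carrier R" using L' that by (intro comb_R) auto
      then show ?thesis using Suc.prems(3)[OF that] True that u L_eq by simp
    qed
    then show ?thesis using Suc.hyps(1)[of L' q] Suc.hyps(2) L' Suc.prems(2) L_eq by auto
  next
    case False
    then obtain x0 where x0: "x0 \<in> A" "ev x0 p \<noteq> \<zero>" by blast
    let ?v = "inv (ev x0 p)"
    have inv: "?v \<in> D" "?v \<otimes> ev x0 p = \<one>"
      using subfield_m_inv[OF D, of "ev x0 p"] x0 evD M_set[OF p] by auto
    define e where "e r = \<ominus> (ev x0 r \<otimes> ?v)" for r
    have eD: "e r \<in> D" if "set_pexp r \<subseteq> D" for r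
      unfolding e_def using evD[OF x0(1) that] inv(1) subringE(5,6)[OF K] by simp
    \<comment> \<open>\<open>red r\<close> is the combination of \<open>r\<close> and \<open>p\<close> that vanishes at \<open>x0\<close>.\<close>
    define red where "red = reduce x0 ?v p"
    have red_eq: "red r = Add r (Mul (Const (e r)) p)" for r by (simp add: red_def e_def reduce_def)
    have red_set: "set_pexp (red r) \<subseteq> D" if "set_pexp r \<subseteq> D" for r
      using that eD[OF that] M_set[OF p] by (simp add: red_eq)
    define L2 where "L2 = map (\<lambda>t. (fst t, red (snd t))) L'"
    have L2: "fst t \<in> carrier R \<and> snd t \<in> M" if "t \<in> set L2" for t
      using that L' p M_lin eD M_set unfolding L2_def red_eq by auto
    have "ev x (red q) = comb L2 x" if x: "x \<in> A" for x
    proof -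
      have "set_pexp q \<subseteq> D" using Suc.prems by blast
      then have c: "ev x q \<in> carrier R" "ev x0 q \<in> carrier R" "ev x p \<in> carrier R" "ev x0 p \<in> carrier R"
        "inv (ev x0 p) \<in> carrier R" using evR[OF x] evR[OF x0(1)] M_set[OF p] DR[OF inv(1)] by auto
      have c2: "comb L' x \<in> carrier R" "comb L' x0 \<in> carrier R"
        using L' x x0(1) by (auto intro!: comb_R)
      have "ev x (red q) = ev x q \<oplus> (\<ominus> (ev x0 q \<otimes> inv (ev x0 p))) \<otimes> ev x p"
        by (simp add: red_eq e_def)
      also have "\<dots> = (u \<otimes> ev x p \<oplus> comb L' x)
          \<oplus> (\<ominus> ((u \<otimes> ev x0 p \<oplus> comb L' x0) \<otimes> inv (ev x0 p))) \<otimes> ev x p"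
        using Suc.prems(3)[OF x] Suc.prems(3)[OF x0(1)] L_eq by simp
      \<comment> \<open>The terms with the coefficient \<open>u\<close> are collected; they cancel because \<open>p\<close> takes the value \<open>\<one>\<close> at \<open>x0\<close> after division.\<close>
      also have "\<dots> = comb L' x \<oplus> (\<ominus> (comb L' x0 \<otimes> inv (ev x0 p))) \<otimes> ev x p
          \<oplus> (u \<otimes> ev x p \<oplus> \<ominus> (u \<otimes> (inv (ev x0 p) \<otimes> ev x0 p) \<otimes> ev x p))"
        using c c2 u by algebra
      also have "u \<otimes> ev x p \<oplus> \<ominus> (u \<otimes> (inv (ev x0 p) \<otimes> ev x0 p) \<otimes> ev x p) = \<zero>"
        using c u inv(2) by (simp add: r_neg)
      finally show ?thesis
        using comb_reduce[of L' p ?v x x0] L' M_set p DR X_R x x0(1) c c2 Dsub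
        unfolding L2_def red_def by simp
    qed
    then obtain m where m: "m \<in> M" "\<forall>x\<in>A. ev x (red q) = ev x m"
      using Suc.hyps(1)[of L2 "red q"] Suc.hyps(2) L2 red_set Suc.prems(2) L_eq L2_def by auto
    have "ev x q = ev x (Add m (Mul (Const (\<ominus> e q)) p))" if x: "x \<in> A" for x
    proof -
      have c: "ev x q \<in> carrier R" "ev x p \<in> carrier R" "e q \<in> carrier R"
        using evR[OF x Suc.prems(2)] evR[OF x M_set[OF p]] DR[OF eD[OF Suc.prems(2)]] .
      have "ev x m = ev x q \<oplus> e q \<otimes> ev x p" using m x by (auto simp: red_eq)
      then show ?thesis using c by (simp) algebra
    qed
    moreover have "\<ominus> e q \<in> D" using eD[OF Suc.prems(2)] subringE(5)[OF K] by simp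
    ultimately show ?thesis
      by (intro bexI[of _ "Add m (Mul (Const (\<ominus> e q)) p)"] ballI M_lin[OF m(1) p])
  qed
qed

lemma (in differential_field) deriv_iterate_combination:
  assumes "\<And>k. k < n \<Longrightarrow> c k \<in> constants R (carrier R)" "\<And>k. k < n \<Longrightarrow> z k \<in> carrier R"
  shows "(deriv R ^^ i) (\<Oplus>k\<in>{..<n}. c k \<otimes> z k) = (\<Oplus>k\<in>{..<n}. c k \<otimes> (deriv R ^^ i) (z k))"
proof (induction i)
  case (Suc i)
  have c: "c k \<in> carrier R" "\<partial> (c k) = \<zero>" if "k < n" for k
    using assms(1)[OF that] by (auto simp: constants_def)
  have "(deriv R ^^ Suc i) (\<Oplus>k\<in>{..<n}. c k \<otimes> z k) = (\<Oplus>k\<in>{..<n}. \<partial> (c k \<otimes> (deriv R ^^ i) (z k)))"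
    unfolding funpow.simps o_apply Suc
    using c assms(2) deriv_iterate_closed by (intro deriv_finsum) auto
  also have "\<dots> = (\<Oplus>k\<in>{..<n}. c k \<otimes> (deriv R ^^ Suc i) (z k))"
    using c assms(2) deriv_iterate_closed[of _ i] deriv_iterate_closed[of _ "Suc i"]
    by (intro finsum_cong') (auto simp: deriv_constant_mult)
  finally show ?case .
qed simp

lemma (in differential_field) lin_diff_solutions_combination:
  fixes m :: nat
  assumes c: "\<And>k. k < m \<Longrightarrow> c k \<in> constants R (carrier R)"
    and z: "\<And>k. k < m \<Longrightarrow> z k \<in> lin_diff_solutions R (carrier R) n a"
    and a: "\<And>i. i < n \<Longrightarrow> a i \<in> carrier R"
  shows "(\<Oplus>k\<in>{..<m}. c k \<otimes> z k) \<in> lin_diff_solutions R (carrier R) n a"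
proof -
  have cc: "c k \<in> carrier R" if "k < m" for k using c[OF that] by (auto simp: constants_def)
  have zc: "(deriv R ^^ i) (z k) \<in> carrier R" if "k < m" for i k
    using solution_deriv_closed[OF z[OF that]] .
  let ?y = "\<Oplus>k\<in>{..<m}. c k \<otimes> z k"
  have comb: "(deriv R ^^ i) ?y = (\<Oplus>k\<in>{..<m}. c k \<otimes> (deriv R ^^ i) (z k))" for i
    using c zc[of _ 0] by (intro deriv_iterate_combination) auto
  have "(\<Oplus>i\<in>{..<n}. a i \<otimes> (deriv R ^^ i) ?y) = (\<Oplus>i\<in>{..<n}. \<Oplus>k\<in>{..<m}. c k \<otimes> (a i \<otimes> (deriv R ^^ i) (z k)))"
  proof (rule finsum_cong')
    fix i assume i: "i \<in> {..<n}"
    have "a i \<otimes> (deriv R ^^ i) ?y = (\<Oplus>k\<in>{..<m}. a i \<otimes> (c k \<otimes> (deriv R ^^ i) (z k)))"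
      unfolding comb using a i cc zc by (intro finsum_rdistr) auto
    also have "\<dots> = (\<Oplus>k\<in>{..<m}. c k \<otimes> (a i \<otimes> (deriv R ^^ i) (z k)))"
      using a i cc zc by (intro finsum_cong') (auto simp: m_lcomm)
    finally show "a i \<otimes> (deriv R ^^ i) ?y = \<dots>" .
  qed (use a cc zc in \<open>auto intro!: finsum_closed\<close>)
  also have "\<dots> = (\<Oplus>k\<in>{..<m}. \<Oplus>i\<in>{..<n}. c k \<otimes> (a i \<otimes> (deriv R ^^ i) (z k)))"
    using a cc zc by (intro finsum_swap) auto
  also have "\<dots> = (\<Oplus>k\<in>{..<m}. c k \<otimes> (\<Oplus>i\<in>{..<n}. a i \<otimes> (deriv R ^^ i) (z k)))"
    using a cc zc by (intro finsum_cong') (auto intro!: finsum_closed finsum_rdistr[symmetric])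
  finally have "(deriv R ^^ n) ?y \<oplus> (\<Oplus>i\<in>{..<n}. a i \<otimes> (deriv R ^^ i) ?y)
      = (\<Oplus>k\<in>{..<m}. c k \<otimes> (deriv R ^^ n) (z k)) \<oplus> (\<Oplus>k\<in>{..<m}. c k \<otimes> (\<Oplus>i\<in>{..<n}. a i \<otimes> (deriv R ^^ i) (z k)))"
    by (simp add: comb)
  also have "\<dots> = (\<Oplus>k\<in>{..<m}. c k \<otimes> (deriv R ^^ n) (z k) \<oplus> c k \<otimes> (\<Oplus>i\<in>{..<n}. a i \<otimes> (deriv R ^^ i) (z k)))"
    using a cc zc by (intro finsum_addf[symmetric]) (auto intro!: finsum_closed)
  also have "\<dots> = (\<Oplus>k\<in>{..<m}. \<zero>)"
  proof (rule finsum_cong')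
    fix k assume k: "k \<in> {..<m}"
    let ?s = "\<Oplus>i\<in>{..<n}. a i \<otimes> (deriv R ^^ i) (z k)"
    have s: "?s \<in> carrier R" using a zc k by (auto intro!: finsum_closed)
    have "c k \<otimes> (deriv R ^^ n) (z k) \<oplus> c k \<otimes> ?s = c k \<otimes> ((deriv R ^^ n) (z k) \<oplus> ?s)"
      using cc zc k s by (intro r_distr[symmetric]) auto
    also have "(deriv R ^^ n) (z k) \<oplus> ?s = \<zero>" using z k by (simp add: lin_diff_solutions_def)
    finally show "c k \<otimes> (deriv R ^^ n) (z k) \<oplus> c k \<otimes> ?s = \<zero>" using cc k by simp
  qed auto
  finally have eq: "(deriv R ^^ n) ?y \<oplus> (\<Oplus>i\<in>{..<n}. a i \<otimes> (deriv R ^^ i) ?y) = \<zero>" by (simp add: finsum_zero)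
  have "?y \<in> carrier R" using cc zc[of _ 0] by (auto intro!: finsum_closed)
  then show ?thesis using eq by (simp add: lin_diff_solutions_def)
qed

section \<open>Polynomials evaluated at solutions\<close>

text \<open>
  A differential ideal \<open>M\<close> over \<open>D\<close> for an equation that has a fundamental system \<open>z\<close> in the larger field
  \<open>R\<close>. Solutions are parametrised by the vectors of constants, through \<open>sol\<close>.
\<close>

locale diff_ideal_and_solutions = differential_field +
  fixes D :: "'a set" and n :: nat and a z :: "nat \<Rightarrow> 'a" and M :: "'a pexp set"
  assumes D: "diff_subfield D R"
    and constants_in_D: "constants R (carrier R) \<subseteq> D"
    and a_in_D: "\<And>i. i < n \<Longrightarrow> a i \<in> D"
    and z: "fundamental_system n a z"
    and M: "diff_ideal D n a M"
begin

abbreviation "C \<equiv> constants R (carrier R)"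

definition sol :: "(nat \<Rightarrow> 'a) \<Rightarrow> 'a" where
  "sol c = (\<Oplus>k\<in>{..<n}. c k \<otimes> z k)"

text \<open>
  Multiplication with the Wronskian matrix. For a vector \<open>c\<close> of constants this is the jet of \<open>sol c\<close>;
  it makes sense for all vectors over \<open>R\<close>, and then every vector over \<open>R\<close> is a value.
\<close>

definition sol_jet :: "(nat \<Rightarrow> 'a) \<Rightarrow> nat \<Rightarrow> 'a" where
  "sol_jet c j = (if j < n then \<Oplus>k\<in>{..<n}. c k \<otimes> (deriv R ^^ j) (z k) else \<zero>)"

text \<open>
  The \<open>R\<close>-linear span of the functions on \<open>C\<^sup>n\<close> that the elements of \<open>M\<close> induce. The lemmas below show
  that it is closed under the derivation of the values and under multiplication with polynomials.
\<close>

definition M_span :: "((nat \<Rightarrow> 'a) \<Rightarrow> 'a) set" where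
  "M_span = {f. \<exists>L. (\<forall>t\<in>set L. fst t \<in> carrier R \<and> snd t \<in> M) \<and>
    (\<forall>c\<in>points n C. f c = comb L (sol_jet c))}"

lemma subring_D: "subring D R" and D_carrier: "D \<subseteq> carrier R"
  using D subfieldE(1,3) by (auto simp: diff_subfield_def)

lemma C_carrier: "C \<subseteq> carrier R" by (auto simp: constants_def)

lemma a_carrier: "i < n \<Longrightarrow> a i \<in> carrier R" using a_in_D D_carrier by auto

lemma z_solution: "k < n \<Longrightarrow> z k \<in> lin_diff_solutions R (carrier R) n a"
  using z by (simp add: fundamental_system_def)

lemma deriv_z_closed: "k < n \<Longrightarrow> (deriv R ^^ j) (z k) \<in> carrier R"
  using solution_deriv_closed[OF z_solution] .

lemma sol_solution: "c \<in> points n C \<Longrightarrow> sol c \<in> lin_diff_solutions R (carrier R) n a"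
  unfolding sol_def
  by (intro lin_diff_solutions_combination) (auto simp: points_def z_solution a_carrier)

lemma sol_jet_closed: "(\<And>k. k < n \<Longrightarrow> c k \<in> carrier R) \<Longrightarrow> sol_jet c j \<in> carrier R"
  unfolding sol_jet_def using deriv_z_closed by (auto intro!: finsum_closed)

lemma sol_jet_closed_C: "c \<in> points n C \<Longrightarrow> sol_jet c j \<in> carrier R"
  using C_carrier by (intro sol_jet_closed) (auto simp: points_def)

lemma jet_sol: assumes c: "c \<in> points n C" shows "jet n (sol c) = sol_jet c"
proof
  fix j
  show "jet n (sol c) j = sol_jet c j"
    using deriv_iterate_combination[of n c z j] c deriv_z_closed[of _ 0]
    by (auto simp: jet_def sol_def sol_jet_def points_def)
qed

lemma M_carrier: "p \<in> M \<Longrightarrow> set_pexp p \<subseteq> carrier R"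
  using diff_idealD(1)[OF M] D_carrier by blast

lemma ev_M_closed: "c \<in> points n C \<Longrightarrow> p \<in> M \<Longrightarrow> ev (sol_jet c) p \<in> carrier R"
  using ev_closed[OF sol_jet_closed_C M_carrier] .

lemma comb_M_closed:
  assumes "c \<in> points n C" "\<And>t. t \<in> set L \<Longrightarrow> fst t \<in> carrier R \<and> snd t \<in> M"
  shows "comb L (sol_jet c) \<in> carrier R"
  using assms M_carrier by (intro comb_closed sol_jet_closed_C) auto

lemma M_spanE:
  assumes "f \<in> M_span"
  obtains L where "\<forall>t\<in>set L. fst t \<in> carrier R \<and> snd t \<in> M"
    "\<forall>c\<in>points n C. f c = comb L (sol_jet c)"
  using assms unfolding M_span_def by blast

lemma M_spanI:
  assumes "\<And>t. t \<in> set L \<Longrightarrow> fst t \<in> carrier R \<and> snd t \<in> M"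
    "\<And>c. c \<in> points n C \<Longrightarrow> f c = comb L (sol_jet c)"
  shows "f \<in> M_span"
  using assms unfolding M_span_def by blast

lemma M_span_closed: "f \<in> M_span \<Longrightarrow> c \<in> points n C \<Longrightarrow> f c \<in> carrier R"
  by (elim M_spanE) (simp add: comb_M_closed)

lemma M_span_cong: "f \<in> M_span \<Longrightarrow> (\<And>c. c \<in> points n C \<Longrightarrow> g c = f c) \<Longrightarrow> g \<in> M_span"
  by (elim M_spanE) (rule M_spanI; simp)

lemma M_span_add: assumes "f \<in> M_span" "g \<in> M_span" shows "(\<lambda>c. f c \<oplus> g c) \<in> M_span"
proof -
  obtain L where L: "\<forall>t\<in>set L. fst t \<in> carrier R \<and> snd t \<in> M"
    "\<forall>c\<in>points n C. f c = comb L (sol_jet c)" using assms(1) by (rule M_spanE)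
  obtain L' where L': "\<forall>t\<in>set L'. fst t \<in> carrier R \<and> snd t \<in> M"
    "\<forall>c\<in>points n C. g c = comb L' (sol_jet c)" using assms(2) by (rule M_spanE)
  show ?thesis
  proof (rule M_spanI[of "L @ L'"])
    show "fst t \<in> carrier R \<and> snd t \<in> M" if "t \<in> set (L @ L')" for t using that L(1) L'(1) by auto
    show "f c \<oplus> g c = comb (L @ L') (sol_jet c)" if "c \<in> points n C" for c
    proof -
      have "fst t \<in> carrier R \<and> set_pexp (snd t) \<subseteq> carrier R" if "t \<in> set (L @ L')" for t
        using that L(1) L'(1) M_carrier[of "snd t"] by auto
      from comb_append[OF this sol_jet_closed_C[OF that]] show ?thesis using that L(2) L'(2) by simp
    qed
  qed
qed

lemma M_span_base: "p \<in> M \<Longrightarrow> u \<in> carrier R \<Longrightarrow> (\<lambda>c. u \<otimes> ev (sol_jet c) p) \<in> M_span"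
  by (rule M_spanI[of "[(u, p)]"]) (auto simp: ev_M_closed)

lemma M_span_zero: "(\<lambda>c. \<zero>) \<in> M_span"
  by (rule M_spanI[of "[]"]) auto

lemma M_span_induct [consumes 1, case_names zero step cong]:
  assumes "f \<in> M_span"
    and zero: "P (\<lambda>c. \<zero>)"
    and step: "\<And>u p g. u \<in> carrier R \<Longrightarrow> p \<in> M \<Longrightarrow> g \<in> M_span \<Longrightarrow> P g \<Longrightarrow> P (\<lambda>c. u \<otimes> ev (sol_jet c) p \<oplus> g c)"
    and cong: "\<And>f g. P f \<Longrightarrow> (\<And>c. c \<in> points n C \<Longrightarrow> g c = f c) \<Longrightarrow> P g"
  shows "P f"
proof -
  obtain L where L: "\<forall>t\<in>set L. fst t \<in> carrier R \<and> snd t \<in> M"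
    "\<forall>c\<in>points n C. f c = comb L (sol_jet c)" using assms(1) by (rule M_spanE)
  have "P (\<lambda>c. comb L (sol_jet c))" using L(1)
  proof (induction L)
    case (Cons t L)
    have "(\<lambda>c. comb L (sol_jet c)) \<in> M_span" using Cons.prems by (intro M_spanI[of L]) auto
    then show ?case using Cons step[of "fst t" "snd t" "\<lambda>c. comb L (sol_jet c)"] by simp
  qed (simp add: zero)
  then show ?thesis by (rule cong) (use L(2) in simp)
qed

lemma M_span_scale: "f \<in> M_span \<Longrightarrow> s \<in> carrier R \<Longrightarrow> (\<lambda>c. s \<otimes> f c) \<in> M_span"
proof (induction rule: M_span_induct)
  case zero
  then show ?case by (intro M_span_cong[OF M_span_zero]) simp
next
  case (step u p g)
  have "(\<lambda>c. (s \<otimes> u) \<otimes> ev (sol_jet c) p \<oplus> s \<otimes> g c) \<in> M_span"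
    using step by (intro M_span_add M_span_base) auto
  then show ?case
    by (rule M_span_cong) (use step M_span_closed ev_M_closed in \<open>auto simp: r_distr m_assoc\<close>)
next
  case (cong f g)
  then show ?case by (rule_tac M_span_cong[of "\<lambda>c. s \<otimes> f c"]) auto
qed

text \<open>
  On the jet of a solution, the derivative of the value of \<open>p\<close> is the value of its formal derivative,
  which belongs to the differential ideal \<open>M\<close> together with \<open>p\<close>.
\<close>

lemma M_span_deriv: "f \<in> M_span \<Longrightarrow> (\<lambda>c. \<partial> (f c)) \<in> M_span"
proof (induction rule: M_span_induct)
  case zero
  show ?case by (rule M_span_cong[OF M_span_zero]) simp
next
  case (step u p g)
  have "(\<lambda>c. (\<partial> u \<otimes> ev (sol_jet c) p \<oplus> u \<otimes> ev (sol_jet c) (formal_deriv n a p)) \<oplus> \<partial> (g c)) \<in> M_span"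
    using step by (intro M_span_add M_span_base) (auto intro: deriv_closed diff_idealD(4)[OF M])
  then show ?case
  proof (rule M_span_cong)
    fix c assume c: "c \<in> points n C"
    have "ev (sol_jet c) (formal_deriv n a p) = \<partial> (ev (sol_jet c) p)"
      using ev_formal_deriv[OF sol_solution[OF c] a_carrier M_carrier[OF step(2)]] jet_sol[OF c] by simp
    then show "\<partial> (u \<otimes> ev (sol_jet c) p \<oplus> g c)
        = (\<partial> u \<otimes> ev (sol_jet c) p \<oplus> u \<otimes> ev (sol_jet c) (formal_deriv n a p)) \<oplus> \<partial> (g c)"
      using step M_span_closed[OF step(3) c] ev_M_closed[OF c step(2)] by (simp add: deriv_add deriv_mult)
  qed
next
  case (cong f g)
  then show ?case by (rule_tac M_span_cong[of "\<lambda>c. \<partial> (f c)"]) auto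
qed

lemma M_span_mult_sol_jet: "f \<in> M_span \<Longrightarrow> j < n \<Longrightarrow> (\<lambda>c. sol_jet c j \<otimes> f c) \<in> M_span"
proof (induction rule: M_span_induct)
  case zero
  then show ?case by (intro M_span_cong[OF M_span_zero]) (simp add: sol_jet_closed_C)
next
  case (step u p g)
  have "Mul (Var j) p \<in> M" using step(2) by (intro diff_idealD(3)[OF M]) auto
  then have "(\<lambda>c. u \<otimes> ev (sol_jet c) (Mul (Var j) p) \<oplus> sol_jet c j \<otimes> g c) \<in> M_span"
    using step by (intro M_span_add M_span_base) auto
  then show ?case
    by (rule M_span_cong)
      (use step M_span_closed ev_M_closed in \<open>auto simp: r_distr m_lcomm sol_jet_closed_C\<close>)
next
  case (cong f g)
  then show ?case by (rule_tac M_span_cong[of "\<lambda>c. sol_jet c j \<otimes> f c"]) auto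
qed

lemma M_span_finsum:
  fixes m :: nat
  assumes "\<And>j. j < m \<Longrightarrow> g j \<in> M_span"
  shows "(\<lambda>c. \<Oplus>j\<in>{..<m}. g j c) \<in> M_span"
  using assms
proof (induction m)
  case 0
  then show ?case using M_span_zero by simp
next
  case (Suc m)
  then have "(\<lambda>c. g m c \<oplus> (\<Oplus>j\<in>{..<m}. g j c)) \<in> M_span" by (intro M_span_add) auto
  then show ?case
    by (rule M_span_cong) (use Suc.prems M_span_closed in \<open>auto simp: lessThan_Suc Pi_def\<close>)
qed

text \<open>
  The inverse \<open>B\<close> of the Wronskian matrix, as an inverse on both sides.
\<close>

lemma coordinates:
  "\<exists>B. (\<forall>j k. B j k \<in> carrier R) \<and>
    (\<forall>x. (\<forall>j. x j \<in> carrier R) \<longrightarrow> (\<forall>i<n. sol_jet (\<lambda>k. \<Oplus>j\<in>{..<n}. x j \<otimes> B j k) i = x i)) \<and>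
    (\<forall>c k. (\<forall>k. c k \<in> carrier R) \<longrightarrow> k < n \<longrightarrow> (\<Oplus>j\<in>{..<n}. sol_jet c j \<otimes> B j k) = c k)"
proof -
  have ker: "u k = \<zero>" if "\<And>k. u k \<in> carrier R" "\<And>j. j < n \<Longrightarrow> (\<Oplus>k\<in>{..<n}. u k \<otimes> (deriv R ^^ j) (z k)) = \<zero>" "k < n" for u k
    using wronskian_independent[OF z a_carrier that] .
  have "\<exists>B :: nat \<Rightarrow> nat \<Rightarrow> 'a. (\<forall>j k. B j k \<in> carrier R) \<and>
    (\<forall>x. (\<forall>j. x j \<in> carrier R) \<longrightarrow>
      (\<forall>i<n. (\<Oplus>k\<in>{..<n}. (\<Oplus>j\<in>{..<n}. x j \<otimes> B j k) \<otimes> (deriv R ^^ i) (z k)) = x i))"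
    by (rule invertible_if_trivial_kernel) (auto intro: deriv_z_closed ker)
  then obtain B where B: "\<And>j k. B j k \<in> carrier R"
    "\<And>x i. (\<And>j. x j \<in> carrier R) \<Longrightarrow> i < n \<Longrightarrow>
      (\<Oplus>k\<in>{..<n}. (\<Oplus>j\<in>{..<n}. x j \<otimes> B j k) \<otimes> (deriv R ^^ i) (z k)) = x i"
    by meson
  have 1: "sol_jet (\<lambda>k. \<Oplus>j\<in>{..<n}. x j \<otimes> B j k) i = x i" if "\<And>j. x j \<in> carrier R" "i < n" for x i
    using B(2)[OF that] that by (simp add: sol_jet_def)
  have "(\<Oplus>j\<in>{..<n}. sol_jet c j \<otimes> B j k) = c k" if c: "\<And>k. c k \<in> carrier R" and k: "k < n" for c k
  proof -
    define c1 where "c1 = (\<lambda>k. \<Oplus>j\<in>{..<n}. sol_jet c j \<otimes> B j k)"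
    have jc: "sol_jet c j \<in> carrier R" for j using sol_jet_closed c by blast
    have c': "c1 k \<in> carrier R" for k using jc B(1) unfolding c1_def by (auto intro!: finsum_closed)
    define u where "u k = \<one> \<otimes> c1 k \<oplus> (\<ominus> \<one>) \<otimes> c k" for k
    have "(\<Oplus>k\<in>{..<n}. u k \<otimes> (deriv R ^^ j) (z k)) = \<zero>" if j: "j < n" for j
    proof -
      have "(\<Oplus>k\<in>{..<n}. u k \<otimes> (deriv R ^^ j) (z k)) = \<one> \<otimes> sol_jet c1 j \<oplus> (\<ominus> \<one>) \<otimes> sol_jet c j"
        unfolding u_def sol_jet_def if_P[OF j] using c c' deriv_z_closed by (intro finsum_lincomb) auto
      then show ?thesis using 1[of "sol_jet c", OF jc j, folded c1_def] jc by (simp add: l_minus r_neg)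
    qed
    then have "u k = \<zero>" using ker[of u k] c c' k by (auto simp: u_def)
    then have "c1 k \<oplus> \<ominus> c k = \<zero>" using c c' by (simp add: u_def l_minus)
    then have "c1 k = c k" using c c' by (metis add.inv_closed minus_equality minus_minus)
    then show ?thesis by (simp add: c1_def)
  qed
  then show ?thesis using B(1) 1 by (intro exI[of _ B]) auto
qed

text \<open>
  Since \<open>M\<close> is an ideal, its span is closed under multiplication with the entries of the jet, and the
  coordinates of \<open>c\<close> are linear combinations of these entries.
\<close>

lemma M_span_mult_coordinate:
  assumes f: "f \<in> M_span" and k: "k < n" shows "(\<lambda>c. c k \<otimes> f c) \<in> M_span"
proof -
  obtain B where B: "\<And>j k. B j k \<in> carrier R"
    "\<And>c k. (\<And>k. c k \<in> carrier R) \<Longrightarrow> k < n \<Longrightarrow> (\<Oplus>j\<in>{..<n}. sol_jet c j \<otimes> B j k) = c k"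
    using coordinates by meson
  have "(\<lambda>c. \<Oplus>j\<in>{..<n}. B j k \<otimes> (sol_jet c j \<otimes> f c)) \<in> M_span"
    using f B(1) by (intro M_span_finsum M_span_scale M_span_mult_sol_jet) auto
  then show ?thesis
  proof (rule M_span_cong)
    fix c assume c: "c \<in> points n C"
    have cc: "c k \<in> carrier R" for k using points_carrier points_mono[OF C_carrier] c by blast
    have "c k \<otimes> f c = (\<Oplus>j\<in>{..<n}. (sol_jet c j \<otimes> B j k) \<otimes> f c)"
      unfolding B(2)[of c, OF cc k, symmetric]
      using B(1) sol_jet_closed_C[OF c] M_span_closed[OF f c] by (intro finsum_ldistr) auto
    also have "\<dots> = (\<Oplus>j\<in>{..<n}. B j k \<otimes> (sol_jet c j \<otimes> f c))"
      using B(1) sol_jet_closed_C[OF c] M_span_closed[OF f c]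
      by (intro finsum_cong') (auto simp: m_ac)
    finally show "c k \<otimes> f c = \<dots>" .
  qed
qed

lemma M_span_mult:
  "set_pexp h \<subseteq> carrier R \<Longrightarrow> f \<in> M_span \<Longrightarrow> (\<lambda>c. ev c h \<otimes> f c) \<in> M_span"
proof (induction h arbitrary: f)
  case (Const u)
  then show ?case using M_span_scale[of f u] by simp
next
  case (Var k)
  show ?case
  proof (cases "k < n")
    case True
    then show ?thesis using M_span_mult_coordinate Var by simp
  next
    case False
    then show ?thesis using M_span_closed[OF Var(2)]
      by (intro M_span_cong[OF M_span_zero]) (auto simp: points_def)
  qed
next
  case (Add p q)
  then have "(\<lambda>c. ev c p \<otimes> f c \<oplus> ev c q \<otimes> f c) \<in> M_span" by (intro M_span_add) auto
  then show ?case
  proof (rule M_span_cong)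
    fix c assume c: "c \<in> points n C"
    have cc: "c k \<in> carrier R" for k using points_carrier points_mono[OF C_carrier] c by blast
    show "ev c (Add p q) \<otimes> f c = ev c p \<otimes> f c \<oplus> ev c q \<otimes> f c"
      using Add.prems cc M_span_closed[OF Add.prems(2) c] by (simp add: l_distr ev_closed)
  qed
next
  case (Mul p q)
  then have "(\<lambda>c. ev c p \<otimes> (ev c q \<otimes> f c)) \<in> M_span" by simp
  then show ?case
  proof (rule M_span_cong)
    fix c assume c: "c \<in> points n C"
    have cc: "c k \<in> carrier R" for k using points_carrier points_mono[OF C_carrier] c by blast
    show "ev c (Mul p q) \<otimes> f c = ev c p \<otimes> (ev c q \<otimes> f c)"
      using Mul.prems cc M_span_closed[OF Mul.prems(2) c] by (simp add: m_assoc ev_closed)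
  qed
qed

text \<open>
  Substituting these linear forms turns a polynomial in the entries of the jet into a polynomial in the
  coordinates of \<open>c\<close>.
\<close>

definition jet_form :: "nat \<Rightarrow> 'a pexp" where
  "jet_form j = (if j < n then linear_form (\<lambda>k. (deriv R ^^ j) (z k)) n else Const \<zero>)"

lemma set_jet_form: "set_pexp (jet_form j) \<subseteq> carrier R"
  using deriv_z_closed set_linear_form[OF carrier_is_subring, of n "\<lambda>k. (deriv R ^^ j) (z k)"]
  by (auto simp: jet_form_def)

lemma ev_psubst_jet_form:
  assumes c: "\<And>k. c k \<in> carrier R"
  shows "ev c (psubst jet_form p) = ev (sol_jet c) p"
proof -
  have "ev c (jet_form j) = sol_jet c j" for j
  proof (cases "j < n")
    case True
    then have "ev c (jet_form j) = (\<Oplus>k\<in>{..<n}. (deriv R ^^ j) (z k) \<otimes> c k)"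
      using deriv_z_closed c by (simp add: jet_form_def ev_linear_form)
    also have "\<dots> = sol_jet c j"
      unfolding sol_jet_def if_P[OF True] using deriv_z_closed c by (intro finsum_cong') (auto simp: m_comm)
    finally show ?thesis .
  qed (simp add: jet_form_def sol_jet_def)
  then show ?thesis by (simp add: ev_psubst)
qed

text \<open>
  The hypothesis is an identity between polynomial functions on \<open>C\<^sup>n\<close>. It extends to \<open>R\<^sup>n\<close> because \<open>C\<close>
  is infinite, and there the jets run through all of \<open>R\<^sup>n\<close>, in particular through \<open>D\<^sup>n\<close>. On \<open>D\<^sup>n\<close> it is a
  linear relation over \<open>R\<close> between polynomials over \<open>D\<close>, from which the coefficients in \<open>R\<close> can be
  eliminated.
\<close>

lemma M_span_over_D:
  assumes f: "f \<in> M_span" and q: "set_pexp q \<subseteq> D"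
    and eq: "\<And>c. c \<in> points n C \<Longrightarrow> f c = ev (sol_jet c) q"
  shows "q \<in> M"
proof -
  obtain L where L: "\<forall>t\<in>set L. fst t \<in> carrier R \<and> snd t \<in> M"
    "\<forall>c\<in>points n C. f c = comb L (sol_jet c)" using f by (rule M_spanE)
  obtain B where B: "\<And>j k. B j k \<in> carrier R"
    "\<And>x i. (\<And>j. x j \<in> carrier R) \<Longrightarrow> i < n \<Longrightarrow> sol_jet (\<lambda>k. \<Oplus>j\<in>{..<n}. x j \<otimes> B j k) i = x i"
    using coordinates by meson
  have qR: "set_pexp q \<subseteq> carrier R" using q D_carrier by blast
  have set_L: "set_pexp (comb_pexp L) \<subseteq> carrier R"
    using L(1) M_carrier by (intro set_comb_pexp[OF _ carrier_is_subring]) auto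
  define h where "h = Add (psubst jet_form q) (Mul (Const (\<ominus> \<one>)) (psubst jet_form (comb_pexp L)))"
  have set_h: "set_pexp h \<subseteq> carrier R"
    unfolding h_def using set_psubst[OF qR set_jet_form] set_psubst[OF set_L set_jet_form] by simp
  have ev_h: "ev c h = ev (sol_jet c) q \<ominus> comb L (sol_jet c)" if c: "\<And>k. c k \<in> carrier R" for c
  proof -
    have j: "sol_jet c j \<in> carrier R" for j using sol_jet_closed c by blast
    show ?thesis
      using ev_closed[OF j set_L]
      by (simp add: h_def ev_psubst_jet_form[OF c] ev_comb_pexp[symmetric] a_minus_def l_minus)
  qed
  have h0: "ev c h = \<zero>" if "c \<in> points n C" for c
  proof -
    have c: "c k \<in> carrier R" for k using points_carrier points_mono[OF C_carrier] that by blast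
    have "ev (sol_jet c) q \<in> carrier R" using ev_closed[OF sol_jet_closed_C[OF that] qR] .
    then show ?thesis using ev_h[of c, OF c] L(2)[rule_format, OF that] eq[OF that] by (simp add: a_minus_def r_neg)
  qed
  have grid: "ev x q = comb L x" if x: "x \<in> points n D" for x
  proof -
    have xc: "x j \<in> carrier R" for j using points_in_subring[OF subring_D x] D_carrier by blast
    \<comment> \<open>The vector of parameters, in general not constant, that has the jet \<open>x\<close>.\<close>
    define c where "c k = (if k < n then \<Oplus>j\<in>{..<n}. x j \<otimes> B j k else \<zero>)" for k
    have cs: "(\<Oplus>j\<in>{..<n}. x j \<otimes> B j k) \<in> carrier R" for k
      using xc B(1) by (auto intro!: finsum_closed)
    then have cc: "c k \<in> carrier R" for k by (simp add: c_def)
    have "sol_jet c i = x i" for i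
    proof (cases "i < n")
      case True
      have "sol_jet c i = sol_jet (\<lambda>k. \<Oplus>j\<in>{..<n}. x j \<otimes> B j k) i"
        unfolding sol_jet_def if_P[OF True] using cs deriv_z_closed
        by (intro finsum_cong') (auto simp: c_def)
      then show ?thesis using B(2)[of x, OF xc True] by simp
    next
      case False
      then show ?thesis using x by (simp add: sol_jet_def points_def)
    qed
    then have jet: "sol_jet c = x" by auto
    have "c \<in> points n (carrier R)" using cs by (auto simp: points_def c_def)
    from vanishing_on_infinite_grid[OF set_h C_carrier infinite_constants h0 this]
    have "ev x q \<ominus> comb L x = \<zero>" using ev_h[of c, OF cc] jet by simp
    moreover have "ev x q \<in> carrier R" "comb L x \<in> carrier R"
      using ev_closed[OF xc qR] ev_closed[OF xc set_L] by (auto simp: ev_comb_pexp)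
    ultimately show ?thesis by simp
  qed
  have "\<exists>m\<in>M. \<forall>x\<in>points n D. ev x q = ev x m"
  proof (rule elimination_of_coefficients)
    show "subfield D R" using D by (simp add: diff_subfield_def)
    show "Const \<zero> \<in> M" using M by (simp add: diff_ideal_def)
    show "Add p (Mul (Const d) r) \<in> M" if "p \<in> M" "r \<in> M" "d \<in> D" for p r d
      using that by (intro diff_idealD(2,3)[OF M]) auto
    show "x i \<in> D" if "x \<in> points n D" for x i
      using points_in_subring[OF subring_D that] .
    show "fst t \<in> carrier R \<and> snd t \<in> M" if "t \<in> set L" for t using L(1) that by simp
  qed (use grid q diff_idealD(1)[OF M] in auto)
  then obtain m where "m \<in> M" "\<forall>x\<in>points n D. ev x q = ev x m" by (elim bexE)
  then show ?thesis using q by (auto intro: diff_idealD(5)[OF M \<open>m \<in> M\<close>])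
qed

end

section \<open>Specialisation of homomorphisms into an algebraically closed field\<close>

lemma (in ring) eval_coefficient_list:
  assumes "\<And>i. g i \<in> carrier R" "t \<in> carrier R"
  shows "eval (map g (rev [0..<Suc d])) t = (\<Oplus>i\<in>{..d}. g i \<otimes> t [^] i)"
  using assms by (induction d) auto

lemma (in field) coefficient_list_polynomial:
  assumes "\<And>i. g i \<in> carrier R" "g d \<noteq> \<zero>"
  shows "map g (rev [0..<Suc d]) \<in> carrier (poly_ring R)"
  using assms by (auto simp: univ_poly_carrier[symmetric] polynomial_def)

lemma (in algebraically_closed) root_exists:
  assumes "\<And>i. g i \<in> carrier L" "g d \<noteq> \<zero>" "d > 0"
  shows "\<exists>t\<in>carrier L. (\<Oplus>i\<in>{..d}. g i \<otimes> t [^] (i :: nat)) = \<zero>"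
proof -
  let ?p = "map g (rev [0..<Suc d])"
  have p: "?p \<in> carrier (poly_ring L)" using assms by (intro coefficient_list_polynomial) auto
  have "splitted ?p" using roots_over_carrier[OF p] .
  then have "size (roots ?p) = d" by (simp add: splitted_def)
  then have "roots ?p \<noteq> {#}" using assms(3) by auto
  then obtain t where "t \<in># roots ?p" by blast
  then have "is_root ?p t" using roots_mem_iff_is_root[OF p] by blast
  then show ?thesis using eval_coefficient_list[of g t d] assms(1)
    by (intro bexI[of _ t]) (auto simp: is_root_def)
qed

lemma (in field) nonroot_exists:
  assumes "\<And>i. g i \<in> carrier R" "g d \<noteq> \<zero>" "infinite (carrier R)"
  shows "\<exists>t\<in>carrier R. (\<Oplus>i\<in>{..d}. g i \<otimes> t [^] (i :: nat)) \<noteq> \<zero>"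
proof (rule ccontr)
  assume neg: "\<not> ?thesis"
  let ?p = "map g (rev [0..<Suc d])"
  have p: "?p \<in> carrier (poly_ring R)" using assms by (intro coefficient_list_polynomial) auto
  have "carrier R \<subseteq> {t. is_root ?p t}"
    using neg eval_coefficient_list[of g _ d] assms(1) by (auto simp: is_root_def)
  then show False using finite_number_of_roots[OF p] assms(3) finite_subset by blast
qed

lemma (in domain) pow_nonzero: "u \<in> carrier R \<Longrightarrow> u \<noteq> \<zero> \<Longrightarrow> u [^] (k :: nat) \<noteq> \<zero>"
  by (induction k) (auto simp: integral_iff)

text \<open>
  The subring \<open>A[x]\<close> of a domain \<open>Q\<close>, as the image of evaluation at \<open>x\<close>.
\<close>

locale adjoin_element = Q: domain Q for Q (structure) +
  fixes A :: "'a set" and x :: 'a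
  assumes A: "subring A Q" and x: "x \<in> carrier Q"
begin

abbreviation "R \<equiv> Q\<lparr>carrier := A\<rparr>"
abbreviation "P \<equiv> UP R"
abbreviation "at_x \<equiv> UnivPoly.eval R Q id x"

definition adjoined :: "'a set" where "adjoined = at_x ` carrier P"

lemma domain_R: "domain R" using Q.subring_is_domain[OF A] .

sublocale R: domain R by (rule domain_R)
sublocale UP: UP_domain R P by unfold_locales

lemma A_carrier: "A \<subseteq> carrier Q" using subringE(1)[OF A] .

lemma hom_id: "id \<in> ring_hom R Q" using A_carrier by (auto intro!: ring_hom_memI)

sublocale at_x: UP_pre_univ_prop R Q id P
  by (intro UP_pre_univ_prop.intro ring_hom_cringI UP.UP_cring_axioms R.is_cring Q.is_cring hom_id)
    (simp_all)

lemma at_x_hom: "at_x \<in> ring_hom P Q" using at_x.eval_ring_hom[OF x] .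

sublocale at_x_hom: ring_hom_cring P Q at_x
  by (intro ring_hom_cringI UP.P.is_cring Q.is_cring at_x_hom)

lemma at_x_const: "c \<in> A \<Longrightarrow> at_x (monom P c 0) = c"
  using at_x.eval_const[OF x] by simp

lemma subring_adjoined: "subring adjoined Q"
  unfolding adjoined_def
  using ring_hom_ring.img_is_subring[OF ring_hom_ringI2[OF UP.P.ring_axioms Q.ring_axioms at_x_hom]
      ring.carrier_is_subring[OF UP.P.ring_axioms]] .

lemma A_subset_adjoined: "A \<subseteq> adjoined"
proof
  fix c assume "c \<in> A"
  then show "c \<in> adjoined" unfolding adjoined_def
    using at_x_const by (intro image_eqI[of _ _ "monom P c 0"]) auto
qed

lemma x_adjoined: "x \<in> adjoined"
  unfolding adjoined_def using at_x.eval_monom1[OF x]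
  by (intro image_eqI[of _ _ "monom P \<one>\<^bsub>R\<^esub> 1"]) (auto intro!: UP.monom_closed subringE(3)[OF A])

text \<open>
  Evaluation at \<open>t\<close> after \<open>\<phi>\<close> factors through evaluation at \<open>x\<close>.
\<close>

lemma extend_hom:
  assumes L: "cring L" and \<phi>: "\<phi> \<in> ring_hom R L" and t: "t \<in> carrier L"
    and ker: "\<And>p. p \<in> carrier P \<Longrightarrow> at_x p = \<zero> \<Longrightarrow> UnivPoly.eval R L \<phi> t p = \<zero>\<^bsub>L\<^esub>"
  shows "\<exists>\<psi> \<in> ring_hom (Q\<lparr>carrier := adjoined\<rparr>) L.
    (\<forall>p\<in>carrier P. \<psi> (at_x p) = UnivPoly.eval R L \<phi> t p) \<and> (\<forall>c\<in>A. \<psi> c = \<phi> c)"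
proof -
  interpret \<phi>: UP_pre_univ_prop R L \<phi> P
    by (intro UP_pre_univ_prop.intro ring_hom_cringI UP.UP_cring_axioms R.is_cring L \<phi>)
      (simp_all)
  let ?e = "UnivPoly.eval R L \<phi> t"
  interpret e: ring_hom_cring P L ?e
    by (intro ring_hom_cringI UP.P.is_cring L \<phi>.eval_ring_hom t)
  have wd: "?e p = ?e q" if "p \<in> carrier P" "q \<in> carrier P" "at_x p = at_x q" for p q
  proof -
    have "at_x (p \<ominus>\<^bsub>P\<^esub> q) = \<zero>" using that by (simp add: a_minus_def Q.r_neg)
    then have "?e (p \<ominus>\<^bsub>P\<^esub> q) = \<zero>\<^bsub>L\<^esub>" using that by (intro ker) auto
    then have "?e p \<ominus>\<^bsub>L\<^esub> ?e q = \<zero>\<^bsub>L\<^esub>" using that by (simp add: a_minus_def)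
    then show ?thesis using that by simp
  qed
  define \<psi> where "\<psi> y = ?e (SOME p. p \<in> carrier P \<and> at_x p = y)" for y
  have \<psi>: "\<psi> (at_x p) = ?e p" if "p \<in> carrier P" for p
  proof -
    have "(SOME q. q \<in> carrier P \<and> at_x q = at_x p) \<in> carrier P \<and>
        at_x (SOME q. q \<in> carrier P \<and> at_x q = at_x p) = at_x p"
      by (rule someI[of _ p]) (use that in simp)
    then show ?thesis unfolding \<psi>_def using that by (intro wd) auto
  qed
  have "\<psi> \<in> ring_hom (Q\<lparr>carrier := adjoined\<rparr>) L"
  proof (rule ring_hom_memI)
    show "\<psi> y \<in> carrier L" if "y \<in> carrier (Q\<lparr>carrier := adjoined\<rparr>)" for y
      using that \<psi> by (auto simp: adjoined_def)
    fix y1 y2 assume "y1 \<in> carrier (Q\<lparr>carrier := adjoined\<rparr>)" "y2 \<in> carrier (Q\<lparr>carrier := adjoined\<rparr>)"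
    then obtain p q where pq: "p \<in> carrier P" "q \<in> carrier P" "y1 = at_x p" "y2 = at_x q"
      by (auto simp: adjoined_def)
    show "\<psi> (y1 \<otimes>\<^bsub>Q\<lparr>carrier := adjoined\<rparr>\<^esub> y2) = \<psi> y1 \<otimes>\<^bsub>L\<^esub> \<psi> y2"
      using pq \<psi>[of "p \<otimes>\<^bsub>P\<^esub> q"] \<psi>[of p] \<psi>[of q] by simp
    show "\<psi> (y1 \<oplus>\<^bsub>Q\<lparr>carrier := adjoined\<rparr>\<^esub> y2) = \<psi> y1 \<oplus>\<^bsub>L\<^esub> \<psi> y2"
      using pq \<psi>[of "p \<oplus>\<^bsub>P\<^esub> q"] \<psi>[of p] \<psi>[of q] by simp
  next
    show "\<psi> \<one>\<^bsub>Q\<lparr>carrier := adjoined\<rparr>\<^esub> = \<one>\<^bsub>L\<^esub>"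
      using \<psi>[of "\<one>\<^bsub>P\<^esub>"] by simp
  qed
  moreover have "\<psi> c = \<phi> c" if "c \<in> A" for c
    using \<psi>[of "monom P c 0"] at_x_const[OF that] \<phi>.eval_const[OF t, of c] that by simp
  ultimately show ?thesis using \<psi> by (intro bexI[of _ \<psi>] conjI ballI)
qed

lemma at_x_small_degree:
  "p \<in> carrier P \<Longrightarrow> deg R p = 0 \<Longrightarrow> p = monom P (at_x p) 0 \<and> at_x p \<in> A \<and> at_x p = coeff P p 0"
  using UP.deg_zero_impl_monom[of p] at_x_const[of "coeff P p 0"] UP.coeff_closed[of p 0] by simp

text \<open>
  If \<open>x\<close> is algebraic over \<open>A\<close>, then every nonzero element of \<open>A[x]\<close> divides a nonzero element of \<open>A\<close>,
  as the norm would show. Here \<open>g\<close> is a relation for \<open>x\<close> of minimal degree. Among the polynomials of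
  smaller degree whose value is a nonzero multiple of \<open>at_x f\<close>, let \<open>r\<close> have minimal degree, and divide
  \<open>g\<close> by \<open>r\<close>. The remainder is zero by the choice of \<open>r\<close>, and so the quotient has the root \<open>x\<close>. If \<open>r\<close>
  were not constant, the quotient would have smaller degree than \<open>g\<close>.
\<close>

lemma norm_in_A:
  assumes g: "g \<in> carrier P" "g \<noteq> \<zero>\<^bsub>P\<^esub>" "at_x g = \<zero>"
    and g_min: "\<forall>p\<in>carrier P. at_x p = \<zero> \<longrightarrow> deg R p < deg R g \<longrightarrow> p = \<zero>\<^bsub>P\<^esub>"
    and f: "f \<in> carrier P" "at_x f \<noteq> \<zero>"
  shows "\<exists>h\<in>carrier P. \<exists>c\<in>A. c \<noteq> \<zero> \<and> c = at_x f \<otimes> at_x h"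
proof -
  have pow: "u [^]\<^bsub>R\<^esub> k \<in> A" "u [^]\<^bsub>R\<^esub> k \<noteq> \<zero>" if "u \<in> A" "u \<noteq> \<zero>" for u and k :: nat
    using that R.nat_pow_closed[of u k] R.pow_nonzero[of u k] by auto
  have at_smult: "at_x (u \<odot>\<^bsub>P\<^esub> p) = u \<otimes> at_x p" if "u \<in> A" "p \<in> carrier P" for u p
    using that by (simp add: UP.monom_mult_is_smult[symmetric] at_x_const)
  have lc: "coeff P p (deg R p) \<in> A" "coeff P p (deg R p) \<noteq> \<zero>"
    if "p \<in> carrier P" "p \<noteq> \<zero>\<^bsub>P\<^esub>" for p
    using UP.lcoeff_closed[OF that(1)] UP.lcoeff_nonzero2[OF that] by auto
  define S where "S = {r \<in> carrier P. at_x r \<noteq> \<zero> \<and> deg R r < deg R g \<and>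
    (\<exists>h\<in>carrier P. at_x r = at_x f \<otimes> at_x h)}"
  have "\<exists>r. r \<in> S"
  proof -
    \<comment> \<open>The degree of \<open>f\<close> is arbitrary; division by \<open>g\<close> produces a multiple of \<open>at_x f\<close> of degree below that of \<open>g\<close>.\<close>
    obtain q r and k :: nat where qr: "q \<in> carrier P" "r \<in> carrier P"
      "coeff P g (deg R g) [^]\<^bsub>R\<^esub> k \<odot>\<^bsub>P\<^esub> f = g \<otimes>\<^bsub>P\<^esub> q \<oplus>\<^bsub>P\<^esub> r" "r = \<zero>\<^bsub>P\<^esub> \<or> deg R r < deg R g"
      using UP.long_div_theorem[OF g(1) f(1) g(2)] by blast
    let ?u = "coeff P g (deg R g) [^]\<^bsub>R\<^esub> k"
    have u: "?u \<in> A" "?u \<noteq> \<zero>" using pow lc[OF g(1,2)] by auto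
    have uQ: "?u \<in> carrier Q" using u A_carrier by blast
    have "?u \<otimes> at_x f = \<zero> \<otimes> at_x q \<oplus> at_x r"
      using arg_cong[OF qr(3), of at_x] at_smult[OF u(1) f(1)] qr(1,2) g f by simp
    then have r: "at_x r = at_x f \<otimes> ?u" using qr uQ f by (simp add: Q.m_comm)
    then have "at_x r \<noteq> \<zero>" using u uQ f by (simp add: Q.integral_iff)
    then have "r \<noteq> \<zero>\<^bsub>P\<^esub>" by auto
    then have "r \<in> S" unfolding S_def using qr r \<open>at_x r \<noteq> \<zero>\<close> u at_x_const[OF u(1)]
      by (auto intro!: bexI[of _ "monom P ?u 0"])
    then show ?thesis by blast
  qed
  then obtain r where r: "r \<in> S" and r_min: "\<And>s. s \<in> S \<Longrightarrow> deg R r \<le> deg R s"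
    using arg_min_natI[of "\<lambda>r. r \<in> S"] arg_min_nat_le[of "\<lambda>r. r \<in> S" _ "deg R"] by metis
  obtain h where h: "h \<in> carrier P" "at_x r = at_x f \<otimes> at_x h" and rP: "r \<in> carrier P"
    and r0: "at_x r \<noteq> \<zero>" and rg: "deg R r < deg R g"
    using r unfolding S_def by blast
  have "r \<noteq> \<zero>\<^bsub>P\<^esub>" using r0 by auto
  have "deg R r = 0"
  proof (rule ccontr)
    assume "deg R r \<noteq> 0"
    obtain q s and k :: nat where qs: "q \<in> carrier P" "s \<in> carrier P"
      "coeff P r (deg R r) [^]\<^bsub>R\<^esub> k \<odot>\<^bsub>P\<^esub> g = r \<otimes>\<^bsub>P\<^esub> q \<oplus>\<^bsub>P\<^esub> s" "s = \<zero>\<^bsub>P\<^esub> \<or> deg R s < deg R r"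
      using UP.long_div_theorem[OF rP g(1) \<open>r \<noteq> \<zero>\<^bsub>P\<^esub>\<close>] by blast
    let ?u = "coeff P r (deg R r) [^]\<^bsub>R\<^esub> k"
    have u: "?u \<in> A" "?u \<noteq> \<zero>" using pow lc[OF rP \<open>r \<noteq> \<zero>\<^bsub>P\<^esub>\<close>] by auto
    have uQ: "?u \<in> carrier Q" using u A_carrier by blast
    have "?u \<otimes> at_x g = at_x r \<otimes> at_x q \<oplus> at_x s"
      using arg_cong[OF qs(3), of at_x] at_smult[OF u(1) g(1)] qs(1,2) rP by simp
    then have rel: "at_x r \<otimes> at_x q \<oplus> at_x s = \<zero>" using g uQ by simp
    have "at_x s = \<ominus> (at_x r \<otimes> at_x q)"
      using rel qs(1,2) rP by (metis Q.a_comm Q.m_closed Q.minus_equality at_x_hom.hom_closed)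
    also have "\<dots> = at_x f \<otimes> at_x (\<ominus>\<^bsub>P\<^esub> (h \<otimes>\<^bsub>P\<^esub> q))"
      using h f qs by (simp add: Q.m_assoc Q.r_minus)
    finally have s: "at_x s = at_x f \<otimes> at_x (\<ominus>\<^bsub>P\<^esub> (h \<otimes>\<^bsub>P\<^esub> q))" .
    have s0: "s = \<zero>\<^bsub>P\<^esub>"
    proof (rule ccontr)
      assume "s \<noteq> \<zero>\<^bsub>P\<^esub>"
      then have sr: "deg R s < deg R r" using qs by blast
      then have "at_x s \<noteq> \<zero>" using g_min qs(2) rg \<open>s \<noteq> \<zero>\<^bsub>P\<^esub>\<close> by auto
      moreover have "\<ominus>\<^bsub>P\<^esub> (h \<otimes>\<^bsub>P\<^esub> q) \<in> carrier P" using h qs by simp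
      ultimately have "s \<in> S" unfolding S_def using s qs(2) sr rg by auto
      then show False using r_min[of s] sr by simp
    qed
    then have "at_x r \<otimes> at_x q = \<zero>" using rel rP qs(1) by simp
    then have q0: "at_x q = \<zero>" using r0 rP qs(1) by (simp add: Q.integral_iff)
    have eq: "?u \<odot>\<^bsub>P\<^esub> g = r \<otimes>\<^bsub>P\<^esub> q" using qs s0 rP by simp
    have dg: "deg R (?u \<odot>\<^bsub>P\<^esub> g) = deg R g" using u g by (simp add: UP.deg_smult)
    have "q \<noteq> \<zero>\<^bsub>P\<^esub>" using eq dg rP rg by auto
    then have "deg R (r \<otimes>\<^bsub>P\<^esub> q) = deg R r + deg R q"
      using rP qs(1) \<open>r \<noteq> \<zero>\<^bsub>P\<^esub>\<close> by (simp add: UP.deg_mult)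
    then have "deg R q < deg R g" using dg eq \<open>deg R r \<noteq> 0\<close> by simp
    then show False using g_min qs(1) q0 \<open>q \<noteq> \<zero>\<^bsub>P\<^esub>\<close> by blast
  qed
  then show ?thesis using at_x_small_degree[OF rP] h r0 by metis
qed

text \<open>
  Chevalley's extension lemma for \<open>A[x]\<close>. Write \<open>b = at_x f\<close>. If \<open>x\<close> is transcendental over \<open>A\<close>, let
  \<open>a\<close> be the leading coefficient of \<open>f\<close> and send \<open>x\<close> to a value at which the image of \<open>f\<close> is nonzero. If
  \<open>x\<close> has a relation, let \<open>g\<close> be one of minimal degree and send \<open>x\<close> to a root of the image of \<open>g\<close>. In
  this case \<open>a\<close> is the leading coefficient of \<open>g\<close> times a nonzero multiple \<open>c\<close> of \<open>b\<close> in \<open>A\<close>. The first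
  factor ensures that the image of \<open>g\<close> has a root and, by division with remainder, that every
  relation for \<open>x\<close> is respected; the second that \<open>b\<close> does not go to zero.
\<close>

theorem specialisation_step:
  assumes b: "b \<in> adjoined" "b \<noteq> \<zero>"
  shows "\<exists>a\<in>A. a \<noteq> \<zero> \<and> (\<forall>L \<phi>. algebraically_closed (L :: ('c, 'd) ring_scheme) \<longrightarrow> infinite (carrier L) \<longrightarrow>
    \<phi> \<in> ring_hom R L \<longrightarrow> \<phi> a \<noteq> \<zero>\<^bsub>L\<^esub> \<longrightarrow>
    (\<exists>\<psi>\<in>ring_hom (Q\<lparr>carrier := adjoined\<rparr>) L. (\<forall>c\<in>A. \<psi> c = \<phi> c) \<and> \<psi> b \<noteq> \<zero>\<^bsub>L\<^esub>))"
proof -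
  obtain f where f: "f \<in> carrier P" "b = at_x f" using b(1) by (auto simp: adjoined_def)
  then have "f \<noteq> \<zero>\<^bsub>P\<^esub>" using b(2) by auto
  have lc: "coeff P p (deg R p) \<in> A" "coeff P p (deg R p) \<noteq> \<zero>"
    if "p \<in> carrier P" "p \<noteq> \<zero>\<^bsub>P\<^esub>" for p
    using UP.lcoeff_closed[OF that(1)] UP.lcoeff_nonzero2[OF that] by auto
  show ?thesis
  proof (cases "\<forall>p\<in>carrier P. at_x p = \<zero> \<longrightarrow> p = \<zero>\<^bsub>P\<^esub>")
    case True
    show ?thesis
    proof (intro bexI[of _ "coeff P f (deg R f)"] conjI allI impI)
      fix L :: "('c, 'd) ring_scheme" and \<phi>
      assume L: "algebraically_closed L" and inf: "infinite (carrier L)" and \<phi>: "\<phi> \<in> ring_hom R L"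
        and nz: "\<phi> (coeff P f (deg R f)) \<noteq> \<zero>\<^bsub>L\<^esub>"
      interpret L: algebraically_closed L by fact
      have \<phi>c: "\<phi> (coeff P f i) \<in> carrier L" for i
        using ring_hom_closed[OF \<phi>] UP.coeff_closed[OF f(1)] by simp
      obtain t where t: "t \<in> carrier L" "UnivPoly.eval R L \<phi> t f \<noteq> \<zero>\<^bsub>L\<^esub>"
        using L.nonroot_exists[of "\<lambda>i. \<phi> (coeff P f i)" "deg R f"] \<phi>c nz inf
          UP.eval_on_carrier[OF f(1), where S = L and phi = \<phi>] by auto
      have "UnivPoly.eval R L \<phi> t p = \<zero>\<^bsub>L\<^esub>" if "p \<in> carrier P" "at_x p = \<zero>" for p
      proof -
        have "p = \<zero>\<^bsub>P\<^esub>" using True that by blast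
        moreover interpret \<phi>: UP_pre_univ_prop R L \<phi> P
          by (intro UP_pre_univ_prop.intro ring_hom_cringI UP.UP_cring_axioms R.is_cring L.is_cring \<phi>)
            (simp_all)
        interpret e: ring_hom_cring P L "UnivPoly.eval R L \<phi> t"
          by (intro ring_hom_cringI UP.P.is_cring L.is_cring \<phi>.eval_ring_hom t)
        show ?thesis using \<open>p = \<zero>\<^bsub>P\<^esub>\<close> by (simp only: e.hom_zero)
      qed
      from extend_hom[OF L.is_cring \<phi> t(1) this] f t(2)
      show "\<exists>\<psi>\<in>ring_hom (Q\<lparr>carrier := adjoined\<rparr>) L. (\<forall>c\<in>A. \<psi> c = \<phi> c) \<and> \<psi> b \<noteq> \<zero>\<^bsub>L\<^esub>"
        by metis
    qed (use lc[OF f(1) \<open>f \<noteq> \<zero>\<^bsub>P\<^esub>\<close>] in auto)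
  next
    case False
    define G where "G = {p \<in> carrier P. p \<noteq> \<zero>\<^bsub>P\<^esub> \<and> at_x p = \<zero>}"
    have "\<exists>g. g \<in> G" using False by (auto simp: G_def)
    then obtain g where "g \<in> G" and "\<And>p. p \<in> G \<Longrightarrow> deg R g \<le> deg R p"
      using arg_min_natI[of "\<lambda>r. r \<in> G"] arg_min_nat_le[of "\<lambda>r. r \<in> G" _ "deg R"] by metis
    then have g: "g \<in> carrier P" "g \<noteq> \<zero>\<^bsub>P\<^esub>" "at_x g = \<zero>"
      and g_min: "\<And>p. p \<in> carrier P \<Longrightarrow> at_x p = \<zero> \<Longrightarrow> deg R p < deg R g \<Longrightarrow> p = \<zero>\<^bsub>P\<^esub>"
      unfolding G_def by force+
    have deg_g: "deg R g > 0"
    proof (rule ccontr)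
      assume "\<not> deg R g > 0"
      then have d: "deg R g = 0" by simp
      then have "coeff P g (deg R g) = at_x g" using at_x_small_degree[OF g(1) d] by metis
      then show False using g(3) lc(2)[OF g(1,2)] by simp
    qed
    obtain h c where h: "h \<in> carrier P" and c: "c \<in> A" "c \<noteq> \<zero>" "c = at_x f \<otimes> at_x h"
    proof -
      have "at_x f \<noteq> \<zero>" using f(2) b(2) by simp
      have "\<forall>p\<in>carrier P. at_x p = \<zero> \<longrightarrow> deg R p < deg R g \<longrightarrow> p = \<zero>\<^bsub>P\<^esub>"
        using g_min by blast
      from norm_in_A[OF g this f(1) \<open>at_x f \<noteq> \<zero>\<close>] that show thesis by (elim bexE conjE)
    qed
    let ?u = "coeff P g (deg R g)"
    show ?thesis
    proof (intro bexI[of _ "?u \<otimes> c"] conjI allI impI)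
      have "?u \<in> carrier Q" "c \<in> carrier Q" using lc(1)[OF g(1,2)] c(1) A_carrier by blast+
      then show "?u \<otimes> c \<noteq> \<zero>" using Q.integral[of ?u c] lc(2)[OF g(1,2)] c(2) by blast
      show "?u \<otimes> c \<in> A" using subringE(6)[OF A lc(1)[OF g(1,2)] c(1)] .
      fix L :: "('c, 'd) ring_scheme" and \<phi>
      assume L: "algebraically_closed L" and \<phi>: "\<phi> \<in> ring_hom R L"
        and nz: "\<phi> (?u \<otimes> c) \<noteq> \<zero>\<^bsub>L\<^esub>"
      interpret L: algebraically_closed L by fact
      interpret \<phi>: UP_pre_univ_prop R L \<phi> P
        by (intro UP_pre_univ_prop.intro ring_hom_cringI UP.UP_cring_axioms R.is_cring L.is_cring \<phi>)
          (simp_all)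
      have "\<phi> (?u \<otimes> c) = \<phi> ?u \<otimes>\<^bsub>L\<^esub> \<phi> c"
        using lc(1)[OF g(1,2)] c(1) \<phi>.hom_mult[of ?u c] by simp
      moreover have "\<phi> ?u \<in> carrier L" "\<phi> c \<in> carrier L"
        using ring_hom_closed[OF \<phi>] lc(1)[OF g(1,2)] c(1) by simp_all
      ultimately have nz: "\<phi> ?u \<noteq> \<zero>\<^bsub>L\<^esub>" "\<phi> c \<noteq> \<zero>\<^bsub>L\<^esub>" using nz by auto
      have \<phi>c: "\<phi> (coeff P g i) \<in> carrier L" for i
        using ring_hom_closed[OF \<phi>] UP.coeff_closed[OF g(1)] by simp
      obtain t where t: "t \<in> carrier L" "UnivPoly.eval R L \<phi> t g = \<zero>\<^bsub>L\<^esub>"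
        using L.root_exists[of "\<lambda>i. \<phi> (coeff P g i)" "deg R g"] \<phi>c nz(1) deg_g
          UP.eval_on_carrier[OF g(1), where S = L and phi = \<phi>] by auto
      interpret e: ring_hom_cring P L "UnivPoly.eval R L \<phi> t"
        by (intro ring_hom_cringI UP.P.is_cring L.is_cring \<phi>.eval_ring_hom t)
      have "UnivPoly.eval R L \<phi> t p = \<zero>\<^bsub>L\<^esub>" if p: "p \<in> carrier P" "at_x p = \<zero>" for p
      proof -
        obtain q r and k :: nat where qr: "q \<in> carrier P" "r \<in> carrier P"
          "?u [^]\<^bsub>R\<^esub> k \<odot>\<^bsub>P\<^esub> p = g \<otimes>\<^bsub>P\<^esub> q \<oplus>\<^bsub>P\<^esub> r" "r = \<zero>\<^bsub>P\<^esub> \<or> deg R r < deg R g"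
          using UP.long_div_theorem[OF g(1) p(1) g(2)] by blast
        have uk: "?u [^]\<^bsub>R\<^esub> k \<in> carrier R" using lc[OF g(1,2)] R.nat_pow_closed by auto
        have eq: "monom P (?u [^]\<^bsub>R\<^esub> k) 0 \<otimes>\<^bsub>P\<^esub> p = g \<otimes>\<^bsub>P\<^esub> q \<oplus>\<^bsub>P\<^esub> r"
          using qr(3) p uk by (simp add: UP.monom_mult_is_smult)
        have "at_x (monom P (?u [^]\<^bsub>R\<^esub> k) 0 \<otimes>\<^bsub>P\<^esub> p) = \<zero>" using p uk by simp
        then have "at_x r = \<zero>" using qr(1,2) g by (simp add: eq)
        then have r: "r = \<zero>\<^bsub>P\<^esub>" using qr g_min by blast
        have "UnivPoly.eval R L \<phi> t (monom P (?u [^]\<^bsub>R\<^esub> k) 0 \<otimes>\<^bsub>P\<^esub> p) = \<zero>\<^bsub>L\<^esub>"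
          unfolding eq using r qr(1) g t by simp
        then have "\<phi> (?u [^]\<^bsub>R\<^esub> k) \<otimes>\<^bsub>L\<^esub> UnivPoly.eval R L \<phi> t p = \<zero>\<^bsub>L\<^esub>"
          using p uk \<phi>.eval_const[OF t(1) uk] by simp
        moreover have "\<phi> (?u [^]\<^bsub>R\<^esub> k) = \<phi> ?u [^]\<^bsub>L\<^esub> k" using lc[OF g(1,2)] by simp
        moreover have "\<phi> ?u [^]\<^bsub>L\<^esub> k \<noteq> \<zero>\<^bsub>L\<^esub>" using nz(1) \<phi>c L.pow_nonzero by simp
        ultimately show ?thesis using p \<phi>c by (simp add: L.integral_iff)
      qed
      from extend_hom[OF L.is_cring \<phi> t(1) this] obtain \<psi> where
        \<psi>: "\<psi> \<in> ring_hom (Q\<lparr>carrier := adjoined\<rparr>) L" "\<forall>c\<in>A. \<psi> c = \<phi> c" by blast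
      have mem: "b \<in> adjoined" "at_x h \<in> adjoined" using b h by (auto simp: adjoined_def)
      have "\<psi> b \<otimes>\<^bsub>L\<^esub> \<psi> (at_x h) = \<phi> c"
        using ring_hom_mult[OF \<psi>(1), of b "at_x h"] mem c f \<psi>(2) by simp
      then have "\<psi> b \<noteq> \<zero>\<^bsub>L\<^esub>"
        using nz(2) ring_hom_closed[OF \<psi>(1), of "at_x h"] mem by auto
      then show "\<exists>\<psi>\<in>ring_hom (Q\<lparr>carrier := adjoined\<rparr>) L. (\<forall>c\<in>A. \<psi> c = \<phi> c) \<and> \<psi> b \<noteq> \<zero>\<^bsub>L\<^esub>"
        using \<psi> by blast
    qed
  qed
qed

end

text \<open>
  An ideal \<open>M\<close> maximal among those that contain \<open>I\<close> but no power of \<open>w\<close> is prime. If \<open>x\<close> and \<open>y\<close> are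
  not in \<open>M\<close>, then adjoining \<open>x\<close> or \<open>y\<close> to \<open>M\<close> makes it contain a power of \<open>w\<close>, and the product of the
  two powers would lie in \<open>M\<close> if \<open>x \<otimes> y\<close> did.
\<close>

lemma (in cring) prime_ideal_avoiding_powers:
  assumes I: "ideal I R" and w: "w \<in> carrier R" and avoid: "\<And>k :: nat. w [^] k \<notin> I"
  shows "\<exists>Q. primeideal Q R \<and> I \<subseteq> Q \<and> w \<notin> Q"
proof -
  define S where "S = {J. ideal J R \<and> I \<subseteq> J \<and> (\<forall>k :: nat. w [^] k \<notin> J)}"
  have "\<exists>M\<in>S. \<forall>J\<in>S. M \<subseteq> J \<longrightarrow> J = M"
  proof (rule subset_Zorn_nonempty)
    show "S \<noteq> {}" using I avoid by (auto simp: S_def)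
    fix C assume C: "C \<noteq> {}" "subset.chain S C"
    then have "subset.chain {I. ideal I R} C"
      unfolding pred_on.chain_def S_def by auto
    then have "ideal (\<Union>C) R" using chain_Union_is_ideal[of C] C(1) by simp
    moreover have CS: "J \<in> S" if "J \<in> C" for J using C(2) that unfolding pred_on.chain_def by blast
    moreover have "I \<subseteq> \<Union>C"
    proof -
      obtain J where "J \<in> C" using C(1) by blast
      then show ?thesis using CS[of J] by (auto simp: S_def)
    qed
    moreover have "\<forall>k :: nat. w [^] k \<notin> \<Union>C" using CS by (auto simp: S_def)
    ultimately show "\<Union>C \<in> S" by (simp add: S_def)
  qed
  then obtain M where M: "M \<in> S" "\<And>J. J \<in> S \<Longrightarrow> M \<subseteq> J \<Longrightarrow> J = M" by (elim bexE) auto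
  then interpret M: ideal M R by (simp add: S_def)
  have M_avoid: "w [^] k \<notin> M" for k :: nat using M(1) by (simp add: S_def)
  have power_in: "\<exists>(k :: nat) m r. m \<in> M \<and> r \<in> carrier R \<and> w [^] k = m \<oplus> r \<otimes> x"
    if x: "x \<in> carrier R" "x \<notin> M" for x
  proof -
    let ?J = "set_add R M (PIdl x)"
    have J: "ideal ?J R" using add_ideals[OF M.is_ideal cgenideal_ideal[OF x(1)]] .
    have memJ: "m \<oplus> r \<otimes> x \<in> ?J" if "m \<in> M" "r \<in> carrier R" for m r
      using that by (auto simp: set_add_def' cgenideal_def)
    have "M \<subseteq> ?J"
    proof
      fix m assume "m \<in> M"
      then show "m \<in> ?J" using memJ[of m \<zero>] x M.Icarr by simp
    qed
    moreover have "x \<in> ?J" using memJ[of \<zero> \<one>] x M.zero_closed by simp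
    ultimately have "?J \<notin> S" using M(2)[of ?J] x by auto
    then obtain k :: nat where "w [^] k \<in> ?J" using J \<open>M \<subseteq> ?J\<close> M(1) by (auto simp: S_def)
    then show ?thesis by (auto simp: set_add_def' cgenideal_def)
  qed
  have "primeideal M R"
  proof (rule primeidealI[OF M.is_ideal is_cring])
    show "carrier R \<noteq> M" using M_avoid[of 0] by auto
    fix x y assume xy: "x \<in> carrier R" "y \<in> carrier R" "x \<otimes> y \<in> M"
    show "x \<in> M \<or> y \<in> M"
    proof (rule ccontr)
      assume "\<not> (x \<in> M \<or> y \<in> M)"
      then obtain j k :: nat and m r m' r' where
        1: "m \<in> M" "r \<in> carrier R" "w [^] j = m \<oplus> r \<otimes> x" and
        2: "m' \<in> M" "r' \<in> carrier R" "w [^] k = m' \<oplus> r' \<otimes> y"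
        using power_in[OF xy(1)] power_in[OF xy(2)] by auto
      have "w [^] (j + k) = (m \<oplus> r \<otimes> x) \<otimes> (m' \<oplus> r' \<otimes> y)"
        using w 1 2 by (simp add: nat_pow_mult[symmetric])
      also have "\<dots> = (m' \<oplus> r' \<otimes> y) \<otimes> m \<oplus> (r \<otimes> x) \<otimes> m' \<oplus> (r \<otimes> r') \<otimes> (x \<otimes> y)"
        using M.Icarr[OF 1(1)] M.Icarr[OF 2(1)] 1(2) 2(2) xy by algebra
      also have "\<dots> \<in> M"
        using M.I_l_closed[OF 1(1), of "m' \<oplus> r' \<otimes> y"] M.I_l_closed[OF 2(1), of "r \<otimes> x"]
          M.I_l_closed[OF xy(3), of "r \<otimes> r'"] 1(2) 2 xy M.Icarr by auto
      finally show False using M_avoid by blast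
    qed
  qed
  moreover have "w \<notin> M" using M_avoid[of 1] w by simp
  ultimately show ?thesis using M(1) by (auto simp: S_def)
qed

primrec adjoin_list :: "('a, 'm) ring_scheme \<Rightarrow> 'a set \<Rightarrow> 'a list \<Rightarrow> 'a set" where
  "adjoin_list Q A [] = A"
| "adjoin_list Q A (x # xs) = adjoin_element.adjoined Q (adjoin_list Q A xs) x"

context domain
begin

lemma subring_adjoin_list:
  assumes "subring A R" "set xs \<subseteq> carrier R"
  shows "subring (adjoin_list R A xs) R \<and> A \<subseteq> adjoin_list R A xs \<and> set xs \<subseteq> adjoin_list R A xs"
  using assms(2)
proof (induction xs)
  case Nil
  then show ?case using assms(1) by simp
next
  case (Cons x xs)
  interpret adjoin_element R "adjoin_list R A xs" x
    by (intro adjoin_element.intro adjoin_element_axioms.intro domain_axioms) (use Cons in auto)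
  show ?case
    using subring_adjoined A_subset_adjoined x_adjoined Cons by auto
qed

text \<open>
  The element \<open>a\<close> that the step for the last adjoined element provides is passed on as the \<open>b\<close> of the
  remaining ones.
\<close>

theorem specialisation:
  assumes A: "subring A R" and xs: "set xs \<subseteq> carrier R"
    and b: "b \<in> adjoin_list R A xs" "b \<noteq> \<zero>"
  shows "\<exists>a\<in>A. a \<noteq> \<zero> \<and> (\<forall>L \<phi>. algebraically_closed (L :: ('c, 'd) ring_scheme) \<longrightarrow> infinite (carrier L) \<longrightarrow>
    \<phi> \<in> ring_hom (R\<lparr>carrier := A\<rparr>) L \<longrightarrow> \<phi> a \<noteq> \<zero>\<^bsub>L\<^esub> \<longrightarrow>
    (\<exists>\<psi>\<in>ring_hom (R\<lparr>carrier := adjoin_list R A xs\<rparr>) L. (\<forall>c\<in>A. \<psi> c = \<phi> c) \<and> \<psi> b \<noteq> \<zero>\<^bsub>L\<^esub>))"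
  using xs b
proof (induction xs arbitrary: b)
  case Nil
  then show ?case by (intro bexI[of _ b] conjI allI impI) auto
next
  case (Cons x xs)
  let ?A = "adjoin_list R A xs"
  have sub: "subring ?A R" "A \<subseteq> ?A" using subring_adjoin_list[OF A, of xs] Cons.prems(1) by auto
  interpret ext: adjoin_element R ?A x
    by (intro adjoin_element.intro adjoin_element_axioms.intro domain_axioms) (use Cons.prems(1) sub in auto)
  from ext.specialisation_step[of b, where ?'c = 'c and ?'d = 'd] Cons.prems(2,3)
  obtain a' where a': "a' \<in> ?A" "a' \<noteq> \<zero>" and
    step: "\<forall>L \<phi>. algebraically_closed (L :: ('c, 'd) ring_scheme) \<longrightarrow> infinite (carrier L) \<longrightarrow>
      \<phi> \<in> ring_hom (R\<lparr>carrier := ?A\<rparr>) L \<longrightarrow> \<phi> a' \<noteq> \<zero>\<^bsub>L\<^esub> \<longrightarrow>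
      (\<exists>\<psi>\<in>ring_hom (R\<lparr>carrier := ext.adjoined\<rparr>) L. (\<forall>c\<in>?A. \<psi> c = \<phi> c) \<and> \<psi> b \<noteq> \<zero>\<^bsub>L\<^esub>)"
    by auto
  from Cons.IH[OF _ a'] Cons.prems(1) obtain a where a: "a \<in> A" "a \<noteq> \<zero>" and
    ih: "\<forall>L \<phi>. algebraically_closed (L :: ('c, 'd) ring_scheme) \<longrightarrow> infinite (carrier L) \<longrightarrow>
    \<phi> \<in> ring_hom (R\<lparr>carrier := A\<rparr>) L \<longrightarrow> \<phi> a \<noteq> \<zero>\<^bsub>L\<^esub> \<longrightarrow>
    (\<exists>\<psi>\<in>ring_hom (R\<lparr>carrier := ?A\<rparr>) L. (\<forall>c\<in>A. \<psi> c = \<phi> c) \<and> \<psi> a' \<noteq> \<zero>\<^bsub>L\<^esub>)"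
    by auto
  show ?case
  proof (intro bexI[of _ a] conjI allI impI)
    fix L :: "('c, 'd) ring_scheme" and \<phi>
    assume L: "algebraically_closed L" "infinite (carrier L)" "\<phi> \<in> ring_hom (R\<lparr>carrier := A\<rparr>) L" "\<phi> a \<noteq> \<zero>\<^bsub>L\<^esub>"
    obtain \<psi>1 where \<psi>1: "\<psi>1 \<in> ring_hom (R\<lparr>carrier := ?A\<rparr>) L" "\<forall>c\<in>A. \<psi>1 c = \<phi> c" "\<psi>1 a' \<noteq> \<zero>\<^bsub>L\<^esub>"
      using ih[rule_format, OF L] by (elim bexE conjE)
    obtain \<psi> where \<psi>: "\<psi> \<in> ring_hom (R\<lparr>carrier := ext.adjoined\<rparr>) L" "\<forall>c\<in>?A. \<psi> c = \<psi>1 c" "\<psi> b \<noteq> \<zero>\<^bsub>L\<^esub>"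
      using step[rule_format, OF L(1,2) \<psi>1(1,3)] by (elim bexE conjE)
    have "\<forall>c\<in>A. \<psi> c = \<phi> c" using \<psi>(2) \<psi>1(2) sub(2) by auto
    then show "\<exists>\<psi>\<in>ring_hom (R\<lparr>carrier := adjoin_list R A (x # xs)\<rparr>) L. (\<forall>c\<in>A. \<psi> c = \<phi> c) \<and> \<psi> b \<noteq> \<zero>\<^bsub>L\<^esub>"
      using \<psi>(1,3) by auto
  qed (use a in auto)
qed

text \<open>
  A homomorphism from a field maps the nonzero element \<open>a\<close> of the preceding theorem to a nonzero
  element. This is the Nullstellensatz in terms of homomorphisms.
\<close>

corollary specialisation_over_field:
  assumes K: "subfield K R" and xs: "set xs \<subseteq> carrier R"
    and b: "b \<in> adjoin_list R K xs" "b \<noteq> \<zero>"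
    and L: "algebraically_closed (L :: ('c, 'd) ring_scheme)" "infinite (carrier L)"
    and \<phi>: "\<phi> \<in> ring_hom (R\<lparr>carrier := K\<rparr>) L"
  shows "\<exists>\<psi>\<in>ring_hom (R\<lparr>carrier := adjoin_list R K xs\<rparr>) L. (\<forall>c\<in>K. \<psi> c = \<phi> c) \<and> \<psi> b \<noteq> \<zero>\<^bsub>L\<^esub>"
proof -
  interpret L: algebraically_closed L by fact
  obtain a where a: "a \<in> K" "a \<noteq> \<zero>" and
    ext: "\<forall>L \<phi>. algebraically_closed (L :: ('c, 'd) ring_scheme) \<longrightarrow> infinite (carrier L) \<longrightarrow>
    \<phi> \<in> ring_hom (R\<lparr>carrier := K\<rparr>) L \<longrightarrow> \<phi> a \<noteq> \<zero>\<^bsub>L\<^esub> \<longrightarrow>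
    (\<exists>\<psi>\<in>ring_hom (R\<lparr>carrier := adjoin_list R K xs\<rparr>) L. (\<forall>c\<in>K. \<psi> c = \<phi> c) \<and> \<psi> b \<noteq> \<zero>\<^bsub>L\<^esub>)"
    using specialisation[OF subfieldE(1)[OF K] xs b, where ?'c = 'c and ?'d = 'd]
    by (elim bexE conjE)
  have inv: "inv a \<in> K" "a \<otimes> inv a = \<one>" using subfield_m_inv[OF K, of a] a by auto
  have "\<phi> a \<noteq> \<zero>\<^bsub>L\<^esub>"
  proof
    assume "\<phi> a = \<zero>\<^bsub>L\<^esub>"
    moreover have "\<phi> (inv a) \<in> carrier L" using ring_hom_closed[OF \<phi>] inv by simp
    moreover have "\<phi> (a \<otimes> inv a) = \<phi> a \<otimes>\<^bsub>L\<^esub> \<phi> (inv a)" using ring_hom_mult[OF \<phi>, of a "inv a"] inv(1) a(1) by simp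
    moreover have "\<phi> \<one> = \<one>\<^bsub>L\<^esub>" using ring_hom_one[OF \<phi>] by simp
    ultimately show False using inv(2) by simp
  qed
  then show ?thesis using ext[rule_format, OF L \<phi>] by blast
qed

end

section \<open>Zeros of differential ideals\<close>

context diff_ideal_and_solutions
begin

definition poly_fun :: "'a pexp \<Rightarrow> (nat \<Rightarrow> 'a) \<Rightarrow> 'a" where
  "poly_fun h = (\<lambda>c\<in>points n C. ev c h)"

text \<open>
  The ring of polynomial functions on \<open>C\<^sup>n\<close> with coefficients in \<open>R\<close>. Restriction to \<open>points n C\<close> makes
  equality of functions the same as equality on \<open>C\<^sup>n\<close>.
\<close>

definition PF :: "((nat \<Rightarrow> 'a) \<Rightarrow> 'a) ring" where
  "PF = \<lparr>carrier = poly_fun ` {h. set_pexp h \<subseteq> carrier R},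
    monoid.mult = (\<lambda>f g. \<lambda>c\<in>points n C. f c \<otimes> g c), monoid.one = (\<lambda>c\<in>points n C. \<one>),
    ring.zero = (\<lambda>c\<in>points n C. \<zero>), ring.add = (\<lambda>f g. \<lambda>c\<in>points n C. f c \<oplus> g c)\<rparr>"

lemma points_C_carrier: "c \<in> points n C \<Longrightarrow> c i \<in> carrier R"
  using points_carrier points_mono[OF C_carrier] by blast

lemma PF_carrierI: "set_pexp h \<subseteq> carrier R \<Longrightarrow> poly_fun h \<in> carrier PF"
  by (simp add: PF_def)

lemma PF_carrierE:
  assumes "f \<in> carrier PF"
  obtains h where "set_pexp h \<subseteq> carrier R" "f = poly_fun h"
  using assms by (auto simp: PF_def)

lemma PF_simps:
  "c \<in> points n C \<Longrightarrow> (f \<otimes>\<^bsub>PF\<^esub> g) c = f c \<otimes> g c"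
  "c \<in> points n C \<Longrightarrow> (f \<oplus>\<^bsub>PF\<^esub> g) c = f c \<oplus> g c"
  "c \<in> points n C \<Longrightarrow> \<one>\<^bsub>PF\<^esub> c = \<one>"
  "c \<in> points n C \<Longrightarrow> \<zero>\<^bsub>PF\<^esub> c = \<zero>"
  "c \<in> points n C \<Longrightarrow> poly_fun h c = ev c h"
  by (simp_all add: PF_def poly_fun_def)

lemma poly_fun_hom:
  "poly_fun (Add p q) = poly_fun p \<oplus>\<^bsub>PF\<^esub> poly_fun q"
  "poly_fun (Mul p q) = poly_fun p \<otimes>\<^bsub>PF\<^esub> poly_fun q"
  "poly_fun (Const \<one>) = \<one>\<^bsub>PF\<^esub>"
  "poly_fun (Const \<zero>) = \<zero>\<^bsub>PF\<^esub>"
  by (auto simp: poly_fun_def PF_def restrict_def)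

lemma PF_closed: "f \<in> carrier PF \<Longrightarrow> c \<in> points n C \<Longrightarrow> f c \<in> carrier R"
  by (elim PF_carrierE) (simp add: PF_simps ev_closed points_C_carrier)

lemma PF_carrier_ops:
  "f \<in> carrier PF \<Longrightarrow> g \<in> carrier PF \<Longrightarrow> f \<oplus>\<^bsub>PF\<^esub> g \<in> carrier PF"
  "f \<in> carrier PF \<Longrightarrow> g \<in> carrier PF \<Longrightarrow> f \<otimes>\<^bsub>PF\<^esub> g \<in> carrier PF"
  "\<one>\<^bsub>PF\<^esub> \<in> carrier PF" "\<zero>\<^bsub>PF\<^esub> \<in> carrier PF"
proof -
  show "\<one>\<^bsub>PF\<^esub> \<in> carrier PF" "\<zero>\<^bsub>PF\<^esub> \<in> carrier PF"
    using PF_carrierI[of "Const \<one>"] PF_carrierI[of "Const \<zero>"] by (simp_all add: poly_fun_hom)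
  assume "f \<in> carrier PF" "g \<in> carrier PF"
  then obtain p q where "set_pexp p \<subseteq> carrier R" "f = poly_fun p" "set_pexp q \<subseteq> carrier R" "g = poly_fun q"
    by (elim PF_carrierE) simp
  then show "f \<oplus>\<^bsub>PF\<^esub> g \<in> carrier PF" "f \<otimes>\<^bsub>PF\<^esub> g \<in> carrier PF"
    using PF_carrierI[of "Add p q"] PF_carrierI[of "Mul p q"] by (simp_all add: poly_fun_hom)
qed

lemma PF_ext:
  assumes "f \<in> carrier PF" "g \<in> carrier PF" "\<And>c. c \<in> points n C \<Longrightarrow> f c = g c"
  shows "f = g"
proof -
  obtain h h' where "f = poly_fun h" "g = poly_fun h'" using assms(1,2) by (auto elim!: PF_carrierE)
  then show ?thesis using assms(3) by (auto simp: poly_fun_def restrict_def fun_eq_iff)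
qed

lemma cring_PF: "cring PF"
proof (rule cringI)
  show "abelian_group PF"
  proof (rule abelian_groupI)
    fix f assume f: "f \<in> carrier PF"
    then obtain h where h: "set_pexp h \<subseteq> carrier R" "f = poly_fun h" by (rule PF_carrierE)
    define g where "g = poly_fun (Mul (Const (\<ominus> \<one>)) h)"
    have g: "g \<in> carrier PF" unfolding g_def using h(1) by (intro PF_carrierI) auto
    have "g \<oplus>\<^bsub>PF\<^esub> f = \<zero>\<^bsub>PF\<^esub>"
    proof (rule PF_ext)
      fix c assume c: "c \<in> points n C"
      have "ev c h \<in> carrier R" using ev_closed[OF points_C_carrier[OF c] h(1)] .
      then show "(g \<oplus>\<^bsub>PF\<^esub> f) c = \<zero>\<^bsub>PF\<^esub> c" using c h(2) by (simp add: PF_simps g_def l_minus l_neg)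
    qed (use f g in \<open>auto intro: PF_carrier_ops\<close>)
    then show "\<exists>g\<in>carrier PF. g \<oplus>\<^bsub>PF\<^esub> f = \<zero>\<^bsub>PF\<^esub>" using g by blast
  qed (auto intro!: PF_ext PF_carrier_ops simp: PF_simps PF_closed a_ac)
  show "comm_monoid PF"
    by (rule comm_monoidI) (auto intro!: PF_ext PF_carrier_ops simp: PF_simps PF_closed m_ac)
qed (auto intro!: PF_ext PF_carrier_ops simp: PF_simps PF_closed l_distr)

sublocale PF: cring PF by (rule cring_PF)

lemma PF_mult_span: "f \<in> carrier PF \<Longrightarrow> g \<in> M_span \<Longrightarrow> f \<otimes>\<^bsub>PF\<^esub> g \<in> M_span"
proof (elim PF_carrierE)
  fix h assume g: "g \<in> M_span" and h: "set_pexp h \<subseteq> carrier R" "f = poly_fun h"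
  show "f \<otimes>\<^bsub>PF\<^esub> g \<in> M_span"
    by (rule M_span_cong[OF M_span_mult[OF h(1) g]]) (simp add: PF_simps h(2))
qed

lemma ideal_span: "ideal (carrier PF \<inter> M_span) PF"
proof (rule idealI[OF PF.ring_axioms])
  show "subgroup (carrier PF \<inter> M_span) (add_monoid PF)"
  proof (rule PF.add.subgroupI)
    have "\<zero>\<^bsub>PF\<^esub> \<in> M_span" by (rule M_span_cong[OF M_span_zero]) (simp add: PF_simps)
    then show "carrier PF \<inter> M_span \<noteq> {}" by blast
    fix f assume f: "f \<in> carrier PF \<inter> M_span"
    have "(\<ominus>\<^bsub>PF\<^esub> \<one>\<^bsub>PF\<^esub>) \<otimes>\<^bsub>PF\<^esub> f \<in> M_span" using f by (intro PF_mult_span) auto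
    moreover have "(\<ominus>\<^bsub>PF\<^esub> \<one>\<^bsub>PF\<^esub>) \<otimes>\<^bsub>PF\<^esub> f = \<ominus>\<^bsub>PF\<^esub> f"
      using PF.l_minus[OF PF.one_closed IntD1[OF f]] by (simp only: PF.l_one[OF IntD1[OF f]])
    ultimately have "\<ominus>\<^bsub>PF\<^esub> f \<in> M_span" by (simp only:)
    then show "\<ominus>\<^bsub>PF\<^esub> f \<in> carrier PF \<inter> M_span" by (rule IntI[OF PF.a_inv_closed[OF IntD1[OF f]]])
    fix g assume g: "g \<in> carrier PF \<inter> M_span"
    have "f \<oplus>\<^bsub>PF\<^esub> g \<in> M_span"
      by (rule M_span_cong[OF M_span_add[OF IntD2[OF f] IntD2[OF g]]]) (simp add: PF_simps)
    then show "f \<oplus>\<^bsub>PF\<^esub> g \<in> carrier PF \<inter> M_span" using f g by simp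
  qed auto
  show "x \<otimes>\<^bsub>PF\<^esub> f \<in> carrier PF \<inter> M_span" if "f \<in> carrier PF \<inter> M_span" "x \<in> carrier PF" for f x
    using that PF_mult_span by simp
  then show "f \<otimes>\<^bsub>PF\<^esub> x \<in> carrier PF \<inter> M_span" if "f \<in> carrier PF \<inter> M_span" "x \<in> carrier PF" for f x
    using that PF.m_comm[of f x] by simp
qed

lemma field_C: "field (R\<lparr>carrier := C\<rparr>)"
  using subfield_iff(2)[OF subfield_constants] .

text \<open>
  Modulo \<open>Q\<close>, the coordinate functions generate a domain over \<open>C\<close> in which \<open>q\<close> is nonzero. A homomorphism
  from this domain to \<open>C\<close> over \<open>C\<close> that does not annihilate \<open>q\<close> is evaluation at the point given by the
  images of the coordinate functions.
\<close>

lemma nullstellensatz_point: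
  assumes alg: "algebraically_closed (R\<lparr>carrier := C\<rparr>)"
    and Q: "primeideal Q PF"
    and q: "set_pexp q \<subseteq> C" "poly_fun q \<notin> Q"
  shows "\<exists>c\<in>points n C. ev c q \<noteq> \<zero> \<and>
    (\<forall>q'. set_pexp q' \<subseteq> C \<longrightarrow> poly_fun q' \<in> Q \<longrightarrow> ev c q' = \<zero>)"
proof -
  interpret Q: primeideal Q PF by fact
  let ?CR = "R\<lparr>carrier := C\<rparr>"
  interpret CR: field ?CR by (rule field_C)
  let ?D = "PF Quot Q"
  interpret D: domain ?D by (rule Q.quotient_is_domain)
  define \<pi> where "\<pi> = (+>\<^bsub>PF\<^esub>) Q"
  interpret \<pi>: ring_hom_ring PF ?D \<pi> unfolding \<pi>_def by (rule Q.rcos_ring_hom_ring)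
  have \<pi>_zero: "\<pi> f = \<zero>\<^bsub>?D\<^esub> \<longleftrightarrow> f \<in> Q" if "f \<in> carrier PF" for f
    using Q.rcos_const_imp_mem[OF that] PF.a_rcos_zero[OF Q.is_ideal, of f]
    by (auto simp: \<pi>_def FactRing_def)
  have CQ: "set_pexp p \<subseteq> carrier R" if "set_pexp p \<subseteq> C" for p :: "'a pexp"
    using that C_carrier by (rule subset_trans)
  \<comment> \<open>The embedding of \<open>C\<close> into the quotient, whose inverse is the homomorphism to be extended.\<close>
  define \<kappa> where "\<kappa> c = \<pi> (poly_fun (Const c))" for c
  have Const_PF: "poly_fun (Const c) \<in> carrier PF" if "c \<in> C" for c
    using that C_carrier by (intro PF_carrierI) auto
  have \<kappa>_hom: "\<kappa> \<in> ring_hom ?CR ?D"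
  proof (rule ring_hom_memI)
    show "\<kappa> c \<in> carrier ?D" if "c \<in> carrier ?CR" for c
      using that Const_PF[of c] unfolding \<kappa>_def by simp
    show "\<kappa> \<one>\<^bsub>?CR\<^esub> = \<one>\<^bsub>?D\<^esub>" by (simp add: \<kappa>_def poly_fun_hom)
    fix c d assume cd: "c \<in> carrier ?CR" "d \<in> carrier ?CR"
    have "poly_fun (Const (c \<otimes> d)) = poly_fun (Const c) \<otimes>\<^bsub>PF\<^esub> poly_fun (Const d)"
      "poly_fun (Const (c \<oplus> d)) = poly_fun (Const c) \<oplus>\<^bsub>PF\<^esub> poly_fun (Const d)"
      by (auto simp: poly_fun_def PF_def restrict_def)
    then show "\<kappa> (c \<otimes>\<^bsub>?CR\<^esub> d) = \<kappa> c \<otimes>\<^bsub>?D\<^esub> \<kappa> d" "\<kappa> (c \<oplus>\<^bsub>?CR\<^esub> d) = \<kappa> c \<oplus>\<^bsub>?D\<^esub> \<kappa> d"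
      using cd Const_PF by (simp_all add: \<kappa>_def)
  qed
  interpret \<kappa>: ring_hom_ring ?CR ?D \<kappa>
    by (rule ring_hom_ringI2[OF CR.ring_axioms D.ring_axioms \<kappa>_hom])
  have sub_C: "subfield C ?CR" using CR.carrier_is_subfield by simp
  have inj: "inj_on \<kappa> C" and K: "subfield (\<kappa> ` C) ?D"
    using \<kappa>.img_is_subfield[OF sub_C] by auto
  define \<phi> where "\<phi> = inv_into C \<kappa>"
  have \<phi>: "\<phi> \<in> ring_hom (?D\<lparr>carrier := \<kappa> ` C\<rparr>) ?CR"
    unfolding \<phi>_def using \<kappa>.inv_ring_hom[OF inj subfieldE(1)[OF sub_C]] by (rule ring_hom_ring.homh)
  have \<phi>\<kappa>: "\<phi> (\<kappa> c) = c" if "c \<in> C" for c unfolding \<phi>_def using inj that by (rule inv_into_f_f)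
  have Var_PF: "poly_fun (Var k) \<in> carrier PF" for k by (intro PF_carrierI) simp
  define xs where "xs = map (\<lambda>k. \<pi> (poly_fun (Var k))) [0..<n]"
  have xs: "set xs \<subseteq> carrier ?D" using Var_PF by (auto simp: xs_def)
  let ?B = "adjoin_list ?D (\<kappa> ` C) xs"
  have B: "subring ?B ?D" "\<kappa> ` C \<subseteq> ?B" "set xs \<subseteq> ?B"
    using D.subring_adjoin_list[OF subfieldE(1)[OF K] xs] by auto
  have Var_zero: "poly_fun (Var k) = \<zero>\<^bsub>PF\<^esub>" if "\<not> k < n" for k
  proof (rule PF_ext)
    show "poly_fun (Var k) c = \<zero>\<^bsub>PF\<^esub> c" if "c \<in> points n C" for c
      using \<open>\<not> k < n\<close> that by (simp add: PF_simps) (simp add: points_def)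
  qed (simp_all add: Var_PF)
  have memB: "\<pi> (poly_fun p) \<in> ?B" if "set_pexp p \<subseteq> C" for p
    using that
  proof (induction p)
    case (Const c)
    then show ?case using B(2) by (auto simp: \<kappa>_def)
  next
    case (Var k)
    show ?case
    proof (cases "k < n")
      case True
      then show ?thesis using B(3) by (auto simp: xs_def)
    next
      case False
      then show ?thesis using subringE(2)[OF B(1)] by (simp add: Var_zero)
    qed
  next
    case (Add p q)
    then show ?case using subringE(7)[OF B(1)] PF_carrierI[OF CQ[of p]] PF_carrierI[OF CQ[of q]]
      by (simp add: poly_fun_hom)
  next
    case (Mul p q)
    then show ?case using subringE(6)[OF B(1)] PF_carrierI[OF CQ[of p]] PF_carrierI[OF CQ[of q]]
      by (simp add: poly_fun_hom)
  qed
  have nz: "\<pi> (poly_fun q) \<noteq> \<zero>\<^bsub>?D\<^esub>" using \<pi>_zero[OF PF_carrierI[OF CQ[OF q(1)]]] q(2) by simp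
  have inf: "infinite (carrier ?CR)" using infinite_constants by simp
  obtain \<psi> where \<psi>: "\<psi> \<in> ring_hom (?D\<lparr>carrier := ?B\<rparr>) ?CR" "\<forall>c\<in>\<kappa> ` C. \<psi> c = \<phi> c"
    "\<psi> (\<pi> (poly_fun q)) \<noteq> \<zero>\<^bsub>?CR\<^esub>"
    using D.specialisation_over_field[OF K xs memB[OF q(1)] nz alg inf \<phi>] by (elim bexE conjE)
  define c where "c k = (if k < n then \<psi> (\<pi> (poly_fun (Var k))) else \<zero>)" for k
  have "\<psi> y \<in> C" if "y \<in> ?B" for y using ring_hom_closed[OF \<psi>(1)] that by simp
  then have c: "c \<in> points n C" using memB[of "Var _"] by (auto simp: points_def c_def)
  have \<psi>_zero: "\<psi> \<zero>\<^bsub>?D\<^esub> = \<zero>"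
    using ring_hom_zero[OF \<psi>(1) D.subring_is_ring[OF B(1)] CR.ring_axioms] by simp
  have ev: "\<psi> (\<pi> (poly_fun p)) = ev c p" if "set_pexp p \<subseteq> C" for p
    using that
  proof (induction p)
    case (Const d)
    then show ?case using \<psi>(2) \<phi>\<kappa>[of d] by (simp add: \<kappa>_def)
  next
    case (Var k)
    then show ?case using \<psi>_zero by (auto simp: c_def Var_zero)
  next
    case (Add p q)
    then show ?case using PF_carrierI[OF CQ[of p]] PF_carrierI[OF CQ[of q]]
        ring_hom_add[OF \<psi>(1), of "\<pi> (poly_fun p)" "\<pi> (poly_fun q)"] memB
      by (simp add: poly_fun_hom)
  next
    case (Mul p q)
    then show ?case using PF_carrierI[OF CQ[of p]] PF_carrierI[OF CQ[of q]]
        ring_hom_mult[OF \<psi>(1), of "\<pi> (poly_fun p)" "\<pi> (poly_fun q)"] memB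
      by (simp add: poly_fun_hom)
  qed
  have "ev c q' = \<zero>" if "set_pexp q' \<subseteq> C" "poly_fun q' \<in> Q" for q'
    using ev[OF that(1)] \<pi>_zero[OF PF_carrierI[OF CQ[OF that(1)]]] that(2) \<psi>_zero by simp
  moreover have "ev c q \<noteq> \<zero>" using ev[OF q(1)] \<psi>(3) by simp
  ultimately show ?thesis using c by blast
qed

lemma comb_as_finsum:
  assumes "\<And>t. t \<in> set L \<Longrightarrow> fst t \<in> carrier R \<and> set_pexp (snd t) \<subseteq> carrier R"
    and x: "\<And>i. x i \<in> carrier R"
  shows "comb L x = (\<Oplus>j\<in>{..<length L}. fst (L ! j) \<otimes> ev x (snd (L ! j)))"
  using assms(1)
proof (induction L rule: rev_induct)
  case (snoc t L)
  have c: "fst (L ! j) \<otimes> ev x (snd (L ! j)) \<in> carrier R" if "j < length L" for j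
    using snoc.prems[of "L ! j"] that by (simp add: ev_closed x)
  have t: "fst t \<otimes> ev x (snd t) \<in> carrier R" using snoc.prems[of t] by (simp add: ev_closed x)
  have "(\<Oplus>j\<in>{..<length (L @ [t])}. fst ((L @ [t]) ! j) \<otimes> ev x (snd ((L @ [t]) ! j)))
    = fst t \<otimes> ev x (snd t) \<oplus> (\<Oplus>j\<in>{..<length L}. fst ((L @ [t]) ! j) \<otimes> ev x (snd ((L @ [t]) ! j)))"
    using c t by (simp add: lessThan_Suc Pi_def nth_append)
  also have "(\<Oplus>j\<in>{..<length L}. fst ((L @ [t]) ! j) \<otimes> ev x (snd ((L @ [t]) ! j)))
    = (\<Oplus>j\<in>{..<length L}. fst (L ! j) \<otimes> ev x (snd (L ! j)))"
    using c by (intro finsum_cong') (auto simp: nth_append)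
  also have "\<dots> = comb L x" using snoc by simp
  also have "fst t \<otimes> ev x (snd t) \<oplus> comb L x = comb (L @ [t]) x"
    using comb_append[of L "[t]" x] snoc.prems x t comb_closed[of L x] by (simp add: a_comm)
  finally show ?case ..
qed simp

lemma comb_product:
  assumes L: "\<And>t. t \<in> set L \<Longrightarrow> fst t \<in> carrier R \<and> set_pexp (snd t) \<subseteq> K"
    and L': "\<And>t. t \<in> set L' \<Longrightarrow> fst t \<in> carrier R \<and> set_pexp (snd t) \<subseteq> K"
    and K: "K \<subseteq> carrier R"
  shows "\<exists>L''. (\<forall>t\<in>set L''. fst t \<in> carrier R \<and> set_pexp (snd t) \<subseteq> K) \<and>
    (\<forall>x. (\<forall>i. x i \<in> carrier R) \<longrightarrow> comb L'' x = comb L x \<otimes> comb L' x)"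
  using L
proof (induction L)
  case Nil
  have "comb L' x \<in> carrier R" if "\<forall>i. x i \<in> carrier R" for x
  proof (rule comb_closed)
    show "fst t \<in> carrier R \<and> set_pexp (snd t) \<subseteq> carrier R" if "t \<in> set L'" for t
      using L'[OF that] K by auto
  qed (use that in simp)
  then show ?case by (intro exI[of _ "[]"]) simp
next
  case (Cons t L)
  then obtain L'' where L'': "\<forall>t\<in>set L''. fst t \<in> carrier R \<and> set_pexp (snd t) \<subseteq> K"
    "\<forall>x. (\<forall>i. x i \<in> carrier R) \<longrightarrow> comb L'' x = comb L x \<otimes> comb L' x" by auto
  define N where "N LL = map (\<lambda>s. (fst t \<otimes> fst s, Mul (snd t) (snd s))) LL" for LL
  have t: "fst t \<in> carrier R" "set_pexp (snd t) \<subseteq> K" using Cons.prems[of t] by auto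
  have N_set: "fst s \<in> carrier R \<and> set_pexp (snd s) \<subseteq> K" if s: "s \<in> set (N L')" for s
  proof -
    obtain s' where "s = (fst t \<otimes> fst s', Mul (snd t) (snd s'))" "s' \<in> set L'"
      using s unfolding N_def set_map by (elim imageE)
    then show ?thesis using L'[of s'] t by simp
  qed
  show ?case
  proof (intro exI[of _ "N L' @ L''"] conjI ballI allI impI)
    show "fst s \<in> carrier R" "set_pexp (snd s) \<subseteq> K" if "s \<in> set (N L' @ L'')" for s
      using that N_set[of s] L''(1) by auto
    fix x :: "nat \<Rightarrow> 'a" assume "\<forall>i. x i \<in> carrier R"
    then have x: "x i \<in> carrier R" for i by simp
    have evt: "ev x (snd t) \<in> carrier R" by (rule ev_closed[OF x subset_trans[OF t(2) K]])
    have c': "comb LL x \<in> carrier R" if "\<And>s. s \<in> set LL \<Longrightarrow> fst s \<in> carrier R \<and> set_pexp (snd s) \<subseteq> K" for LL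
    proof (rule comb_closed[OF _ x])
      show "fst s \<in> carrier R \<and> set_pexp (snd s) \<subseteq> carrier R" if "s \<in> set LL" for s
        using \<open>\<And>s. s \<in> set LL \<Longrightarrow> _\<close>[OF that] K by auto
    qed
    have N: "comb (N LL) x = (fst t \<otimes> ev x (snd t)) \<otimes> comb LL x"
      if "\<And>s. s \<in> set LL \<Longrightarrow> fst s \<in> carrier R \<and> set_pexp (snd s) \<subseteq> K" for LL
      using that
    proof (induction LL)
      case Nil
      then show ?case using t evt by (simp add: N_def)
    next
      case (Cons s LL)
      have "fst s \<in> carrier R" "set_pexp (snd s) \<subseteq> K" using Cons.prems[of s] by auto
      moreover from this(2) have "ev x (snd s) \<in> carrier R" by (rule ev_closed[OF x subset_trans[OF _ K]])
      moreover have "comb LL x \<in> carrier R" using Cons.prems by (intro c') auto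
      ultimately show ?case using Cons t evt by (simp add: N_def) algebra
    qed
    have "comb (N L' @ L'') x = comb (N L') x \<oplus> comb L'' x"
    proof (rule comb_append[OF _ x])
      show "fst s \<in> carrier R \<and> set_pexp (snd s) \<subseteq> carrier R" if "s \<in> set (N L' @ L'')" for s
        using that N_set[of s] L''(1) K by auto
    qed
    also have "\<dots> = (fst t \<otimes> ev x (snd t)) \<otimes> comb L' x \<oplus> comb L x \<otimes> comb L' x"
      using N[of L'] L' L''(2) x by simp
    also have "\<dots> = comb (t # L) x \<otimes> comb L' x"
      using evt t c'[of L'] c'[of L] L' Cons.prems by (simp add: l_distr)
    finally show "comb (N L' @ L'') x = comb (t # L) x \<otimes> comb L' x" .
  qed
qed

text \<open>
  Every polynomial over \<open>R\<close> is a combination, with coefficients in \<open>R\<close>, of polynomials over \<open>C\<close>.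
\<close>

lemma constant_polynomial_decomposition:
  assumes "set_pexp h \<subseteq> carrier R"
  shows "\<exists>L. (\<forall>t\<in>set L. fst t \<in> carrier R \<and> set_pexp (snd t) \<subseteq> C) \<and>
    (\<forall>x. (\<forall>i. x i \<in> carrier R) \<longrightarrow> comb L x = ev x h)"
  using assms
proof (induction h)
  case (Const u)
  then show ?case by (intro exI[of _ "[(u, Const \<one>)]"]) (auto simp: constants_def)
next
  case (Var k)
  show ?case by (intro exI[of _ "[(\<one>, Var k)]"]) auto
next
  case (Add p q)
  then obtain L L' where L: "\<forall>t\<in>set L. fst t \<in> carrier R \<and> set_pexp (snd t) \<subseteq> C"
    "\<forall>x. (\<forall>i. x i \<in> carrier R) \<longrightarrow> comb L x = ev x p"
    and L': "\<forall>t\<in>set L'. fst t \<in> carrier R \<and> set_pexp (snd t) \<subseteq> C"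
    "\<forall>x. (\<forall>i. x i \<in> carrier R) \<longrightarrow> comb L' x = ev x q" by auto
  have "comb (L @ L') x = ev x (Add p q)" if x: "\<forall>i. x i \<in> carrier R" for x
  proof -
    have "fst t \<in> carrier R \<and> set_pexp (snd t) \<subseteq> carrier R" if "t \<in> set (L @ L')" for t
    proof -
      have "fst t \<in> carrier R \<and> set_pexp (snd t) \<subseteq> C" using that L(1) L'(1) by auto
      then show ?thesis using subset_trans[OF _ C_carrier, of "set_pexp (snd t)"] by simp
    qed
    from comb_append[OF this] show ?thesis using L(2) L'(2) x by simp
  qed
  then show ?case using L(1) L'(1) by (intro exI[of _ "L @ L'"]) (simp add: ball_Un)
next
  case (Mul p q)
  then obtain L L' where L: "\<forall>t\<in>set L. fst t \<in> carrier R \<and> set_pexp (snd t) \<subseteq> C"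
    "\<forall>x. (\<forall>i. x i \<in> carrier R) \<longrightarrow> comb L x = ev x p"
    and L': "\<forall>t\<in>set L'. fst t \<in> carrier R \<and> set_pexp (snd t) \<subseteq> C"
    "\<forall>x. (\<forall>i. x i \<in> carrier R) \<longrightarrow> comb L' x = ev x q" by auto
  have "\<exists>L''. (\<forall>t\<in>set L''. fst t \<in> carrier R \<and> set_pexp (snd t) \<subseteq> C) \<and>
    (\<forall>x. (\<forall>i. x i \<in> carrier R) \<longrightarrow> comb L'' x = comb L x \<otimes> comb L' x)"
    by (rule comb_product[OF _ _ C_carrier]) (use L(1) L'(1) in simp_all)
  then obtain L'' where "\<forall>t\<in>set L''. fst t \<in> carrier R \<and> set_pexp (snd t) \<subseteq> C"
    "\<forall>x. (\<forall>i. x i \<in> carrier R) \<longrightarrow> comb L'' x = comb L x \<otimes> comb L' x" by (elim exE conjE)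
  then show ?case using L(2) L'(2) by (intro exI[of _ L'']) simp
qed

text \<open>
  Write the polynomial as a combination of polynomials \<open>q j\<close> over \<open>C\<close>. The coefficient vectors whose
  combination of the \<open>q j\<close> lies in \<open>M_span\<close> form a subspace. It is derivation-stable because the \<open>q j\<close>
  have constant values on \<open>C\<^sup>n\<close>. Its constant vectors give polynomials over \<open>C\<close> that belong to \<open>Q\<close> and
  hence vanish at \<open>c0\<close>; so do all combinations, as the constant vectors span the subspace.
\<close>

lemma span_vanishes:
  assumes Q: "carrier PF \<inter> M_span \<subseteq> Q"
    and c0: "c0 \<in> points n C"
    and zero: "\<And>q. set_pexp q \<subseteq> C \<Longrightarrow> poly_fun q \<in> Q \<Longrightarrow> ev c0 q = \<zero>"
    and h: "set_pexp h \<subseteq> carrier R" and mem: "(\<lambda>c. ev c h) \<in> M_span"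
  shows "ev c0 h = \<zero>"
proof -
  obtain L where L: "\<forall>t\<in>set L. fst t \<in> carrier R \<and> set_pexp (snd t) \<subseteq> C"
    "\<forall>x. (\<forall>i. x i \<in> carrier R) \<longrightarrow> comb L x = ev x h"
    using constant_polynomial_decomposition[OF h] by (elim exE conjE)
  define m where "m = length L"
  define q where "q j = (if j < m then snd (L ! j) else Const \<zero>)" for j
  have q: "set_pexp (q j) \<subseteq> C" for j
    using L(1) nth_mem[of j L] by (auto simp: q_def m_def constants_def)
  have qR: "set_pexp (q j) \<subseteq> carrier R" for j using q C_carrier by (rule subset_trans)
  have ev_q: "ev c (q j) \<in> C" if "c \<in> points n C" for c j
    using ev_in_subring[OF subfieldE(1)[OF subfield_constants]
        points_in_subring[OF subfieldE(1)[OF subfield_constants] that] q] .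
  have ev_qR: "ev c (q j) \<in> carrier R" if "c \<in> points n C" for c j
    using ev_q[OF that] C_carrier by blast
  define lc where "lc u c = (\<Oplus>j\<in>{..<m}. u j \<otimes> ev c (q j))" for u c
  define P where "P u \<longleftrightarrow> (\<forall>j. u j \<in> carrier R) \<and> lc u \<in> M_span" for u
  have P: "derivation_stable_subspace P"
    unfolding derivation_stable_subspace_def
  proof (intro conjI allI impI)
    show "u j \<in> carrier R" if "P u" for u j using that by (simp add: P_def)
    fix u assume u: "P u"
    have uc: "u j \<in> carrier R" for j using u by (simp add: P_def)
    show "P (\<lambda>j. \<partial> (u j))"
      unfolding P_def
    proof
      show "\<forall>j. \<partial> (u j) \<in> carrier R" using uc by (simp add: deriv_closed)
      have "(\<lambda>c. \<partial> (lc u c)) \<in> M_span" using u by (intro M_span_deriv) (simp add: P_def)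
      then show "lc (\<lambda>j. \<partial> (u j)) \<in> M_span"
      proof (rule M_span_cong)
        fix c assume c: "c \<in> points n C"
        have "\<partial> (lc u c) = (\<Oplus>j\<in>{..<m}. \<partial> (u j \<otimes> ev c (q j)))"
          unfolding lc_def using uc ev_qR[OF c] by (intro deriv_finsum) auto
        also have "\<dots> = lc (\<lambda>j. \<partial> (u j)) c"
          unfolding lc_def
        proof (rule finsum_cong')
          fix j
          have "\<partial> (ev c (q j)) = \<zero>" using ev_q[OF c] by (simp add: constants_def)
          then show "\<partial> (u j \<otimes> ev c (q j)) = \<partial> (u j) \<otimes> ev c (q j)"
            using uc ev_qR[OF c] by (simp add: deriv_mult deriv_closed)
        qed (use uc ev_qR[OF c] in \<open>auto intro: deriv_closed\<close>)
        finally show "lc (\<lambda>j. \<partial> (u j)) c = \<partial> (lc u c)" ..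
      qed
    qed
    fix v s t assume v: "P v" and st: "s \<in> carrier R" "t \<in> carrier R"
    have vc: "v j \<in> carrier R" for j using v by (simp add: P_def)
    show "P (\<lambda>j. s \<otimes> u j \<oplus> t \<otimes> v j)"
      unfolding P_def
    proof
      show "\<forall>j. s \<otimes> u j \<oplus> t \<otimes> v j \<in> carrier R" using uc vc st by simp
      have "(\<lambda>c. s \<otimes> lc u c \<oplus> t \<otimes> lc v c) \<in> M_span"
        using u v st by (intro M_span_add M_span_scale) (simp_all add: P_def)
      then show "lc (\<lambda>j. s \<otimes> u j \<oplus> t \<otimes> v j) \<in> M_span"
      proof (rule M_span_cong)
        fix c assume c: "c \<in> points n C"
        show "lc (\<lambda>j. s \<otimes> u j \<oplus> t \<otimes> v j) c = s \<otimes> lc u c \<oplus> t \<otimes> lc v c"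
          unfolding lc_def using uc vc st ev_qR[OF c] by (intro finsum_lincomb)
      qed
    qed
  qed
  have lc_L: "lc (\<lambda>j. if j < m then fst (L ! j) else \<zero>) c = ev c h" if c: "c \<in> points n C" for c
  proof -
    have LR: "fst t \<in> carrier R \<and> set_pexp (snd t) \<subseteq> carrier R" if "t \<in> set L" for t
      using L(1) that C_carrier by auto
    have fR: "fst (L ! j) \<in> carrier R" if "j < m" for j using LR nth_mem that by (simp add: m_def)
    have "ev c h = comb L c" using L(2) points_C_carrier[OF c] by simp
    also have "\<dots> = (\<Oplus>j\<in>{..<m}. fst (L ! j) \<otimes> ev c (snd (L ! j)))"
      unfolding m_def by (rule comb_as_finsum[OF LR points_C_carrier[OF c]])
    also have "\<dots> = lc (\<lambda>j. if j < m then fst (L ! j) else \<zero>) c"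
      unfolding lc_def
    proof (rule finsum_cong')
      show "(\<lambda>j. (if j < m then fst (L ! j) else \<zero>) \<otimes> ev c (q j)) \<in> {..<m} \<rightarrow> carrier R"
        using fR ev_qR[OF c] by auto
    qed (simp_all add: q_def)
    finally show ?thesis ..
  qed
  have "lc (\<lambda>j. if j < m then fst (L ! j) else \<zero>) c0 = \<zero>"
    unfolding lc_def
  proof (rule derivation_stable_subspace_annihilated[of "{..<m}" P])
    show "ev c0 (q j) \<in> carrier R" for j using ev_qR[OF c0] .
    have "fst (L ! j) \<in> carrier R" if "j < m" for j
      using L(1) nth_mem[of j L] that by (simp add: m_def)
    moreover have "lc (\<lambda>j. if j < m then fst (L ! j) else \<zero>) \<in> M_span"
      by (rule M_span_cong[OF mem]) (rule lc_L)
    ultimately show "P (\<lambda>j. if j < m then fst (L ! j) else \<zero>)" by (simp add: P_def)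
  next
    fix e assume e: "P e" "\<forall>j\<in>{..<m}. \<partial> (e j) = \<zero>"
    \<comment> \<open>Constant coefficients can be multiplied into the polynomials: \<open>r\<close> is over \<open>C\<close> and has the values \<open>lc e\<close>.\<close>
    define r where "r = comb_pexp (map (\<lambda>j. (\<one>, Mul (Const (e j)) (q j))) [0..<m])"
    have eC: "e j \<in> C" if "j < m" for j using e that by (simp add: P_def constants_def)
    have eR: "e j \<in> carrier R" for j using e by (simp add: P_def)
    have one: "\<one> \<in> C" by (simp add: constants_def)
    have r: "set_pexp r \<subseteq> C"
      unfolding r_def
      by (rule set_comb_pexp[OF _ subfieldE(1)[OF subfield_constants]]) (use eC one in \<open>auto dest: subsetD[OF q]\<close>)
    have ev_r: "ev c r = lc e c" if c: "c \<in> points n C" for c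
    proof -
      have "ev c r = (\<Oplus>j\<in>{..<length (map (\<lambda>j. (\<one>, Mul (Const (e j)) (q j))) [0..<m])}.
          fst (map (\<lambda>j. (\<one>, Mul (Const (e j)) (q j))) [0..<m] ! j) \<otimes>
          ev c (snd (map (\<lambda>j. (\<one>, Mul (Const (e j)) (q j))) [0..<m] ! j)))"
        unfolding r_def ev_comb_pexp
        by (rule comb_as_finsum[OF _ points_C_carrier[OF c]]) (use eR in \<open>auto dest: subsetD[OF qR]\<close>)
      also have "\<dots> = lc e c"
        unfolding lc_def using eR ev_qR[OF c] by (intro finsum_cong') auto
      finally show ?thesis .
    qed
    have "poly_fun r \<in> M_span"
      by (rule M_span_cong[of "lc e"]) (use e ev_r in \<open>auto simp: P_def PF_simps\<close>)
    moreover have "poly_fun r \<in> carrier PF" using r C_carrier by (intro PF_carrierI) (rule subset_trans)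
    ultimately have "ev c0 r = \<zero>" using zero[OF r] Q by blast
    then show "(\<Oplus>j\<in>{..<m}. e j \<otimes> ev c0 (q j)) = \<zero>" using ev_r[OF c0] by (simp add: lc_def)
  qed (use P in simp_all)
  then show ?thesis using lc_L[OF c0] by simp
qed

text \<open>
  Some polynomial \<open>p\<close> over \<open>C\<close> in the combination \<open>L\<close> that represents \<open>w\<close> lies outside \<open>Q\<close>, and there is a
  point \<open>c0\<close> for which it is nonzero. If \<open>w\<close> vanishes at \<open>c0\<close>, then reducing the other polynomials of \<open>L\<close>
  modulo \<open>p\<close> such that they vanish at \<open>c0\<close> absorbs the term of \<open>p\<close>, so that \<open>w\<close> has a shorter
  representation.
\<close>

lemma nonzero_point:
  assumes alg: "algebraically_closed (R\<lparr>carrier := C\<rparr>)"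
    and Q: "primeideal Q PF"
    and L: "\<And>t. t \<in> set L \<Longrightarrow> fst t \<in> carrier R \<and> set_pexp (snd t) \<subseteq> C"
    and w: "set_pexp w \<subseteq> carrier R" "\<And>c. c \<in> points n C \<Longrightarrow> ev c w = comb L c" "poly_fun w \<notin> Q"
  shows "\<exists>c\<in>points n C. ev c w \<noteq> \<zero> \<and>
    (\<forall>q. set_pexp q \<subseteq> C \<longrightarrow> poly_fun q \<in> Q \<longrightarrow> ev c q = \<zero>)"
  using L w(2)
proof (induction "length L" arbitrary: L rule: less_induct)
  case less
  interpret Q: primeideal Q PF by fact
  have LR: "fst t \<in> carrier R \<and> set_pexp (snd t) \<subseteq> carrier R" if "t \<in> set L" for t
    using less.prems(1)[OF that] C_carrier by auto
  have "\<exists>t\<in>set L. poly_fun (snd t) \<notin> Q"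
  proof (rule ccontr)
    assume neg: "\<not> (\<exists>t\<in>set L. poly_fun (snd t) \<notin> Q)"
    have "poly_fun (comb_pexp LL) \<in> Q" if "set LL \<subseteq> set L" for LL
      using that
    proof (induction LL)
      case Nil
      then show ?case using Q.zero_closed by (simp add: poly_fun_hom)
    next
      case (Cons t LL)
      have t: "fst t \<in> carrier R" "poly_fun (snd t) \<in> Q" using Cons.prems neg LR by auto
      have "poly_fun (Const (fst t)) \<otimes>\<^bsub>PF\<^esub> poly_fun (snd t) \<in> Q"
        by (rule Q.I_l_closed[OF t(2)]) (rule PF_carrierI, use t in simp)
      then show ?case using Q.a_closed Cons by (simp add: poly_fun_hom)
    qed
    then have "poly_fun (comb_pexp L) \<in> Q" by simp
    moreover have "poly_fun w = poly_fun (comb_pexp L)"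
      using less.prems(2) by (auto simp: poly_fun_def ev_comb_pexp restrict_def)
    ultimately show False using w(3) by simp
  qed
  then obtain t L1 L2 where t: "poly_fun (snd t) \<notin> Q" and L_eq: "L = L1 @ t # L2"
    by (metis split_list)
  obtain u p where up: "t = (u, p)" by (cases t)
  have uR: "u \<in> carrier R" and pC: "set_pexp p \<subseteq> C" using less.prems(1)[of t] L_eq up by auto
  have pR: "set_pexp p \<subseteq> carrier R" using pC C_carrier by (rule subset_trans)
  obtain c0 where c0: "c0 \<in> points n C" "ev c0 p \<noteq> \<zero>"
    "\<forall>q. set_pexp q \<subseteq> C \<longrightarrow> poly_fun q \<in> Q \<longrightarrow> ev c0 q = \<zero>"
    using nullstellensatz_point[OF alg Q pC] t up by auto
  show ?case
  proof (cases "ev c0 w = \<zero>")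
    case False
    then show ?thesis using c0 by blast
  next
    case True
    let ?v = "inv (ev c0 p)"
    have sub: "subring C R" using subfieldE(1)[OF subfield_constants] .
    have evC: "ev c0 r \<in> C" if "set_pexp r \<subseteq> C" for r
      using ev_in_subring[OF sub points_in_subring[OF sub c0(1)] that] .
    have v: "?v \<in> C" "?v \<otimes> ev c0 p = \<one>" "ev c0 p \<otimes> ?v = \<one>"
      using subfield_m_inv[OF subfield_constants, of "ev c0 p"] c0(2) evC[OF pC] by auto
    have vR: "?v \<in> carrier R" using v(1) C_carrier by blast
    define L' where "L' = map (\<lambda>t. (fst t, reduce c0 ?v p (snd t))) (L1 @ L2)"
    have L12: "fst s \<in> carrier R \<and> set_pexp (snd s) \<subseteq> C" if "s \<in> set (L1 @ L2)" for s
      using less.prems(1)[of s] that L_eq by auto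
    have L12R: "fst s \<in> carrier R \<and> set_pexp (snd s) \<subseteq> carrier R" if "s \<in> set (L1 @ L2)" for s
      using L12[OF that] C_carrier by auto
    have red: "set_pexp (reduce c0 ?v p r) \<subseteq> C" if "set_pexp r \<subseteq> C" for r
      using that pC v(1) evC[OF that] subringE(5,6)[OF sub] by (simp add: reduce_def)
    have split: "comb L c = u \<otimes> ev c p \<oplus> comb (L1 @ L2) c" if c: "c \<in> points n C" for c
    proof -
      note cR = points_C_carrier[OF c]
      have L1: "comb L1 c \<in> carrier R" "comb L2 c \<in> carrier R"
        using L12R by (auto intro!: comb_closed cR)
      have "comb L c = comb L1 c \<oplus> comb (t # L2) c"
        unfolding L_eq using LR L_eq by (intro comb_append cR) auto
      also have "\<dots> = u \<otimes> ev c p \<oplus> (comb L1 c \<oplus> comb L2 c)"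
        using L1 uR ev_closed[OF cR pR] up by (simp add: a_lcomm)
      also have "comb L1 c \<oplus> comb L2 c = comb (L1 @ L2) c"
        using L12R by (intro comb_append[symmetric] cR) auto
      finally show ?thesis .
    qed
    have "ev c w = comb L' c" if c: "c \<in> points n C" for c
    proof -
      note cR = points_C_carrier[OF c] and c0R = points_C_carrier[OF c0(1)]
      have carr: "ev c p \<in> carrier R" "ev c0 p \<in> carrier R" "comb (L1 @ L2) c \<in> carrier R"
        "comb (L1 @ L2) c0 \<in> carrier R"
        by (rule ev_closed[OF cR pR], rule ev_closed[OF c0R pR], rule comb_closed[OF L12R cR],
            assumption, rule comb_closed[OF L12R c0R], assumption)
      have "u \<otimes> ev c0 p \<oplus> comb (L1 @ L2) c0 = \<zero>"
        using split[OF c0(1)] less.prems(2)[OF c0(1)] True by simp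
      then have "comb (L1 @ L2) c0 = \<ominus> (u \<otimes> ev c0 p)"
        using carr uR by (metis a_comm m_closed minus_equality)
      then have "\<ominus> (comb (L1 @ L2) c0 \<otimes> ?v) = u \<otimes> (ev c0 p \<otimes> ?v)"
        using carr uR vR by (simp add: l_minus m_assoc)
      then have "\<ominus> (comb (L1 @ L2) c0 \<otimes> ?v) = u" using v(3) uR by simp
      moreover have "comb L' c = comb (L1 @ L2) c \<oplus> (\<ominus> (comb (L1 @ L2) c0 \<otimes> ?v)) \<otimes> ev c p"
        unfolding L'_def by (rule comb_reduce[OF L12R pR vR cR c0R])
      ultimately show ?thesis using split[OF c] less.prems(2)[OF c] carr uR by (simp add: a_comm)
    qed
    moreover have "fst s \<in> carrier R \<and> set_pexp (snd s) \<subseteq> C" if s: "s \<in> set L'" for s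
    proof -
      obtain s' where "s = (fst s', reduce c0 ?v p (snd s'))" "s' \<in> set (L1 @ L2)"
        using s unfolding L'_def set_map by (elim imageE)
      then show ?thesis using L12[of s'] red[of "snd s'"] by simp
    qed
    moreover have "length L' < length L" by (simp add: L'_def L_eq)
    ultimately show ?thesis using less.hyps by blast
  qed
qed

text \<open>
  No power of \<open>W\<close>, as a polynomial function \<open>w\<close> of the parameters, lies in the ideal \<open>M_span\<close>. So a prime
  ideal \<open>Q\<close> contains \<open>M_span\<close> but not \<open>w\<close>, and the point found for \<open>Q\<close> is the parameter of the solution.
\<close>

theorem zero_of_diff_ideal:
  assumes alg: "algebraically_closed (R\<lparr>carrier := C\<rparr>)"
    and W: "set_pexp W \<subseteq> D" and avoid: "\<And>k. pexp_power W k \<notin> M"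
  shows "\<exists>y \<in> lin_diff_solutions R (carrier R) n a.
    (\<forall>p\<in>M. ev (jet n y) p = \<zero>) \<and> ev (jet n y) W \<noteq> \<zero>"
proof -
  have ev_s: "ev c (psubst jet_form p) = ev (sol_jet c) p" if "c \<in> points n C" for c p
    by (rule ev_psubst_jet_form[OF points_C_carrier[OF that]])
  have set_subst: "set_pexp (psubst jet_form p) \<subseteq> carrier R" if "set_pexp p \<subseteq> carrier R" for p
    using that set_jet_form by (rule set_psubst)
  have WR: "set_pexp W \<subseteq> carrier R" using W D_carrier by (rule subset_trans)
  define w where "w = psubst jet_form W"
  have w: "set_pexp w \<subseteq> carrier R" unfolding w_def using WR by (rule set_subst)
  have w_pow: "poly_fun w [^]\<^bsub>PF\<^esub> k = poly_fun (psubst jet_form (pexp_power W k))" for k :: nat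
  proof (induction k)
    case (Suc k)
    have "set_pexp (psubst jet_form (pexp_power W k)) \<subseteq> carrier R"
      using set_pexp_power[OF carrier_is_subring WR] by (rule set_subst)
    then show ?case using Suc w PF.m_comm[of "poly_fun w" "poly_fun (psubst jet_form (pexp_power W k))"]
      by (simp add: poly_fun_hom w_def PF_carrierI)
  qed (simp add: poly_fun_hom)
  have "poly_fun w [^]\<^bsub>PF\<^esub> k \<notin> carrier PF \<inter> M_span" for k :: nat
  proof
    assume "poly_fun w [^]\<^bsub>PF\<^esub> k \<in> carrier PF \<inter> M_span"
    then have "pexp_power W k \<in> M"
      by (intro M_span_over_D[of "poly_fun w [^]\<^bsub>PF\<^esub> k"])
        (auto simp: w_pow PF_simps ev_s intro!: subsetD[OF set_pexp_power[OF subring_D W]])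
    then show False using avoid by blast
  qed
  then obtain Q where Q: "primeideal Q PF" "carrier PF \<inter> M_span \<subseteq> Q" "poly_fun w \<notin> Q"
    using PF.prime_ideal_avoiding_powers[OF ideal_span PF_carrierI[OF w]] by blast
  obtain L where L: "\<forall>t\<in>set L. fst t \<in> carrier R \<and> set_pexp (snd t) \<subseteq> C"
    "\<forall>x. (\<forall>i. x i \<in> carrier R) \<longrightarrow> comb L x = ev x w"
    using constant_polynomial_decomposition[OF w] by (elim exE conjE)
  have "\<exists>c\<in>points n C. ev c w \<noteq> \<zero> \<and>
      (\<forall>q. set_pexp q \<subseteq> C \<longrightarrow> poly_fun q \<in> Q \<longrightarrow> ev c q = \<zero>)"
    by (rule nonzero_point[OF alg Q(1) _ w _ Q(3), of L]) (use L points_C_carrier in auto)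
  then obtain c where c: "c \<in> points n C" "ev c w \<noteq> \<zero>"
    "\<And>q. set_pexp q \<subseteq> C \<Longrightarrow> poly_fun q \<in> Q \<Longrightarrow> ev c q = \<zero>" by blast
  have "ev (sol_jet c) p = \<zero>" if p: "p \<in> M" for p
  proof -
    have pR: "set_pexp p \<subseteq> carrier R" using M_carrier[OF p] .
    have "(\<lambda>c. \<one> \<otimes> ev (sol_jet c) p) \<in> M_span" using p by (intro M_span_base) auto
    then have "(\<lambda>c. ev c (psubst jet_form p)) \<in> M_span"
      by (rule M_span_cong) (simp add: ev_s ev_M_closed p)
    from span_vanishes[OF Q(2) c(1) c(3) set_subst[OF pR] this] show ?thesis by (simp add: ev_s c(1))
  qed
  moreover have "ev (sol_jet c) W \<noteq> \<zero>" using c(2) by (simp add: w_def ev_s c(1))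
  ultimately show ?thesis using sol_solution[OF c(1)] jet_sol[OF c(1)] by (intro bexI[of _ "sol c"]) simp_all
qed

end

section \<open>Embeddings of differential fields\<close>

locale diff_field_hom = R: differential_field R + K: differential_field K
  for R :: "('a, 'm) diff_ring_scheme" (structure) and K :: "('k, 'l) diff_ring_scheme" (structure) +
  fixes E :: "'a set" and h :: "'a \<Rightarrow> 'k"
  assumes dom: "diff_subfield E R" and emb: "h \<in> diff_embeddings R E K"
begin

lemma subfield_dom: "subfield E R" and subring_dom: "subring E R" and dom_subset: "E \<subseteq> carrier R"
  and dom_deriv: "x \<in> E \<Longrightarrow> \<partial>\<^bsub>R\<^esub> x \<in> E"
  using dom subfieldE(1,3)[of E R] by (auto simp: diff_subfield_def)

lemma dom_closed: "x \<in> E \<Longrightarrow> x \<in> carrier R" using dom_subset by blast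

lemmas dom_ops = subringE(2,3,5,6,7)[OF subring_dom]

lemma hom: "h \<in> ring_hom (R\<lparr>carrier := E\<rparr>) K" and inj: "inj_on h E"
  and emb_deriv: "x \<in> E \<Longrightarrow> h (\<partial>\<^bsub>R\<^esub> x) = \<partial>\<^bsub>K\<^esub> (h x)"
  using emb by (auto simp: diff_embeddings_def)

lemma emb_closed: "x \<in> E \<Longrightarrow> h x \<in> carrier K"
  using ring_hom_closed[OF hom] by simp

lemma emb_mult: "x \<in> E \<Longrightarrow> y \<in> E \<Longrightarrow> h (x \<otimes>\<^bsub>R\<^esub> y) = h x \<otimes>\<^bsub>K\<^esub> h y"
  using ring_hom_mult[OF hom, of x y] by simp

lemma emb_add: "x \<in> E \<Longrightarrow> y \<in> E \<Longrightarrow> h (x \<oplus>\<^bsub>R\<^esub> y) = h x \<oplus>\<^bsub>K\<^esub> h y"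
  using ring_hom_add[OF hom, of x y] by simp

lemma emb_zero: "h \<zero>\<^bsub>R\<^esub> = \<zero>\<^bsub>K\<^esub>"
  using ring_hom_zero[OF hom R.subring_is_ring[OF subring_dom] K.ring_axioms] by simp

lemma emb_one: "h \<one>\<^bsub>R\<^esub> = \<one>\<^bsub>K\<^esub>" using ring_hom_one[OF hom] by simp

lemma emb_minus: assumes x: "x \<in> E" shows "h (\<ominus>\<^bsub>R\<^esub> x) = \<ominus>\<^bsub>K\<^esub> h x"
proof -
  have "h (\<ominus>\<^bsub>R\<^esub> x) \<oplus>\<^bsub>K\<^esub> h x = h (\<ominus>\<^bsub>R\<^esub> x \<oplus>\<^bsub>R\<^esub> x)" using x dom_ops(3) by (simp add: emb_add)
  then have "h (\<ominus>\<^bsub>R\<^esub> x) \<oplus>\<^bsub>K\<^esub> h x = \<zero>\<^bsub>K\<^esub>" using dom_closed[OF x] by (simp add: R.l_neg emb_zero)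
  then show ?thesis using K.minus_equality emb_closed[OF x] emb_closed[OF dom_ops(3)[OF x]] by simp
qed

lemma emb_zero_iff: "x \<in> E \<Longrightarrow> h x = \<zero>\<^bsub>K\<^esub> \<longleftrightarrow> x = \<zero>\<^bsub>R\<^esub>"
  using inj_onD[OF inj, of x "\<zero>\<^bsub>R\<^esub>"] dom_ops(1) emb_zero by auto

lemma dom_iterate: "x \<in> E \<Longrightarrow> (deriv R ^^ i) x \<in> E"
  by (induction i) (auto intro: dom_deriv)

lemma emb_iterate: "x \<in> E \<Longrightarrow> h ((deriv R ^^ i) x) = (deriv K ^^ i) (h x)"
  by (induction i) (auto simp: emb_deriv dom_iterate)

lemma emb_finsum:
  fixes m :: nat
  assumes "\<And>k. k < m \<Longrightarrow> f k \<in> E"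
  shows "finsum R f {..<m} \<in> E \<and> h (finsum R f {..<m}) = finsum K (\<lambda>k. h (f k)) {..<m}"
  using assms
proof (induction m)
  case 0
  then show ?case by (simp add: dom_ops emb_zero)
next
  case (Suc m)
  then have "finsum R f {..<Suc m} = f m \<oplus>\<^bsub>R\<^esub> finsum R f {..<m}"
    "finsum K (\<lambda>k. h (f k)) {..<Suc m} = h (f m) \<oplus>\<^bsub>K\<^esub> finsum K (\<lambda>k. h (f k)) {..<m}"
    by (simp_all add: lessThan_Suc Pi_def dom_closed emb_closed)
  then show ?case using Suc by (simp add: dom_ops emb_add)
qed

lemma image_solution:
  assumes y: "y \<in> E" "y \<in> lin_diff_solutions R N n a" and a: "\<And>i. i < n \<Longrightarrow> a i \<in> E"
  shows "h y \<in> lin_diff_solutions K (carrier K) n (\<lambda>i. h (a i))"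
proof -
  let ?s = "\<Oplus>\<^bsub>R\<^esub>i\<in>{..<n}. a i \<otimes>\<^bsub>R\<^esub> (deriv R ^^ i) y"
  have s: "?s \<in> E \<and> h ?s = (\<Oplus>\<^bsub>K\<^esub>i\<in>{..<n}. h (a i \<otimes>\<^bsub>R\<^esub> (deriv R ^^ i) y))"
    using a dom_iterate[OF y(1)] dom_ops(4) by (intro emb_finsum) auto
  also have "(\<Oplus>\<^bsub>K\<^esub>i\<in>{..<n}. h (a i \<otimes>\<^bsub>R\<^esub> (deriv R ^^ i) y))
      = (\<Oplus>\<^bsub>K\<^esub>i\<in>{..<n}. h (a i) \<otimes>\<^bsub>K\<^esub> (deriv K ^^ i) (h y))"
    using a y(1) by (intro K.finsum_cong')
      (auto simp: emb_mult dom_iterate emb_iterate emb_closed intro!: K.deriv_iterate_closed)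
  finally have s: "?s \<in> E" "h ?s = (\<Oplus>\<^bsub>K\<^esub>i\<in>{..<n}. h (a i) \<otimes>\<^bsub>K\<^esub> (deriv K ^^ i) (h y))" by auto
  have "h ((deriv R ^^ n) y \<oplus>\<^bsub>R\<^esub> ?s) = \<zero>\<^bsub>K\<^esub>" using y(2) emb_zero by (simp add: lin_diff_solutions_def)
  then show ?thesis
    using s y(1) emb_closed[OF y(1)] by (simp add: lin_diff_solutions_def emb_add dom_iterate emb_iterate)
qed

lemma image_fundamental_system:
  assumes z: "R.fundamental_system n a z" "\<And>k. k < n \<Longrightarrow> z k \<in> E" and a: "\<And>i. i < n \<Longrightarrow> a i \<in> E"
    and C: "constants R (carrier R) \<subseteq> E" "constants K (carrier K) = h ` constants R (carrier R)"
  shows "K.fundamental_system n (\<lambda>i. h (a i)) (\<lambda>k. h (z k))"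
  unfolding K.fundamental_system_def
proof (intro conjI allI impI)
  show "h (z k) \<in> lin_diff_solutions K (carrier K) n (\<lambda>i. h (a i))" if "k < n" for k
    using image_solution[OF z(2)[OF that] _ a, of "carrier R"] z(1) that
    by (simp add: R.fundamental_system_def)
  fix e k
  assume e: "\<forall>k. e k \<in> constants K (carrier K)" "(\<Oplus>\<^bsub>K\<^esub>k\<in>{..<n}. e k \<otimes>\<^bsub>K\<^esub> h (z k)) = \<zero>\<^bsub>K\<^esub>" "k < n"
  have "\<exists>c. c \<in> constants R (carrier R) \<and> e k = h c" for k using e(1) C(2) by blast
  then obtain c where c: "\<And>k. c k \<in> constants R (carrier R)" "\<And>k. e k = h (c k)" by metis
  have cE: "c k \<in> E" for k using c(1) C(1) by blast
  have sE: "(\<Oplus>\<^bsub>R\<^esub>k\<in>{..<n}. c k \<otimes>\<^bsub>R\<^esub> z k) \<in> E"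
    and "h (\<Oplus>\<^bsub>R\<^esub>k\<in>{..<n}. c k \<otimes>\<^bsub>R\<^esub> z k) = (\<Oplus>\<^bsub>K\<^esub>k\<in>{..<n}. h (c k \<otimes>\<^bsub>R\<^esub> z k))"
    using emb_finsum[of n "\<lambda>k. c k \<otimes>\<^bsub>R\<^esub> z k"] cE z(2) dom_ops(4) by auto
  note this(2)
  also have "(\<Oplus>\<^bsub>K\<^esub>k\<in>{..<n}. h (c k \<otimes>\<^bsub>R\<^esub> z k)) = (\<Oplus>\<^bsub>K\<^esub>k\<in>{..<n}. e k \<otimes>\<^bsub>K\<^esub> h (z k))"
    using cE z(2) c(2) by (intro K.finsum_cong') (auto simp: emb_mult emb_closed)
  finally have "(\<Oplus>\<^bsub>R\<^esub>k\<in>{..<n}. c k \<otimes>\<^bsub>R\<^esub> z k) = \<zero>\<^bsub>R\<^esub>" using e(2) emb_zero_iff[OF sE] by simp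
  then have "c k = \<zero>\<^bsub>R\<^esub>"
    using c(1) e(3) by (intro R.fundamental_system_independent[OF z(1), of c k])
  then show "e k = \<zero>\<^bsub>K\<^esub>" using c(2) emb_zero by simp
qed

lemma image_diff_subfield: "diff_subfield (h ` E) K"
proof -
  interpret EE: field "R\<lparr>carrier := E\<rparr>"
    using R.subfield_iff(2)[OF subfield_dom] .
  interpret h: ring_hom_ring "R\<lparr>carrier := E\<rparr>" K h
    by (rule ring_hom_ringI2[OF EE.ring_axioms K.ring_axioms hom])
  have "subfield E (R\<lparr>carrier := E\<rparr>)" using EE.carrier_is_subfield by simp
  from h.img_is_subfield(2)[OF this] have "subfield (h ` E) K" by simp
  moreover have "\<partial>\<^bsub>K\<^esub> y \<in> h ` E" if "y \<in> h ` E" for y using that emb_deriv[symmetric] dom_deriv by auto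
  ultimately show ?thesis by (simp add: diff_subfield_def)
qed

lemma vimage_diff_subfield:
  assumes N: "diff_subfield N R" "N \<subseteq> E" and M: "diff_subfield M K"
  shows "diff_subfield {x \<in> N. h x \<in> M} R"
proof -
  have Nf: "subfield N R" and Ns: "subring N R" and Mf: "subfield M K" and Ms: "subring M K"
    using N(1) M subfieldE(1) by (auto simp: diff_subfield_def)
  note N_ops = subringE(2,3,5,6,7)[OF Ns] and M_ops = subringE(2,3,5,6,7)[OF Ms]
  have NE: "x \<in> E" if "x \<in> N" for x using that N(2) by blast
  have "subfield {x \<in> N. h x \<in> M} R"
  proof (rule R.subfieldI')
    show "subring {x \<in> N. h x \<in> M} R"
      by (rule R.subringI)
        (use N_ops M_ops NE dom_closed in \<open>auto simp: emb_one emb_minus emb_mult emb_add\<close>)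
    fix x assume "x \<in> {x \<in> N. h x \<in> M} - {\<zero>\<^bsub>R\<^esub>}"
    then have x: "x \<in> N" "h x \<in> M" "x \<noteq> \<zero>\<^bsub>R\<^esub>" by auto
    have inv: "inv\<^bsub>R\<^esub> x \<in> N" "inv\<^bsub>R\<^esub> x \<otimes>\<^bsub>R\<^esub> x = \<one>\<^bsub>R\<^esub>" using R.subfield_m_inv[OF Nf, of x] x by auto
    have hx: "h x \<noteq> \<zero>\<^bsub>K\<^esub>" using emb_zero_iff[OF NE[OF x(1)]] x(3) by simp
    have invM: "inv\<^bsub>K\<^esub> (h x) \<in> M" "h x \<otimes>\<^bsub>K\<^esub> inv\<^bsub>K\<^esub> (h x) = \<one>\<^bsub>K\<^esub>" "inv\<^bsub>K\<^esub> (h x) \<in> carrier K"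
      using K.subfield_m_inv[OF Mf, of "h x"] x(2) hx subfieldE(3)[OF Mf] by auto
    have c: "h (inv\<^bsub>R\<^esub> x) \<in> carrier K" "h x \<in> carrier K" using emb_closed NE inv(1) x(1) by auto
    have "h (inv\<^bsub>R\<^esub> x) \<otimes>\<^bsub>K\<^esub> h x = \<one>\<^bsub>K\<^esub>"
      using emb_mult[OF NE[OF inv(1)] NE[OF x(1)]] inv(2) emb_one by simp
    then have "h (inv\<^bsub>R\<^esub> x) = inv\<^bsub>K\<^esub> (h x)"
      using c K.inv_char[of "h x" "h (inv\<^bsub>R\<^esub> x)"] K.m_comm[OF c] by simp
    then show "inv\<^bsub>R\<^esub> x \<in> {x \<in> N. h x \<in> M}" using inv(1) invM(1) by simp
  qed
  moreover have "\<partial>\<^bsub>R\<^esub> x \<in> {x \<in> N. h x \<in> M}" if "x \<in> {x \<in> N. h x \<in> M}" for x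
    using that N(1) M NE by (auto simp: diff_subfield_def emb_deriv)
  ultimately show ?thesis by (simp add: diff_subfield_def)
qed

end

locale diff_embedding = differential_field R + diff_field_hom R R D \<theta>
  for R :: "('a, 'm) diff_ring_scheme" (structure) and D :: "'a set" and \<theta> :: "'a \<Rightarrow> 'a" +
  assumes C_subset: "constants R (carrier R) \<subseteq> D"
    and fix_constants: "\<And>c. c \<in> constants R (carrier R) \<Longrightarrow> \<theta> c = c"

lemma (in differential_field) diff_embeddingI:
  assumes "diff_subfield D R" "constants R (carrier R) \<subseteq> D" "\<theta> \<in> diff_embeddings R D R"
    and "\<And>c. c \<in> constants R (carrier R) \<Longrightarrow> \<theta> c = c"
  shows "diff_embedding R D \<theta>"
  using assms
  by (intro diff_embedding.intro diff_field_hom.intro diff_field_hom_axioms.intro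
      diff_embedding_axioms.intro differential_field_axioms) auto

context diff_embedding
begin

abbreviation "C \<equiv> constants R (carrier R)"
abbreviation "D' \<equiv> \<theta> ` D"

lemma D'_carrier: "D' \<subseteq> carrier R" using emb_closed by auto

lemma C_subset_image: "C \<subseteq> D'"
proof
  fix c assume c: "c \<in> C"
  then have "c \<in> D" using C_subset by (rule subsetD[rotated])
  then show "c \<in> D'" by (rule image_eqI[rotated]) (simp add: fix_constants[OF c])
qed

lemma set_map: "set_pexp p \<subseteq> D \<Longrightarrow> set_pexp (map_pexp \<theta> p) \<subseteq> D'"
  by (auto simp: pexp.set_map)

lemma set_map_carrier: "set_pexp p \<subseteq> D \<Longrightarrow> set_pexp (map_pexp \<theta> p) \<subseteq> carrier R"
  using set_map[of p] D'_carrier by (rule subset_trans)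

lemma points_closed: "x \<in> points n D \<Longrightarrow> x i \<in> D"
  using points_in_subring[OF subring_dom] .

lemma ev_map:
  assumes "\<And>i. x i \<in> D" "set_pexp p \<subseteq> D"
  shows "ev (\<lambda>i. \<theta> (x i)) (map_pexp \<theta> p) = \<theta> (ev x p)"
  using assms(2)
proof (induction p)
  case (Add p q)
  then show ?case using ev_in_subring[OF subring_dom assms(1)] by (simp add: emb_add)
next
  case (Mul p q)
  then show ?case using ev_in_subring[OF subring_dom assms(1)] by (simp add: emb_mult)
qed auto

lemma points_image: "points n D' = (\<lambda>x i. \<theta> (x i)) ` points n D"
proof (intro equalityI subsetI)
  fix y assume y: "y \<in> points n D'"
  define x where "x i = (if i < n then inv_into D \<theta> (y i) else \<zero>)" for i
  have "x \<in> points n D" using y by (auto simp: points_def x_def intro!: inv_into_into)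
  moreover have "y = (\<lambda>i. \<theta> (x i))"
  proof
    fix i
    show "y i = \<theta> (x i)"
      using y f_inv_into_f[of "y i" \<theta> D] by (cases "i < n") (simp_all add: points_def x_def emb_zero)
  qed
  ultimately show "y \<in> (\<lambda>x i. \<theta> (x i)) ` points n D" by blast
qed (auto simp: points_def emb_zero)

lemma map_linear_form: "map_pexp \<theta> (linear_form d m) = linear_form (\<lambda>j. \<theta> (d j)) m"
  by (induction m) (auto simp: emb_zero)

lemma linear_form_cong: "(\<And>j. j < m \<Longrightarrow> d j = e j) \<Longrightarrow> linear_form d m = linear_form e m"
  by (induction m) auto

lemma map_formal_deriv:
  assumes "set_pexp p \<subseteq> D" "\<And>i. i < n \<Longrightarrow> a i \<in> D"
  shows "map_pexp \<theta> (formal_deriv n a p) = formal_deriv n (\<lambda>i. \<theta> (a i)) (map_pexp \<theta> p)"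
  using assms(1)
proof (induction p)
  case (Var i)
  have "linear_form (\<lambda>j. \<theta> (\<ominus> a j)) n = linear_form (\<lambda>j. \<ominus> \<theta> (a j)) n"
    using assms(2) emb_minus by (intro linear_form_cong) auto
  then show ?case by (simp add: map_linear_form emb_zero)
qed (auto simp: emb_deriv)

lemma map_power: "map_pexp \<theta> (pexp_power p k) = pexp_power (map_pexp \<theta> p) k"
  by (induction k) (auto simp: emb_one)

lemma map_inverse:
  assumes "set_pexp q \<subseteq> D'"
  obtains p where "set_pexp p \<subseteq> D" "q = map_pexp \<theta> p"
proof
  show "set_pexp (map_pexp (inv_into D \<theta>) q) \<subseteq> D"
    using assms by (auto simp: pexp.set_map intro!: inv_into_into)
  have "map_pexp \<theta> (map_pexp (inv_into D \<theta>) q) = map_pexp (\<lambda>x. x) q"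
    unfolding pexp.map_comp
    by (rule pexp.map_cong0) (use assms in \<open>auto intro!: f_inv_into_f\<close>)
  then show "q = map_pexp \<theta> (map_pexp (inv_into D \<theta>) q)" by (simp add: pexp.map_ident)
qed

lemma map_injective:
  "set_pexp p \<subseteq> D \<Longrightarrow> set_pexp q \<subseteq> D \<Longrightarrow> map_pexp \<theta> p = map_pexp \<theta> q \<Longrightarrow> p = q"
  using inj by (intro pexp.inj_map_strong[of p q \<theta> \<theta>]) (auto simp: inj_on_def subset_iff)

lemma diff_ideal_image:
  assumes M: "diff_ideal D n a M" and a: "\<And>i. i < n \<Longrightarrow> a i \<in> D"
  shows "diff_ideal D' n (\<lambda>i. \<theta> (a i)) (map_pexp \<theta> ` M)"
  unfolding diff_ideal_def
proof (intro conjI ballI allI impI)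
  note MD = diff_idealD(1)[OF M]
  show "map_pexp \<theta> ` M \<subseteq> {p. set_pexp p \<subseteq> D'}" using MD set_map by blast
  have "Const \<zero> \<in> M" using M by (simp add: diff_ideal_def)
  then show "Const \<zero> \<in> map_pexp \<theta> ` M" by (intro image_eqI[of _ _ "Const \<zero>"]) (simp_all add: emb_zero)
  fix p' assume "p' \<in> map_pexp \<theta> ` M"
  then obtain p where p: "p \<in> M" "p' = map_pexp \<theta> p" by (elim imageE)
  show "formal_deriv n (\<lambda>i. \<theta> (a i)) p' \<in> map_pexp \<theta> ` M"
    using diff_idealD(4)[OF M p(1)] p(2) map_formal_deriv[OF MD[OF p(1)] a]
    by (intro image_eqI[of _ _ "formal_deriv n a p"]) simp_all
  show "Add p' q' \<in> map_pexp \<theta> ` M" if q': "q' \<in> map_pexp \<theta> ` M" for q'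
  proof -
    obtain q where q: "q' = map_pexp \<theta> q" "q \<in> M" using q' by (elim imageE)
    then show ?thesis using diff_idealD(2)[OF M p(1) q(2)] p(2)
      by (intro image_eqI[of _ _ "Add p q"]) simp_all
  qed
  fix q' assume "set_pexp q' \<subseteq> D'"
  then obtain q where q: "set_pexp q \<subseteq> D" "q' = map_pexp \<theta> q" by (rule map_inverse)
  show "Mul q' p' \<in> map_pexp \<theta> ` M"
    using diff_idealD(3)[OF M p(1) q(1)] p(2) q(2) by (intro image_eqI[of _ _ "Mul q p"]) simp_all
  assume eq: "\<forall>x\<in>points n D'. ev x q' = ev x p'"
  have "q \<in> M"
  proof (rule diff_idealD(5)[OF M p(1) q(1)])
    fix x assume x: "x \<in> points n D"
    have "(\<lambda>i. \<theta> (x i)) \<in> points n D'" using x points_image by blast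
    then have "\<theta> (ev x q) = \<theta> (ev x p)"
      using eq ev_map[of x q, OF points_closed[OF x] q(1)]
        ev_map[of x p, OF points_closed[OF x] MD[OF p(1)]] q(2) p(2) by simp
    then show "ev x q = ev x p"
      using inj ev_in_subring[OF subring_dom points_closed[OF x]] q(1) MD[OF p(1)] by (simp add: inj_on_def)
  qed
  then show "q' \<in> map_pexp \<theta> ` M" using q(2) by blast
qed

section \<open>Extending an embedding by one solution\<close>

text \<open>
  The polynomials over \<open>D\<close> that vanish at the jet of \<open>y\<close> once \<open>\<theta>\<close> has been applied to their
  coefficients. If \<open>\<theta>\<close> is the identity, these are the algebraic relations over \<open>D\<close> between \<open>y\<close> and its
  derivatives.
\<close>

definition relations :: "nat \<Rightarrow> 'a \<Rightarrow> 'a pexp set" where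
  "relations n y = {p. set_pexp p \<subseteq> D \<and> ev (jet n y) (map_pexp \<theta> p) = \<zero>}"

lemma jet_points: "y \<in> carrier R \<Longrightarrow> jet n y \<in> points n (carrier R)"
  by (simp add: points_def jet_def deriv_iterate_closed)

lemma diff_ideal_relations:
  assumes y: "y \<in> lin_diff_solutions R (carrier R) n (\<lambda>i. \<theta> (a i))"
    and a: "\<And>i. i < n \<Longrightarrow> a i \<in> D"
  shows "diff_ideal D n a (relations n y)"
  unfolding diff_ideal_def
proof (intro conjI ballI allI impI)
  have yc: "y \<in> carrier R" using y by (simp add: lin_diff_solutions_def)
  note jc = jet_closed[OF yc]
  have evc: "ev (jet n y) (map_pexp \<theta> q) \<in> carrier R" if "set_pexp q \<subseteq> D" for q
    using ev_closed[OF jc set_map_carrier[OF that]] .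
  show "relations n y \<subseteq> {p. set_pexp p \<subseteq> D}" by (auto simp: relations_def)
  show "Const \<zero> \<in> relations n y" by (simp add: relations_def emb_zero dom_ops)
  fix p assume "p \<in> relations n y"
  then have p: "set_pexp p \<subseteq> D" "ev (jet n y) (map_pexp \<theta> p) = \<zero>" by (simp_all add: relations_def)
  show "Add p q \<in> relations n y" if "q \<in> relations n y" for q
    using that p by (simp add: relations_def)
  have "ev (jet n y) (map_pexp \<theta> (formal_deriv n a p)) = \<partial> \<zero>"
  proof -
    have "map_pexp \<theta> (formal_deriv n a p) = formal_deriv n (\<lambda>i. \<theta> (a i)) (map_pexp \<theta> p)"
      using a by (intro map_formal_deriv[OF p(1)])
    moreover have "ev (jet n y) (formal_deriv n (\<lambda>i. \<theta> (a i)) (map_pexp \<theta> p))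
        = \<partial> (ev (jet n y) (map_pexp \<theta> p))"
      using emb_closed a by (intro ev_formal_deriv[OF y _ set_map_carrier[OF p(1)]]) simp
    ultimately show ?thesis using p(2) by simp
  qed
  then show "formal_deriv n a p \<in> relations n y"
    using set_formal_deriv[OF dom a p(1)] by (simp add: relations_def)
  fix q assume q: "set_pexp q \<subseteq> D"
  then show "Mul q p \<in> relations n y" using p evc by (simp add: relations_def)
  assume eq: "\<forall>x\<in>points n D. ev x q = ev x p"
  define h where "h = Add (map_pexp \<theta> q) (Mul (Const (\<ominus> \<one>)) (map_pexp \<theta> p))"
  have h: "set_pexp h \<subseteq> carrier R" using set_map_carrier[OF p(1)] set_map_carrier[OF q] by (simp add: h_def)
  \<comment> \<open>The values of \<open>p\<close> and \<open>q\<close> agree on an infinite grid, so the two are the same polynomial.\<close>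
  have "ev (jet n y) h = \<zero>"
  proof (rule vanishing_on_infinite_grid[OF h D'_carrier _ _ jet_points[OF yc]])
    show "infinite D'" using infinite_constants C_subset_image finite_subset by blast
    fix x' assume "x' \<in> points n D'"
    then obtain x where x: "x \<in> points n D" "x' = (\<lambda>i. \<theta> (x i))" unfolding points_image by (elim imageE)
    have "ev x' (map_pexp \<theta> p) \<in> carrier R"
      using ev_closed[OF _ set_map_carrier[OF p(1)], of x'] x(2) emb_closed points_closed[OF x(1)] by simp
    then show "ev x' h = \<zero>"
      using eq x ev_map[of x q, OF points_closed[OF x(1)] q]
        ev_map[of x p, OF points_closed[OF x(1)] p(1)]
      by (simp add: h_def l_minus r_neg)
  qed
  then have "ev (jet n y) (map_pexp \<theta> q) = \<zero>" using p(2) evc[OF q] by (simp add: h_def)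
  then show "q \<in> relations n y" using q by (simp add: relations_def)
qed

lemma relations_avoid_powers:
  assumes y: "y \<in> carrier R" and W: "set_pexp W \<subseteq> D" and nz: "ev (jet n y) (map_pexp \<theta> W) \<noteq> \<zero>"
  shows "pexp_power W k \<notin> relations n y"
proof
  assume "pexp_power W k \<in> relations n y"
  then have "ev (jet n y) (map_pexp \<theta> W) [^] k = \<zero>"
    using ev_pexp_power[OF jet_closed[OF y] set_map_carrier[OF W]] by (simp add: relations_def map_power)
  moreover have "ev (jet n y) (map_pexp \<theta> W) \<in> carrier R"
    using ev_closed[OF jet_closed[OF y] set_map_carrier[OF W]] .
  ultimately show False using pow_nonzero[OF _ nz] by blast
qed

end

context differential_field
begin

lemma diff_ideal_Union:
  assumes "S \<noteq> {}" and S: "\<And>M. M \<in> S \<Longrightarrow> diff_ideal D n a M"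
    and chain: "\<And>M N. M \<in> S \<Longrightarrow> N \<in> S \<Longrightarrow> M \<subseteq> N \<or> N \<subseteq> M"
  shows "diff_ideal D n a (\<Union>S)"
  unfolding diff_ideal_def
proof (intro conjI ballI allI impI)
  show "\<Union>S \<subseteq> {p. set_pexp p \<subseteq> D}" using diff_idealD(1)[OF S] by blast
  obtain M0 where "M0 \<in> S" using assms(1) by blast
  then show "Const \<zero> \<in> \<Union>S" using S[of M0] by (auto simp: diff_ideal_def)
  fix p assume "p \<in> \<Union>S"
  then obtain M where M: "M \<in> S" "p \<in> M" by blast
  note MM = S[OF M(1)]
  show "formal_deriv n a p \<in> \<Union>S" using diff_idealD(4)[OF MM M(2)] M(1) by blast
  show "Add p q \<in> \<Union>S" if q: "q \<in> \<Union>S" for q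
  proof -
    obtain N where N: "N \<in> S" "q \<in> N" using q by (elim UnionE)
    from chain[OF M(1) N(1)] show ?thesis
    proof
      assume "M \<subseteq> N"
      then have "p \<in> N" using M(2) by blast
      then have "Add p q \<in> N" using diff_idealD(2)[OF S[OF N(1)] _ N(2)] by simp
      then show ?thesis using N(1) by blast
    next
      assume "N \<subseteq> M"
      then have "q \<in> M" using N(2) by blast
      then have "Add p q \<in> M" using diff_idealD(2)[OF MM M(2)] by simp
      then show ?thesis using M(1) by blast
    qed
  qed
  fix q assume q: "set_pexp q \<subseteq> D"
  show "Mul q p \<in> \<Union>S" using diff_idealD(3)[OF MM M(2) q] M(1) by blast
  assume "\<forall>x\<in>points n D. ev x q = ev x p"
  then show "q \<in> \<Union>S" using diff_idealD(5)[OF MM M(2) q] M(1) by blast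
qed

lemma maximal_diff_ideal:
  assumes M0: "diff_ideal D n a M0" "\<And>k. pexp_power W k \<notin> M0"
  shows "\<exists>M. diff_ideal D n a M \<and> (\<forall>k. pexp_power W k \<notin> M) \<and>
    (\<forall>N. diff_ideal D n a N \<longrightarrow> (\<forall>k. pexp_power W k \<notin> N) \<longrightarrow> M \<subseteq> N \<longrightarrow> N = M)"
proof -
  define S where "S = {M. diff_ideal D n a M \<and> (\<forall>k. pexp_power W k \<notin> M)}"
  have "\<exists>M\<in>S. \<forall>N\<in>S. M \<subseteq> N \<longrightarrow> N = M"
  proof (rule subset_Zorn_nonempty)
    show "S \<noteq> {}" using M0 by (auto simp: S_def)
    fix CC assume CC: "CC \<noteq> {}" "subset.chain S CC"
    then have mem: "M \<in> S" if "M \<in> CC" for M using that unfolding pred_on.chain_def by blast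
    have "diff_ideal D n a (\<Union>CC)"
    proof (rule diff_ideal_Union[OF CC(1)])
      show "M \<subseteq> N \<or> N \<subseteq> M" if "M \<in> CC" "N \<in> CC" for M N
        using CC(2) that unfolding pred_on.chain_def by blast
    qed (use mem in \<open>simp add: S_def\<close>)
    then show "\<Union>CC \<in> S" using mem by (auto simp: S_def)
  qed
  then show ?thesis by (auto simp: S_def)
qed

text \<open>
  The Wronskian matrix is invertible, so no nonzero linear form annihilates all its rows.
\<close>

lemma linear_form_detects:
  assumes z: "fundamental_system n a z" and a: "\<And>i. i < n \<Longrightarrow> a i \<in> carrier R"
    and d: "\<And>j. d j \<in> carrier R" "j0 < n" "d j0 \<noteq> \<zero>"
  shows "\<exists>k<n. ev (jet n (z k)) (linear_form d n) \<noteq> \<zero>"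
proof (rule ccontr)
  assume neg: "\<not> ?thesis"
  have zsol: "z k \<in> lin_diff_solutions R (carrier R) n a" if "k < n" for k
    using z that by (simp add: fundamental_system_def)
  have zc: "(deriv R ^^ j) (z k) \<in> carrier R" if "k < n" for k j
    using solution_deriv_closed[OF zsol[OF that]] .
  have zero: "(\<Oplus>j\<in>{..<n}. d j \<otimes> (deriv R ^^ j) (z k)) = \<zero>" if "k < n" for k
  proof -
    have zk: "z k \<in> carrier R" using zc[OF that, of 0] by simp
    have "ev (jet n (z k)) (linear_form d n) = (\<Oplus>j\<in>{..<n}. d j \<otimes> jet n (z k) j)"
      using d(1) jet_closed[OF zk] by (rule ev_linear_form)
    also have "\<dots> = (\<Oplus>j\<in>{..<n}. d j \<otimes> (deriv R ^^ j) (z k))"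
      using d(1) zc[OF that] by (intro finsum_cong') (auto simp: jet_def)
    finally show ?thesis using neg that by simp
  qed
  have "\<exists>B :: nat \<Rightarrow> nat \<Rightarrow> 'a. (\<forall>j k. B j k \<in> carrier R) \<and>
    (\<forall>x. (\<forall>j. x j \<in> carrier R) \<longrightarrow>
      (\<forall>i<n. (\<Oplus>k\<in>{..<n}. (\<Oplus>j\<in>{..<n}. x j \<otimes> B j k) \<otimes> (deriv R ^^ i) (z k)) = x i))"
    by (rule invertible_if_trivial_kernel) (auto intro: zc wronskian_independent[OF z a])
  then obtain B :: "nat \<Rightarrow> nat \<Rightarrow> 'a" where B: "\<And>j k. B j k \<in> carrier R"
    "\<And>x i. (\<And>j. x j \<in> carrier R) \<Longrightarrow> i < n \<Longrightarrow>
      (\<Oplus>k\<in>{..<n}. (\<Oplus>j\<in>{..<n}. x j \<otimes> B j k) \<otimes> (deriv R ^^ i) (z k)) = x i"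
    by meson
  define e where "e j = (if j = j0 then \<one> else \<zero>)" for j
  define c where "c k = (\<Oplus>j\<in>{..<n}. e j \<otimes> B j k)" for k
  have ec: "e j \<in> carrier R" for j by (simp add: e_def)
  have cc: "c k \<in> carrier R" for k unfolding c_def using ec B(1) by (auto intro!: finsum_closed)
  have unit: "(\<Oplus>k\<in>{..<n}. c k \<otimes> (deriv R ^^ i) (z k)) = e i" if "i < n" for i
    unfolding c_def by (rule B(2)[OF ec that])
  have "d j0 = (\<Oplus>i\<in>{..<n}. if j0 = i then d i else \<zero>)"
    using d by (intro finsum_singleton[symmetric]) auto
  also have "\<dots> = (\<Oplus>i\<in>{..<n}. \<Oplus>k\<in>{..<n}. c k \<otimes> (d i \<otimes> (deriv R ^^ i) (z k)))"
  proof (rule finsum_cong')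
    fix i assume i: "i \<in> {..<n}"
    have "(\<Oplus>k\<in>{..<n}. c k \<otimes> (d i \<otimes> (deriv R ^^ i) (z k))) = (\<Oplus>k\<in>{..<n}. d i \<otimes> (c k \<otimes> (deriv R ^^ i) (z k)))"
      using cc d(1) zc by (intro finsum_cong') (auto simp: m_lcomm)
    also have "\<dots> = d i \<otimes> e i"
      using unit i cc d(1) zc by (subst finsum_rdistr[symmetric]) auto
    finally show "(if j0 = i then d i else \<zero>) = (\<Oplus>k\<in>{..<n}. c k \<otimes> (d i \<otimes> (deriv R ^^ i) (z k)))"
      using d(1) by (auto simp: e_def)
  qed (use cc d(1) zc in \<open>auto intro!: finsum_closed\<close>)
  also have "\<dots> = (\<Oplus>k\<in>{..<n}. \<Oplus>i\<in>{..<n}. c k \<otimes> (d i \<otimes> (deriv R ^^ i) (z k)))"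
    using cc d(1) zc by (intro finsum_swap) auto
  also have "\<dots> = (\<Oplus>k\<in>{..<n}. \<zero>)"
  proof (rule finsum_cong')
    fix k assume k: "k \<in> {..<n}"
    have "(\<Oplus>i\<in>{..<n}. c k \<otimes> (d i \<otimes> (deriv R ^^ i) (z k)))
        = c k \<otimes> (\<Oplus>i\<in>{..<n}. d i \<otimes> (deriv R ^^ i) (z k))"
      using k cc d(1) zc by (intro finsum_rdistr[symmetric]) auto
    then show "(\<Oplus>i\<in>{..<n}. c k \<otimes> (d i \<otimes> (deriv R ^^ i) (z k))) = \<zero>" using zero k cc by simp
  qed auto
  finally show False using d(3) by (simp add: finsum_zero)
qed

definition independent_solutions :: "'a set \<Rightarrow> nat \<Rightarrow> (nat \<Rightarrow> 'a) \<Rightarrow> nat \<Rightarrow> (nat \<Rightarrow> 'a) \<Rightarrow> bool" where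
  "independent_solutions D n a r v \<longleftrightarrow>
    (\<forall>k<r. v k \<in> lin_diff_solutions R (carrier R) n a \<and> v k \<in> D) \<and>
    (\<forall>e. (\<forall>k. e k \<in> constants R (carrier R)) \<longrightarrow> (\<Oplus>k\<in>{..<r}. e k \<otimes> v k) = \<zero> \<longrightarrow> (\<forall>k<r. e k = \<zero>))"

text \<open>
  The solutions in \<open>D\<close> have dimension \<open>r < n\<close> over the constants, because \<open>y\<close> is not among them. To
  vanish at the jets of a basis means to satisfy \<open>r\<close> linear equations over \<open>D\<close> in the \<open>n\<close>
  coefficients of the form.
\<close>

lemma annihilating_linear_form:
  assumes D: "diff_subfield D R" and C: "constants R (carrier R) \<subseteq> D"
    and a: "\<And>i. i < n \<Longrightarrow> a i \<in> D"
    and y: "y \<in> lin_diff_solutions R (carrier R) n a" "y \<notin> D"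
  shows "\<exists>d. (\<forall>j. d j \<in> D) \<and> (\<exists>j<n. d j \<noteq> \<zero>) \<and>
    (\<forall>v \<in> lin_diff_solutions R (carrier R) n a \<inter> D. ev (jet n v) (linear_form d n) = \<zero>)"
proof -
  let ?C = "constants R (carrier R)"
  have sub: "subfield D R" "subring D R" "D \<subseteq> carrier R" and dD: "\<And>x. x \<in> D \<Longrightarrow> \<partial> x \<in> D"
    using D subfieldE(1,3) by (auto simp: diff_subfield_def)
  have aR: "a i \<in> carrier R" if "i < n" for i using a[OF that] sub(3) by blast
  have "independent_solutions D n a 0 v" for v by (simp add: independent_solutions_def)
  moreover have "\<not> independent_solutions D n a n v" for v
  proof
    assume v: "independent_solutions D n a n v"
    then have "fundamental_system n a v" unfolding independent_solutions_def fundamental_system_def by simp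
    then obtain c where c: "\<forall>k. c k \<in> ?C" "y = (\<Oplus>k\<in>{..<n}. c k \<otimes> v k)"
      using solution_in_span_of_fundamental_system[OF _ aR y(1)] by blast
    have "(\<Oplus>k\<in>{..<m}. c k \<otimes> v k) \<in> D" if "m \<le> n" for m
      using that
    proof (induction m)
      case (Suc m)
      have "c k \<otimes> v k \<in> D" if "k \<le> m" for k
      proof (rule subringE(6)[OF sub(2)])
        show "c k \<in> D" using c(1) C by blast
        show "v k \<in> D" using v Suc.prems that by (simp add: independent_solutions_def)
      qed
      moreover from this have "c k \<otimes> v k \<in> carrier R" if "k \<le> m" for k using that sub(3) by blast
      ultimately show ?case using Suc subringE(7)[OF sub(2)] by (simp add: lessThan_Suc Pi_def)
    qed (simp add: subringE(2)[OF sub(2)])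
    then show False using c(2) y(2) by blast
  qed
  \<comment> \<open>The dimension \<open>r\<close> of the space of solutions in \<open>D\<close>.\<close>
  ultimately have "\<exists>r<n. (\<exists>v. independent_solutions D n a r v) \<and> \<not> (\<exists>v. independent_solutions D n a (Suc r) v)"
    using ex_least_nat_less[of "\<lambda>r. \<not> (\<exists>v. independent_solutions D n a r v)" n] by auto
  then obtain r v where r: "r < n" and v: "independent_solutions D n a r v"
    and max: "\<And>v. \<not> independent_solutions D n a (Suc r) v" by blast
  have vc: "(deriv R ^^ j) (v k) \<in> D" if "k < r" for j k
    using v that dD by (induction j) (auto simp: independent_solutions_def)
  have "\<exists>d. (\<forall>j. d j \<in> D) \<and> (\<exists>j\<in>{..<n}. d j \<noteq> \<zero>) \<and>
      (\<forall>k<r. (\<Oplus>j\<in>{..<n}. (deriv R ^^ j) (v k) \<otimes> d j) = \<zero>)"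
    using r vc by (intro homogeneous_system_nontrivial_solution[OF sub(1)]) auto
  then obtain d where d: "\<And>j. d j \<in> D" "\<exists>j\<in>{..<n}. d j \<noteq> \<zero>"
    "\<And>k. k < r \<Longrightarrow> (\<Oplus>j\<in>{..<n}. (deriv R ^^ j) (v k) \<otimes> d j) = \<zero>" by blast
  have dR: "d j \<in> carrier R" for j using d(1) sub(3) by blast
  have W: "ev (jet n u) (linear_form d n) = (\<Oplus>j\<in>{..<n}. (deriv R ^^ j) u \<otimes> d j)" if u: "u \<in> carrier R" for u
  proof -
    have "ev (jet n u) (linear_form d n) = (\<Oplus>j\<in>{..<n}. d j \<otimes> jet n u j)"
      using dR jet_closed[OF u] by (rule ev_linear_form)
    also have "\<dots> = (\<Oplus>j\<in>{..<n}. (deriv R ^^ j) u \<otimes> d j)"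
      using dR deriv_iterate_closed[OF u] by (intro finsum_cong') (auto simp: jet_def m_comm)
    finally show ?thesis .
  qed
  have "ev (jet n u) (linear_form d n) = \<zero>"
    if u: "u \<in> lin_diff_solutions R (carrier R) n a" "u \<in> D" for u
  proof -
    define w where "w k = (if k < r then v k else u)" for k
    have uR: "u \<in> carrier R" using u sub(3) by blast
    have dep: "\<not> independent_solutions D n a (Suc r) w" by (rule max)
    obtain e k where e: "\<forall>k. e k \<in> ?C" "(\<Oplus>k\<in>{..<Suc r}. e k \<otimes> w k) = \<zero>" "k < Suc r" "e k \<noteq> \<zero>"
    proof -
      have "\<forall>k<Suc r. w k \<in> lin_diff_solutions R (carrier R) n a \<and> w k \<in> D"
        using u v by (simp add: independent_solutions_def w_def)
      then show thesis using dep that unfolding independent_solutions_def by blast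
    qed
    have wD: "(deriv R ^^ j) (w k) \<in> D" for j k
      using u(2) v dD by (induction j) (auto simp: independent_solutions_def w_def)
    have wR: "(deriv R ^^ j) (w k) \<in> carrier R" for j k using wD sub(3) by blast
    have eR: "e k \<in> carrier R" for k using e(1) by (auto simp: constants_def)
    have er: "e r \<noteq> \<zero>"
    proof
      assume 0: "e r = \<zero>"
      have "(\<Oplus>k\<in>{..<Suc r}. e k \<otimes> w k) = e r \<otimes> w r \<oplus> (\<Oplus>k\<in>{..<r}. e k \<otimes> w k)"
        using eR wR[of 0] by (simp add: lessThan_Suc Pi_def)
      moreover have "v k \<in> carrier R" if "k < r" for k using vc[OF that, of 0] sub(3) by auto
      then have "(\<Oplus>k\<in>{..<r}. e k \<otimes> w k) = (\<Oplus>k\<in>{..<r}. e k \<otimes> v k)"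
        using eR by (intro finsum_cong') (auto simp: w_def)
      moreover have "(\<Oplus>k\<in>{..<r}. e k \<otimes> w k) \<in> carrier R"
        using eR wR[of 0] by (auto intro!: finsum_closed)
      ultimately have "(\<Oplus>k\<in>{..<r}. e k \<otimes> v k) = \<zero>" using e(2) 0 wR[of 0] by simp
      then have "\<forall>k<r. e k = \<zero>" using v e(1) unfolding independent_solutions_def by blast
      then show False using e(3,4) 0 by (cases "k = r") auto
    qed
    have comb: "(\<Oplus>k\<in>{..<Suc r}. e k \<otimes> (deriv R ^^ j) (w k)) = \<zero>" for j
    proof -
      have "(deriv R ^^ j) \<zero> = \<zero>" by (induction j) auto
      then show ?thesis using deriv_iterate_combination[of "Suc r" e w j] e wR[of 0] by simp
    qed
    have lin: "(\<Oplus>j\<in>{..<n}. (deriv R ^^ j) (w k) \<otimes> d j) = (if k < r then \<zero> else ev (jet n u) (linear_form d n))" for k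
      using d(3)[of k] W[OF uR] by (simp add: w_def)
    have "(\<Oplus>j\<in>{..<n}. (\<Oplus>k\<in>{..<Suc r}. e k \<otimes> (deriv R ^^ j) (w k)) \<otimes> d j)
        = (\<Oplus>j\<in>{..<n}. \<Oplus>k\<in>{..<Suc r}. e k \<otimes> ((deriv R ^^ j) (w k) \<otimes> d j))"
    proof (rule finsum_cong')
      fix j
      have "(\<Oplus>k\<in>{..<Suc r}. e k \<otimes> (deriv R ^^ j) (w k)) \<otimes> d j
          = (\<Oplus>k\<in>{..<Suc r}. (e k \<otimes> (deriv R ^^ j) (w k)) \<otimes> d j)"
        using eR wR dR by (intro finsum_ldistr) auto
      also have "\<dots> = (\<Oplus>k\<in>{..<Suc r}. e k \<otimes> ((deriv R ^^ j) (w k) \<otimes> d j))"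
        using eR wR dR by (intro finsum_cong') (auto simp: m_assoc)
      finally show "(\<Oplus>k\<in>{..<Suc r}. e k \<otimes> (deriv R ^^ j) (w k)) \<otimes> d j = \<dots>" .
    qed (use eR wR dR in \<open>auto intro!: finsum_closed\<close>)
    also have "\<dots> = (\<Oplus>k\<in>{..<Suc r}. \<Oplus>j\<in>{..<n}. e k \<otimes> ((deriv R ^^ j) (w k) \<otimes> d j))"
      using eR wR dR by (intro finsum_swap) auto
    also have "\<dots> = (\<Oplus>k\<in>{..<Suc r}. e k \<otimes> (if k < r then \<zero> else ev (jet n u) (linear_form d n)))"
      unfolding lin[symmetric] using eR wR dR
      by (intro finsum_cong' finsum_rdistr[symmetric]) (auto intro!: finsum_closed finsum_rdistr[symmetric])
    also have "\<dots> = (\<Oplus>k\<in>{..<Suc r}. if r = k then e k \<otimes> ev (jet n u) (linear_form d n) else \<zero>)"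
      using eR ev_closed[OF jet_closed[OF uR] set_linear_form[OF carrier_is_subring dR]]
      by (intro finsum_cong') auto
    also have "\<dots> = e r \<otimes> ev (jet n u) (linear_form d n)"
      using eR ev_closed[OF jet_closed[OF uR] set_linear_form[OF carrier_is_subring dR]]
      by (intro finsum_singleton) auto
    finally have "e r \<otimes> ev (jet n u) (linear_form d n) = (\<Oplus>j\<in>{..<n}. \<zero> \<otimes> d j)"
      unfolding comb by simp
    also have "\<dots> = \<zero>" using dR by (simp add: finsum_zero)
    finally show ?thesis
      using er eR ev_closed[OF jet_closed[OF uR] set_linear_form[OF carrier_is_subring dR]]
      by (simp add: integral_iff)
  qed
  then show ?thesis using d(1,2) by (intro exI[of _ d]) auto
qed

end

lemma (in differential_field) diff_embedding_id:
  assumes "diff_subfield D R" "constants R (carrier R) \<subseteq> D"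
  shows "diff_embedding R D (\<lambda>x. x)"
proof -
  have "D \<subseteq> carrier R" using assms(1) subfieldE(3) by (auto simp: diff_subfield_def)
  then have "(\<lambda>x. x) \<in> diff_embeddings R D R"
    by (auto simp: diff_embeddings_def intro!: ring_hom_memI inj_onI)
  then show ?thesis using assms
    by (intro diff_embeddingI) auto
qed

context diff_embedding
begin

text \<open>
  A maximal differential ideal \<open>M\<close> without powers of \<open>W\<close> is the ideal of relations of every solution at
  whose jet \<open>M\<close> vanishes and \<open>W\<close> does not. Such a solution \<open>u\<close> exists for \<open>M\<close>, and a solution \<open>v\<close> for
  the image of \<open>M\<close> under \<open>\<theta>\<close>. The linear form \<open>W\<close> is chosen to vanish at the solutions in \<open>D\<close>, which
  keeps \<open>u\<close> outside \<open>D\<close>.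
\<close>

theorem corresponding_solutions:
  assumes alg: "algebraically_closed (R\<lparr>carrier := C\<rparr>)"
    and a: "\<And>i. i < n \<Longrightarrow> a i \<in> D"
    and z: "fundamental_system n a z" and z': "fundamental_system n (\<lambda>i. \<theta> (a i)) z'"
    and y: "y \<in> lin_diff_solutions R (carrier R) n a" "y \<notin> D"
  shows "\<exists>u \<in> lin_diff_solutions R (carrier R) n a. \<exists>v \<in> lin_diff_solutions R (carrier R) n (\<lambda>i. \<theta> (a i)).
    u \<notin> D \<and> (\<forall>p. set_pexp p \<subseteq> D \<longrightarrow> (ev (jet n u) p = \<zero> \<longleftrightarrow> ev (jet n v) (map_pexp \<theta> p) = \<zero>))"
proof -
  interpret id: diff_embedding R D "\<lambda>x. x" by (rule diff_embedding_id[OF dom C_subset])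
  obtain d where d: "\<forall>j. d j \<in> D" "\<exists>j<n. d j \<noteq> \<zero>"
    "\<forall>v \<in> lin_diff_solutions R (carrier R) n a \<inter> D. ev (jet n v) (linear_form d n) = \<zero>"
  proof -
    have "\<exists>d. (\<forall>j. d j \<in> D) \<and> (\<exists>j<n. d j \<noteq> \<zero>) \<and>
        (\<forall>v \<in> lin_diff_solutions R (carrier R) n a \<inter> D. ev (jet n v) (linear_form d n) = \<zero>)"
      by (rule annihilating_linear_form[OF dom C_subset a y])
    then obtain d where "(\<forall>j. d j \<in> D) \<and> (\<exists>j<n. d j \<noteq> \<zero>) \<and>
        (\<forall>v \<in> lin_diff_solutions R (carrier R) n a \<inter> D. ev (jet n v) (linear_form d n) = \<zero>)" by (rule exE)
    then show thesis by (intro that[of d]) simp_all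
  qed
  define W where "W = linear_form d n"
  have W: "set_pexp W \<subseteq> D" unfolding W_def using d(1) by (intro set_linear_form[OF subring_dom]) simp
  obtain j0 where j0: "j0 < n" "d j0 \<noteq> \<zero>" using d(2) by (elim exE conjE)
  have aR: "a i \<in> carrier R" if "i < n" for i using dom_closed a that by simp
  obtain k where k: "k < n" "ev (jet n (z k)) W \<noteq> \<zero>"
  proof -
    have dR: "d j \<in> carrier R" for j using d(1) dom_closed by simp
    have "\<exists>k<n. ev (jet n (z k)) (linear_form d n) \<noteq> \<zero>"
      by (rule linear_form_detects[where d = d, OF z aR dR j0])
    then show thesis using that by (auto simp: W_def)
  qed
  have zk: "z k \<in> lin_diff_solutions R (carrier R) n a" using z k(1) by (simp add: fundamental_system_def)
  have zkc: "z k \<in> carrier R" using zk by (simp add: lin_diff_solutions_def)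
  have avoid: "pexp_power W i \<notin> id.relations n (z k)" for i
    using id.relations_avoid_powers[OF zkc W] k(2) by (simp add: pexp.map_ident)
  have rel: "diff_ideal D n a (id.relations n (z k))" by (rule id.diff_ideal_relations[OF zk a])
  obtain M where M: "diff_ideal D n a M" "\<forall>i. pexp_power W i \<notin> M"
    "\<forall>N. diff_ideal D n a N \<longrightarrow> (\<forall>i. pexp_power W i \<notin> N) \<longrightarrow> M \<subseteq> N \<longrightarrow> N = M"
    using maximal_diff_ideal[OF rel avoid] by (elim exE conjE)
  interpret S: diff_ideal_and_solutions R D n a z M
    by (intro diff_ideal_and_solutions.intro diff_ideal_and_solutions_axioms.intro differential_field_axioms)
      (use dom C_subset a z M(1) in auto)
  obtain u where u: "u \<in> lin_diff_solutions R (carrier R) n a" "\<forall>p\<in>M. ev (jet n u) p = \<zero>"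
    "ev (jet n u) W \<noteq> \<zero>"
    using S.zero_of_diff_ideal[OF alg W spec[OF M(2)]] by (elim bexE conjE)
  have uc: "u \<in> carrier R" using u(1) by (simp add: lin_diff_solutions_def)
  have u_rel: "id.relations n u = M"
  proof (rule M(3)[rule_format])
    show "diff_ideal D n a (id.relations n u)" by (rule id.diff_ideal_relations[OF u(1) a])
    show "pexp_power W i \<notin> id.relations n u" for i
      using id.relations_avoid_powers[OF uc W] u(3) by (simp add: pexp.map_ident)
    show "M \<subseteq> id.relations n u"
      using u(2) diff_idealD(1)[OF M(1)] by (auto simp: id.relations_def pexp.map_ident)
  qed
  have M': "diff_ideal D' n (\<lambda>i. \<theta> (a i)) (map_pexp \<theta> ` M)" by (rule diff_ideal_image[OF M(1) a])
  have avoid': "pexp_power (map_pexp \<theta> W) i \<notin> map_pexp \<theta> ` M" for i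
  proof
    assume "pexp_power (map_pexp \<theta> W) i \<in> map_pexp \<theta> ` M"
    then obtain p where p: "map_pexp \<theta> (pexp_power W i) = map_pexp \<theta> p" "p \<in> M"
      unfolding map_power[symmetric] by (elim imageE)
    then have "pexp_power W i = p"
      using map_injective[OF set_pexp_power[OF subring_dom W] diff_idealD(1)[OF M(1) p(2)]] by simp
    with spec[OF M(2), of i] p(2) show False by blast
  qed
  interpret S': diff_ideal_and_solutions R D' n "\<lambda>i. \<theta> (a i)" z' "map_pexp \<theta> ` M"
    by (intro diff_ideal_and_solutions.intro diff_ideal_and_solutions_axioms.intro differential_field_axioms)
      (use image_diff_subfield C_subset_image a z' M' in auto)
  obtain v where v: "v \<in> lin_diff_solutions R (carrier R) n (\<lambda>i. \<theta> (a i))"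
    "\<forall>p\<in>map_pexp \<theta> ` M. ev (jet n v) p = \<zero>" "ev (jet n v) (map_pexp \<theta> W) \<noteq> \<zero>"
    using S'.zero_of_diff_ideal[OF alg set_map[OF W] avoid'] by (elim bexE conjE)
  have vc: "v \<in> carrier R" using v(1) by (simp add: lin_diff_solutions_def)
  have v_rel: "relations n v = M"
  proof (rule M(3)[rule_format])
    show "diff_ideal D n a (relations n v)" by (rule diff_ideal_relations[OF v(1) a])
    show "pexp_power W i \<notin> relations n v" for i by (rule relations_avoid_powers[OF vc W v(3)])
    show "M \<subseteq> relations n v"
      using v(2) diff_idealD(1)[OF M(1)] by (auto simp: relations_def)
  qed
  have "u \<notin> D" using d(3) u(1,3) by (auto simp: W_def)
  moreover have "ev (jet n u) p = \<zero> \<longleftrightarrow> ev (jet n v) (map_pexp \<theta> p) = \<zero>" if "set_pexp p \<subseteq> D" for p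
    using u_rel v_rel that by (auto simp: id.relations_def relations_def pexp.map_ident)
  ultimately show ?thesis using u(1) v(1) by (intro bexI[of _ u] bexI[of _ v]) simp_all
qed

end

section \<open>Extending embeddings to automorphisms\<close>

context differential_field
begin

text \<open>
  The graph of an isomorphism between two differential subrings; the condition on zeros makes the
  relation functional and injective. Only subrings are demanded, because the polynomial values of a
  new solution do not form a field. A maximal graph belongs to a subfield by
  \<open>partial_iso_fractions\<close>.
\<close>

definition partial_iso :: "('a \<times> 'a) set \<Rightarrow> bool" where
  "partial_iso G \<longleftrightarrow> G \<subseteq> carrier R \<times> carrier R \<and> (\<one>, \<one>) \<in> G \<and>
    (\<forall>x y s t. (x, y) \<in> G \<longrightarrow> (s, t) \<in> G \<longrightarrow> (x \<oplus> s, y \<oplus> t) \<in> G \<and> (x \<otimes> s, y \<otimes> t) \<in> G) \<and>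
    (\<forall>x y. (x, y) \<in> G \<longrightarrow> (\<ominus> x, \<ominus> y) \<in> G \<and> (\<partial> x, \<partial> y) \<in> G \<and> (x = \<zero> \<longleftrightarrow> y = \<zero>))"

lemma partial_isoD:
  assumes "partial_iso G" "(x, y) \<in> G"
  shows "x \<in> carrier R" "y \<in> carrier R" "(\<ominus> x, \<ominus> y) \<in> G" "(\<partial> x, \<partial> y) \<in> G" "x = \<zero> \<longleftrightarrow> y = \<zero>"
    and "(s, t) \<in> G \<Longrightarrow> (x \<oplus> s, y \<oplus> t) \<in> G" "(s, t) \<in> G \<Longrightarrow> (x \<otimes> s, y \<otimes> t) \<in> G"
  using assms by (auto simp: partial_iso_def)

lemma partial_iso_functional:
  assumes G: "partial_iso G" and "(x, y) \<in> G" "(s, t) \<in> G"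
  shows "x = s \<longleftrightarrow> y = t"
proof -
  have "(x \<oplus> \<ominus> s, y \<oplus> \<ominus> t) \<in> G"
    using partial_isoD(6)[OF G assms(2) partial_isoD(3)[OF G assms(3)]] .
  then have "x \<oplus> \<ominus> s = \<zero> \<longleftrightarrow> y \<oplus> \<ominus> t = \<zero>" by (rule partial_isoD(5)[OF G])
  then show ?thesis using partial_isoD(1,2)[OF G assms(2)] partial_isoD(1,2)[OF G assms(3)]
    by (simp add: a_minus_def[symmetric])
qed

text \<open>
  The extension to fractions, with cleared denominators: \<open>x\<close> and \<open>y\<close> correspond if \<open>s \<otimes> x\<close> and \<open>t \<otimes> y\<close>
  do for some corresponding nonzero \<open>s\<close> and \<open>t\<close>. For the derivative, the denominator is \<open>s \<otimes> s\<close>, by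
  the quotient rule \<open>s\<^sup>2 x' = s (s x)' - s' (s x)\<close>.
\<close>

lemma partial_iso_fractions:
  assumes G: "partial_iso G"
  defines "G' \<equiv> {(x, y) \<in> carrier R \<times> carrier R. \<exists>s t. (s, t) \<in> G \<and> s \<noteq> \<zero> \<and> (s \<otimes> x, t \<otimes> y) \<in> G}"
  shows "partial_iso G'" "G \<subseteq> G'" "(x, y) \<in> G \<Longrightarrow> x \<noteq> \<zero> \<Longrightarrow> (inv x, inv y) \<in> G'"
proof -
  note GD = partial_isoD[OF G]
  have one: "(\<one>, \<one>) \<in> G" using G by (simp add: partial_iso_def)
  show sub: "G \<subseteq> G'"
  proof
    fix q assume q: "q \<in> G"
    obtain x y where xy: "q = (x, y)" by (cases q)
    have "x \<in> carrier R" "y \<in> carrier R" using GD(1,2) q xy by auto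
    then show "q \<in> G'" unfolding G'_def xy using one q xy
      by (auto intro!: exI[of _ \<one>])
  qed
  show "(inv x, inv y) \<in> G'" if xy: "(x, y) \<in> G" "x \<noteq> \<zero>" for x y
  proof -
    have c: "x \<in> carrier R" "y \<in> carrier R" "y \<noteq> \<zero>" using GD[OF xy(1)] xy(2) by auto
    then have "inv x \<in> carrier R" "inv y \<in> carrier R" "x \<otimes> inv x = \<one>" "y \<otimes> inv y = \<one>"
      using xy(2) field_Units by auto
    then have "(inv x, inv y) \<in> carrier R \<times> carrier R" "(x \<otimes> inv x, y \<otimes> inv y) \<in> G"
      using one by simp_all
    then show ?thesis unfolding G'_def using xy by blast
  qed
  show "partial_iso G'"
    unfolding partial_iso_def
  proof (intro conjI allI impI)
    show "G' \<subseteq> carrier R \<times> carrier R" by (auto simp: G'_def)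
    show "(\<one>, \<one>) \<in> G'" using one sub by blast
    fix x y assume "(x, y) \<in> G'"
    then obtain s t where xy: "x \<in> carrier R" "y \<in> carrier R" and st: "(s, t) \<in> G" "s \<noteq> \<zero>"
      and p: "(s \<otimes> x, t \<otimes> y) \<in> G" by (auto simp: G'_def)
    have c: "s \<in> carrier R" "t \<in> carrier R" "t \<noteq> \<zero>" using GD[OF st(1)] st(2) by auto
    show "x = \<zero> \<longleftrightarrow> y = \<zero>" using GD(5)[OF p] xy c st(2) by (auto simp: integral_iff)
    have "(s \<otimes> \<ominus> x, t \<otimes> \<ominus> y) \<in> G" using GD(3)[OF p] xy c by (simp add: r_minus)
    then show "(\<ominus> x, \<ominus> y) \<in> G'" unfolding G'_def using xy st by auto
    have "(s \<otimes> \<partial> (s \<otimes> x) \<oplus> \<ominus> (\<partial> s \<otimes> (s \<otimes> x)), t \<otimes> \<partial> (t \<otimes> y) \<oplus> \<ominus> (\<partial> t \<otimes> (t \<otimes> y))) \<in> G"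
      by (intro GD(6) GD(7)[OF st(1)] GD(3) GD(4)[OF p] GD(7)[OF GD(4)[OF st(1)]] p)
    moreover have "s \<otimes> \<partial> (s \<otimes> x) \<oplus> \<ominus> (\<partial> s \<otimes> (s \<otimes> x)) = (s \<otimes> s) \<otimes> \<partial> x"
      if "s \<in> carrier R" "x \<in> carrier R" for s x
    proof -
      have "\<partial> s \<in> carrier R" "\<partial> x \<in> carrier R" using that by (auto intro: deriv_closed)
      then show ?thesis using that by (simp add: deriv_mult) algebra
    qed
    ultimately have "((s \<otimes> s) \<otimes> \<partial> x, (t \<otimes> t) \<otimes> \<partial> y) \<in> G" using xy c by simp
    moreover have "(s \<otimes> s, t \<otimes> t) \<in> G" "s \<otimes> s \<noteq> \<zero>" using GD(7)[OF st(1) st(1)] c st by (auto simp: integral_iff)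
    ultimately show "(\<partial> x, \<partial> y) \<in> G'" unfolding G'_def using xy by (auto intro: deriv_closed)
    fix x2 y2 assume "(x2, y2) \<in> G'"
    then obtain s2 t2 where xy2: "x2 \<in> carrier R" "y2 \<in> carrier R" and st2: "(s2, t2) \<in> G" "s2 \<noteq> \<zero>"
      and p2: "(s2 \<otimes> x2, t2 \<otimes> y2) \<in> G" by (auto simp: G'_def)
    have c2: "s2 \<in> carrier R" "t2 \<in> carrier R" using GD[OF st2(1)] by auto
    have den: "(s \<otimes> s2, t \<otimes> t2) \<in> G" "s \<otimes> s2 \<noteq> \<zero>"
      using GD(7)[OF st(1) st2(1)] c c2 st st2 by (auto simp: integral_iff)
    have "(s2 \<otimes> (s \<otimes> x) \<oplus> s \<otimes> (s2 \<otimes> x2), t2 \<otimes> (t \<otimes> y) \<oplus> t \<otimes> (t2 \<otimes> y2)) \<in> G"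
      by (intro GD(6) GD(7)[OF st2(1)] GD(7)[OF st(1)] p p2)
    moreover have "s2 \<otimes> (s \<otimes> x) \<oplus> s \<otimes> (s2 \<otimes> x2) = (s \<otimes> s2) \<otimes> (x \<oplus> x2)"
      "t2 \<otimes> (t \<otimes> y) \<oplus> t \<otimes> (t2 \<otimes> y2) = (t \<otimes> t2) \<otimes> (y \<oplus> y2)"
      using xy xy2 c c2 by algebra+
    ultimately show "(x \<oplus> x2, y \<oplus> y2) \<in> G'" unfolding G'_def using xy xy2 den by auto
    have "((s \<otimes> x) \<otimes> (s2 \<otimes> x2), (t \<otimes> y) \<otimes> (t2 \<otimes> y2)) \<in> G" by (intro GD(7) p p2)
    moreover have "(s \<otimes> x) \<otimes> (s2 \<otimes> x2) = (s \<otimes> s2) \<otimes> (x \<otimes> x2)"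
      "(t \<otimes> y) \<otimes> (t2 \<otimes> y2) = (t \<otimes> t2) \<otimes> (y \<otimes> y2)"
      using xy xy2 c c2 by algebra+
    ultimately show "(x \<otimes> x2, y \<otimes> y2) \<in> G'" unfolding G'_def using xy xy2 den by auto
  qed
qed

lemma maximal_partial_iso:
  assumes "partial_iso G0"
  shows "\<exists>G. partial_iso G \<and> G0 \<subseteq> G \<and> (\<forall>G'. partial_iso G' \<longrightarrow> G \<subseteq> G' \<longrightarrow> G' = G)"
proof -
  define S where "S = {G. partial_iso G \<and> G0 \<subseteq> G}"
  have "\<exists>G\<in>S. \<forall>G'\<in>S. G \<subseteq> G' \<longrightarrow> G' = G"
  proof (rule subset_Zorn_nonempty)
    show "S \<noteq> {}" using assms by (auto simp: S_def)
    fix CC assume CC: "CC \<noteq> {}" "subset.chain S CC"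
    then have mem: "partial_iso G \<and> G0 \<subseteq> G" if "G \<in> CC" for G
      using that unfolding pred_on.chain_def S_def by blast
    obtain G1 where G1: "G1 \<in> CC" using CC(1) by blast
    have common: "\<exists>G\<in>CC. p \<in> G \<and> q \<in> G" if pq: "p \<in> \<Union>CC" "q \<in> \<Union>CC" for p q
    proof -
      obtain G where G: "G \<in> CC" "p \<in> G" using pq(1) by (elim UnionE)
      obtain H where H: "H \<in> CC" "q \<in> H" using pq(2) by (elim UnionE)
      have "G \<subseteq> H \<or> H \<subseteq> G" using CC(2) G(1) H(1) unfolding pred_on.chain_def by blast
      then show ?thesis using G H by blast
    qed
    have "partial_iso (\<Union>CC)"
      unfolding partial_iso_def
    proof (intro conjI allI impI)
      show "\<Union>CC \<subseteq> carrier R \<times> carrier R" using mem by (force simp: partial_iso_def)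
      show "(\<one>, \<one>) \<in> \<Union>CC" using G1 mem[OF G1] by (auto simp: partial_iso_def)
      fix x y assume xy: "(x, y) \<in> \<Union>CC"
      then obtain G where G: "G \<in> CC" "(x, y) \<in> G" by (elim UnionE)
      note GD = partial_isoD[OF conjunct1[OF mem[OF G(1)]]]
      show "x = \<zero> \<longleftrightarrow> y = \<zero>" using GD(5)[OF G(2)] .
      show "(\<ominus> x, \<ominus> y) \<in> \<Union>CC" using GD(3)[OF G(2)] G(1) by blast
      show "(\<partial> x, \<partial> y) \<in> \<Union>CC" using GD(4)[OF G(2)] G(1) by blast
      fix s t assume st: "(s, t) \<in> \<Union>CC"
      obtain H where H: "H \<in> CC" "(x, y) \<in> H" "(s, t) \<in> H" using common[OF xy st] by (elim bexE conjE)
      note HD = partial_isoD[OF conjunct1[OF mem[OF H(1)]]]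
      show "(x \<oplus> s, y \<oplus> t) \<in> \<Union>CC" using HD(6)[OF H(2,3)] H(1) by blast
      show "(x \<otimes> s, y \<otimes> t) \<in> \<Union>CC" using HD(7)[OF H(2,3)] H(1) by blast
    qed
    moreover have "G0 \<subseteq> \<Union>CC" using G1 mem[OF G1] by blast
    ultimately show "\<Union>CC \<in> S" by (simp add: S_def)
  qed
  then obtain G where "G \<in> S" "\<And>G'. G' \<in> S \<Longrightarrow> G \<subseteq> G' \<Longrightarrow> G' = G" by (elim bexE) auto
  then show ?thesis unfolding S_def by (intro exI[of _ G]) auto
qed

end

lemma (in diff_embedding) partial_iso_graph: "partial_iso ((\<lambda>x. (x, \<theta> x)) ` D)"
  unfolding partial_iso_def
proof (intro conjI allI impI)
  show "(\<lambda>x. (x, \<theta> x)) ` D \<subseteq> carrier R \<times> carrier R" using dom_closed emb_closed by auto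
  show "(\<one>, \<one>) \<in> (\<lambda>x. (x, \<theta> x)) ` D" using dom_ops(2) emb_one by (intro image_eqI[of _ _ \<one>]) auto
  fix x y assume "(x, y) \<in> (\<lambda>x. (x, \<theta> x)) ` D"
  then have xy: "x \<in> D" "y = \<theta> x" by auto
  show "(\<ominus> x, \<ominus> y) \<in> (\<lambda>x. (x, \<theta> x)) ` D"
    using xy by (intro image_eqI[of _ _ "\<ominus> x"]) (auto simp: emb_minus dom_ops)
  show "(\<partial> x, \<partial> y) \<in> (\<lambda>x. (x, \<theta> x)) ` D"
    using xy by (intro image_eqI[of _ _ "\<partial> x"]) (auto simp: emb_deriv dom_deriv)
  show "x = \<zero> \<longleftrightarrow> y = \<zero>" using xy inj_onD[OF inj, of x \<zero>] dom_ops(1) emb_zero by auto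
  fix s t assume "(s, t) \<in> (\<lambda>x. (x, \<theta> x)) ` D"
  then have st: "s \<in> D" "t = \<theta> s" by auto
  show "(x \<oplus> s, y \<oplus> t) \<in> (\<lambda>x. (x, \<theta> x)) ` D"
    using xy st by (intro image_eqI[of _ _ "x \<oplus> s"]) (auto simp: emb_add dom_ops)
  show "(x \<otimes> s, y \<otimes> t) \<in> (\<lambda>x. (x, \<theta> x)) ` D"
    using xy st by (intro image_eqI[of _ _ "x \<otimes> s"]) (auto simp: emb_mult dom_ops)
qed

text \<open>
  The values of the polynomials over \<open>D\<close> at the jet of \<open>u\<close> form the differential ring generated by \<open>u\<close>
  over \<open>D\<close>, and \<open>corr\<close> makes the correspondence of the values injective and well defined.
\<close>

lemma (in diff_embedding) partial_iso_adjoin_solution: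
  assumes a: "\<And>i. i < n \<Longrightarrow> a i \<in> D"
    and u: "u \<in> lin_diff_solutions R (carrier R) n a"
    and v: "v \<in> lin_diff_solutions R (carrier R) n (\<lambda>i. \<theta> (a i))"
    and corr: "\<And>p. set_pexp p \<subseteq> D \<Longrightarrow> ev (jet n u) p = \<zero> \<longleftrightarrow> ev (jet n v) (map_pexp \<theta> p) = \<zero>"
  shows "partial_iso ((\<lambda>p. (ev (jet n u) p, ev (jet n v) (map_pexp \<theta> p))) ` {p. set_pexp p \<subseteq> D})"
    (is "partial_iso (?g ` ?P)")
  unfolding partial_iso_def
proof (intro conjI allI impI)
  have uc: "u \<in> carrier R" and vc: "v \<in> carrier R" using u v by (auto simp: lin_diff_solutions_def)
  have PR: "set_pexp p \<subseteq> carrier R" if "set_pexp p \<subseteq> D" for p :: "'a pexp"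
    using that dom_subset by (rule subset_trans)
  have c: "ev (jet n u) p \<in> carrier R" "ev (jet n v) (map_pexp \<theta> p) \<in> carrier R" if "set_pexp p \<subseteq> D" for p
    using ev_closed[OF jet_closed[OF uc] PR[OF that]]
      ev_closed[OF jet_closed[OF vc] set_map_carrier[OF that]] by auto
  show "?g ` ?P \<subseteq> carrier R \<times> carrier R" using c by auto
  show "(\<one>, \<one>) \<in> ?g ` ?P" using dom_ops(2) by (intro image_eqI[of _ _ "Const \<one>"]) (auto simp: emb_one)
  fix x y assume "(x, y) \<in> ?g ` ?P"
  then obtain p where p: "set_pexp p \<subseteq> D" "x = ev (jet n u) p" "y = ev (jet n v) (map_pexp \<theta> p)" by auto
  show "x = \<zero> \<longleftrightarrow> y = \<zero>" using corr p by simp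
  show "(\<ominus> x, \<ominus> y) \<in> ?g ` ?P"
  proof (rule image_eqI[of _ _ "Mul (Const (\<ominus> \<one>)) p"])
    show "(\<ominus> x, \<ominus> y) = ?g (Mul (Const (\<ominus> \<one>)) p)"
      using c[OF p(1)] by (simp add: p(2,3) emb_minus emb_one dom_ops l_minus)
  qed (use p(1) dom_ops in simp)
  have "ev (jet n u) (formal_deriv n a p) = \<partial> x"
    unfolding p(2) using a dom_closed by (intro ev_formal_deriv[OF u _ PR[OF p(1)]]) simp
  moreover have "ev (jet n v) (map_pexp \<theta> (formal_deriv n a p)) = \<partial> y"
  proof -
    have "map_pexp \<theta> (formal_deriv n a p) = formal_deriv n (\<lambda>i. \<theta> (a i)) (map_pexp \<theta> p)"
      using a by (intro map_formal_deriv[OF p(1)])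
    then show ?thesis
      unfolding p(3) using a emb_closed by (simp add: ev_formal_deriv[OF v _ set_map_carrier[OF p(1)]])
  qed
  moreover have "set_pexp (formal_deriv n a p) \<subseteq> D" using a by (intro set_formal_deriv[OF dom _ p(1)])
  ultimately show "(\<partial> x, \<partial> y) \<in> ?g ` ?P" by (intro image_eqI[of _ _ "formal_deriv n a p"]) auto
  fix s t assume "(s, t) \<in> ?g ` ?P"
  then obtain q where q: "set_pexp q \<subseteq> D" "s = ev (jet n u) q" "t = ev (jet n v) (map_pexp \<theta> q)" by auto
  show "(x \<oplus> s, y \<oplus> t) \<in> ?g ` ?P" using p q by (intro image_eqI[of _ _ "Add p q"]) auto
  show "(x \<otimes> s, y \<otimes> t) \<in> ?g ` ?P" using p q by (intro image_eqI[of _ _ "Mul p q"]) auto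
qed

lemma lin_diff_solutions_cong:
  assumes "ring R" "\<And>i. i < n \<Longrightarrow> a i = b i" "\<And>i. i < n \<Longrightarrow> b i \<in> carrier R"
    and "\<And>y i. y \<in> N \<Longrightarrow> (deriv R ^^ i) y \<in> carrier R"
  shows "lin_diff_solutions R N n a = lin_diff_solutions R N n b"
proof -
  interpret ring R by fact
  have "(\<Oplus>\<^bsub>R\<^esub>i\<in>{..<n}. a i \<otimes>\<^bsub>R\<^esub> (deriv R ^^ i) y) = (\<Oplus>\<^bsub>R\<^esub>i\<in>{..<n}. b i \<otimes>\<^bsub>R\<^esub> (deriv R ^^ i) y)"
    if "y \<in> N" for y
    using assms(2,3) assms(4)[OF that] by (intro finsum_cong') auto
  then show ?thesis by (auto simp: lin_diff_solutions_def)
qed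

context differential_field
begin

lemma fundamental_system_cong:
  assumes "fundamental_system n a z" "\<And>i. i < n \<Longrightarrow> a i = b i" "\<And>i. i < n \<Longrightarrow> b i \<in> carrier R"
  shows "fundamental_system n b z"
proof -
  have "lin_diff_solutions R (carrier R) n a = lin_diff_solutions R (carrier R) n b"
    using assms(2,3) deriv_iterate_closed by (intro lin_diff_solutions_cong[OF ring_axioms])
  then show ?thesis using assms(1) by (simp add: fundamental_system_def)
qed

lemma diff_field_generated_least:
  "diff_subfield L R \<Longrightarrow> S \<subseteq> L \<Longrightarrow> diff_field_generated R S \<subseteq> L"
  by (auto simp: diff_field_generated_def)

lemma partial_iso_imp_diff_embedding:
  assumes G: "partial_iso G"
    and inv_closed: "\<And>x y. (x, y) \<in> G \<Longrightarrow> x \<noteq> \<zero> \<Longrightarrow> (inv x, inv y) \<in> G"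
    and const: "\<And>c. c \<in> constants R (carrier R) \<Longrightarrow> (c, c) \<in> G"
  shows "\<exists>D \<theta>. diff_embedding R D \<theta> \<and> G = (\<lambda>x. (x, \<theta> x)) ` D"
proof -
  define D where "D = fst ` G"
  define \<theta> where "\<theta> x = (THE y. (x, y) \<in> G)" for x
  note GD = partial_isoD[OF G]
  have \<theta>_eq: "\<theta> x = y" if "(x, y) \<in> G" for x y
    unfolding \<theta>_def using that partial_iso_functional[OF G that] by (intro the_equality) auto
  have \<theta>: "(x, \<theta> x) \<in> G" if "x \<in> D" for x
  proof -
    obtain y where "(x, y) \<in> G" using \<open>x \<in> D\<close> by (auto simp: D_def)
    then show ?thesis using \<theta>_eq by simp
  qed
  have D: "x \<in> D" if "(x, y) \<in> G" for x y using that by (force simp: D_def)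
  have one: "(\<one>, \<one>) \<in> G" using G by (simp add: partial_iso_def)
  have "subring D R"
  proof (rule subringI)
    show "D \<subseteq> carrier R" using GD(1) by (auto simp: D_def)
    show "\<one> \<in> D" using D[OF one] .
    fix x assume x: "x \<in> D"
    show "\<ominus> x \<in> D" using D[OF GD(3)[OF \<theta>[OF x]]] .
    fix y assume y: "y \<in> D"
    show "x \<otimes> y \<in> D" using D[OF GD(7)[OF \<theta>[OF x] \<theta>[OF y]]] .
    show "x \<oplus> y \<in> D" using D[OF GD(6)[OF \<theta>[OF x] \<theta>[OF y]]] .
  qed
  moreover have "inv x \<in> D" if "x \<in> D - {\<zero>}" for x
    using D[OF inv_closed[OF \<theta>]] that by blast
  ultimately have "subfield D R" by (rule subfieldI')
  moreover have "\<partial> x \<in> D" if "x \<in> D" for x using D[OF GD(4)[OF \<theta>[OF that]]] .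
  ultimately have dD: "diff_subfield D R" by (simp add: diff_subfield_def)
  have "\<theta> \<in> diff_embeddings R D R"
    unfolding diff_embeddings_def
  proof (intro CollectI conjI ballI)
    show "\<theta> \<in> ring_hom (R\<lparr>carrier := D\<rparr>) R"
    proof (rule ring_hom_memI)
      fix x assume "x \<in> carrier (R\<lparr>carrier := D\<rparr>)"
      then have x: "(x, \<theta> x) \<in> G" using \<theta> by simp
      show "\<theta> x \<in> carrier R" using GD(2)[OF x] .
      fix y assume "y \<in> carrier (R\<lparr>carrier := D\<rparr>)"
      then have y: "(y, \<theta> y) \<in> G" using \<theta> by simp
      show "\<theta> (x \<otimes>\<^bsub>R\<lparr>carrier := D\<rparr>\<^esub> y) = \<theta> x \<otimes> \<theta> y" using \<theta>_eq[OF GD(7)[OF x y]] by simp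
      show "\<theta> (x \<oplus>\<^bsub>R\<lparr>carrier := D\<rparr>\<^esub> y) = \<theta> x \<oplus> \<theta> y" using \<theta>_eq[OF GD(6)[OF x y]] by simp
    next
      show "\<theta> \<one>\<^bsub>R\<lparr>carrier := D\<rparr>\<^esub> = \<one>" using \<theta>_eq[OF one] by simp
    qed
    show "inj_on \<theta> D"
    proof (rule inj_onI)
      fix x y assume "x \<in> D" "y \<in> D" "\<theta> x = \<theta> y"
      then show "x = y" using partial_iso_functional[OF G \<theta> \<theta>] by simp
    qed
    show "\<theta> (\<partial> x) = \<partial> (\<theta> x)" if "x \<in> D" for x using \<theta>_eq[OF GD(4)[OF \<theta>[OF that]]] .
  qed
  moreover have "c \<in> D" "\<theta> c = c" if "c \<in> constants R (carrier R)" for c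
    using D[OF const[OF that]] \<theta>_eq[OF const[OF that]] by auto
  ultimately have "diff_embedding R D \<theta>"
    using dD by (intro diff_embeddingI) auto
  moreover have "G = (\<lambda>x. (x, \<theta> x)) ` D"
  proof (intro equalityI subsetI)
    fix q assume q: "q \<in> G"
    obtain x y where "q = (x, y)" by (cases q)
    then show "q \<in> (\<lambda>x. (x, \<theta> x)) ` D" using q D[of x y] \<theta>_eq[of x y] by auto
  qed (use \<theta> in auto)
  ultimately show ?thesis by (intro exI conjI)
qed

end

locale picard_vessiot_tower = differential_field +
  fixes F :: "'a set" and Fs :: "nat \<Rightarrow> 'a set"
  assumes Fs_0: "Fs 0 = F"
    and Fs_Suc: "\<And>i. picard_vessiot_closure R (Fs i) (Fs (Suc i))"
    and Fs_union: "carrier R = (\<Union>i. Fs i)"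
    and alg_closed: "algebraically_closed (R\<lparr>carrier := constants R F\<rparr>)"
begin

lemma Fs_mono: "i \<le> j \<Longrightarrow> Fs i \<subseteq> Fs j"
proof (rule lift_Suc_mono_le[of Fs])
  show "Fs i \<subseteq> Fs (Suc i)" for i
    using Fs_Suc[of i] by (simp add: picard_vessiot_closure_def no_new_constants_subext_def)
qed

lemma Fs_constants: "constants R (Fs i) = constants R F"
proof (induction i)
  case (Suc i)
  then show ?case
    using Fs_Suc[of i] by (simp add: picard_vessiot_closure_def no_new_constants_subext_def)
qed (simp add: Fs_0)

lemma constants_carrier: "constants R (carrier R) = constants R F"
proof
  show "constants R (carrier R) \<subseteq> constants R F"
  proof
    fix c assume "c \<in> constants R (carrier R)"
    then obtain i where "c \<in> constants R (Fs i)" by (auto simp: constants_def Fs_union)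
    then show "c \<in> constants R F" by (simp add: Fs_constants)
  qed
  show "constants R F \<subseteq> constants R (carrier R)" by (auto simp: constants_def Fs_union Fs_0[symmetric])
qed

lemma Fs_carrier: "Fs i \<subseteq> carrier R" using Fs_union by auto

lemma finitely_many_in_stage:
  fixes n :: nat
  assumes "\<And>i. i < n \<Longrightarrow> a i \<in> carrier R"
  shows "\<exists>j. \<forall>i<n. a i \<in> Fs j"
  using assms
proof (induction n)
  case (Suc n)
  then obtain j where j: "\<forall>i<n. a i \<in> Fs j" by auto
  obtain k where k: "a n \<in> Fs k" using Suc.prems[of n] Fs_union by auto
  have "\<forall>i<Suc n. a i \<in> Fs (max j k)"
    using j k Fs_mono[of j "max j k"] Fs_mono[of k "max j k"] by (auto simp: less_Suc_eq)
  then show ?case by blast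
qed simp

lemma stage_fundamental_system:
  assumes "\<And>i. i < n \<Longrightarrow> a i \<in> Fs j"
  shows "\<exists>z. fundamental_system n a z \<and> (\<forall>k<n. z k \<in> Fs (Suc j))"
proof -
  have "full_set_of_solutions R (Fs (Suc j)) n a"
    using Fs_Suc[of j] assms by (simp add: picard_vessiot_closure_def)
  then obtain z where "fundamental_system n a z" "\<forall>k<n. z k \<in> lin_diff_solutions R (Fs (Suc j)) n a"
    using full_set_imp_fundamental_system[of "Fs (Suc j)" n a] Fs_carrier
    by (auto simp: Fs_constants constants_carrier)
  then show ?thesis by (auto simp: lin_diff_solutions_def)
qed

lemma fundamental_system_exists:
  assumes "\<And>i. i < n \<Longrightarrow> a i \<in> carrier R"
  shows "\<exists>z. fundamental_system n a z"
proof -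
  obtain j where "\<forall>i<n. a i \<in> Fs j" using finitely_many_in_stage[OF assms] by (rule exE)
  then show ?thesis using stage_fundamental_system[of n a j] by blast
qed

text \<open>
  The whole field arises from \<open>F\<close> by repeatedly adjoining solutions of equations over a stage of the
  tower.
\<close>

lemma tower_induct:
  assumes D: "diff_subfield D R" and F: "F \<subseteq> D"
    and step: "\<And>n a y i. Fs i \<subseteq> D \<Longrightarrow> (\<And>k. k < n \<Longrightarrow> a k \<in> Fs i) \<Longrightarrow>
      y \<in> lin_diff_solutions R (carrier R) n a \<Longrightarrow> y \<in> D"
  shows "D = carrier R"
proof -
  have "Fs i \<subseteq> D" for i
  proof (induction i)
    case 0
    then show ?case using F by (simp add: Fs_0)
  next
    case (Suc i)
    have "Fs (Suc i) = diff_field_generated R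
        (Fs i \<union> \<Union> {lin_diff_solutions R (Fs (Suc i)) n a | n a. \<forall>k<n. a k \<in> Fs i})"
      using Fs_Suc[of i] by (simp add: picard_vessiot_closure_def)
    moreover have "diff_field_generated R
        (Fs i \<union> \<Union> {lin_diff_solutions R (Fs (Suc i)) n a | n a. \<forall>k<n. a k \<in> Fs i}) \<subseteq> D"
    proof (rule diff_field_generated_least[OF D], rule Un_least[OF Suc], rule subsetI)
      fix y assume "y \<in> \<Union> {lin_diff_solutions R (Fs (Suc i)) n a | n a. \<forall>k<n. a k \<in> Fs i}"
      then obtain n a where na: "\<forall>k<n. a k \<in> Fs i" "y \<in> lin_diff_solutions R (Fs (Suc i)) n a" by auto
      have "y \<in> lin_diff_solutions R (carrier R) n a"
        using na(2) Fs_carrier[of "Suc i"] by (auto simp: lin_diff_solutions_def)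
      then show "y \<in> D" using step[OF Suc, of n a y] na(1) by simp
    qed
    ultimately show ?case by simp
  qed
  then show ?thesis using D subfieldE(3)[of D R] Fs_union by (auto simp: diff_subfield_def)
qed

text \<open>
  If the image contains the coefficients of an equation, it contains the image of a fundamental system
  of the equation with the preimages as coefficients. This is again a fundamental system, so the
  image contains all solutions.
\<close>

theorem embedding_of_carrier_surjective:
  assumes "diff_embedding R (carrier R) \<theta>" and fix_F: "\<And>x. x \<in> F \<Longrightarrow> \<theta> x = x"
  shows "\<theta> ` carrier R = carrier R"
proof -
  interpret \<theta>: diff_embedding R "carrier R" \<theta> by fact
  show ?thesis
  proof (rule tower_induct[OF \<theta>.image_diff_subfield])
    show "F \<subseteq> \<theta> ` carrier R"
    proof
      fix x assume "x \<in> F"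
      moreover from this have "x \<in> carrier R" using Fs_carrier[of 0] by (auto simp: Fs_0)
      ultimately show "x \<in> \<theta> ` carrier R" using fix_F by (intro image_eqI[of _ _ x]) auto
    qed
    fix n a y i
    assume Fi: "Fs i \<subseteq> \<theta> ` carrier R" and a: "\<And>k. k < n \<Longrightarrow> a k \<in> Fs i"
      and y: "y \<in> lin_diff_solutions R (carrier R) n a"
    define b where "b k = inv_into (carrier R) \<theta> (a k)" for k
    have b: "b k \<in> carrier R" "\<theta> (b k) = a k" if "k < n" for k
      using Fi a[OF that] by (auto simp: b_def intro: inv_into_into f_inv_into_f)
    have aR: "a k \<in> carrier R" if "k < n" for k using a[OF that] Fs_carrier by blast
    have "\<exists>z. fundamental_system n b z" by (rule fundamental_system_exists) (rule b(1))
    then obtain z where z: "fundamental_system n b z" by (rule exE)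
    have zc: "z k \<in> carrier R" if "k < n" for k
      using z that by (simp add: fundamental_system_def lin_diff_solutions_def)
    have "constants R (carrier R) = \<theta> ` constants R (carrier R)" using \<theta>.fix_constants by force
    then have "fundamental_system n (\<lambda>i. \<theta> (b i)) (\<lambda>k. \<theta> (z k))"
      using zc b(1) \<theta>.C_subset by (intro \<theta>.image_fundamental_system[OF z])
    then have z': "fundamental_system n a (\<lambda>k. \<theta> (z k))"
      by (rule fundamental_system_cong) (use b aR in auto)
    obtain c where c: "\<forall>k. c k \<in> constants R (carrier R)" "y = (\<Oplus>k\<in>{..<n}. c k \<otimes> \<theta> (z k))"
      using solution_in_span_of_fundamental_system[OF z' aR y] by blast
    have cc: "c k \<in> carrier R" "\<theta> (c k) = c k" for k
      using c(1) \<theta>.fix_constants by (auto simp: constants_def)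
    have "\<theta> (\<Oplus>k\<in>{..<n}. c k \<otimes> z k) = (\<Oplus>k\<in>{..<n}. \<theta> (c k \<otimes> z k))"
      and s: "(\<Oplus>k\<in>{..<n}. c k \<otimes> z k) \<in> carrier R"
      using \<theta>.emb_finsum[of n "\<lambda>k. c k \<otimes> z k"] cc zc by auto
    moreover have "(\<Oplus>k\<in>{..<n}. \<theta> (c k \<otimes> z k)) = (\<Oplus>k\<in>{..<n}. c k \<otimes> \<theta> (z k))"
      using cc zc \<theta>.emb_closed by (intro finsum_cong') (auto simp: \<theta>.emb_mult)
    ultimately show "y \<in> \<theta> ` carrier R" using c(2) by (metis image_eqI)
  qed
qed

text \<open>
  A maximal partial isomorphism above the graph of \<open>\<theta>\<close> is closed under inverses, so it is the graph of
  an embedding \<open>\<sigma>\<close> of a differential subfield \<open>D\<close>. If \<open>D\<close> lacked a solution of an equation over \<open>D\<close>,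
  a pair of corresponding solutions would enlarge the graph.
\<close>

theorem extend_to_automorphism:
  assumes L: "diff_embedding R L \<theta>" and "F \<subseteq> L" and fix_F: "\<And>x. x \<in> F \<Longrightarrow> \<theta> x = x"
  shows "\<exists>\<sigma> \<in> diff_automorphisms_over R F. \<forall>x\<in>L. \<sigma> x = \<theta> x"
proof -
  interpret L: diff_embedding R L \<theta> by fact
  have alg: "algebraically_closed (R\<lparr>carrier := constants R (carrier R)\<rparr>)"
    using alg_closed by (simp add: constants_carrier)
  obtain G where G: "partial_iso G" "(\<lambda>x. (x, \<theta> x)) ` L \<subseteq> G"
    "\<forall>G'. partial_iso G' \<longrightarrow> G \<subseteq> G' \<longrightarrow> G' = G"
    using maximal_partial_iso[OF L.partial_iso_graph] by (elim exE conjE)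
  have inv_closed: "(inv x, inv y) \<in> G" if "(x, y) \<in> G" "x \<noteq> \<zero>" for x y
    using partial_iso_fractions(3)[OF G(1) that]
    unfolding G(3)[rule_format, OF partial_iso_fractions(1,2)[OF G(1)]] .
  have const: "(c, c) \<in> G" if "c \<in> constants R (carrier R)" for c
    using G(2) that L.C_subset L.fix_constants[OF that] by force
  obtain D \<sigma> where D: "diff_embedding R D \<sigma>" and G_eq: "G = (\<lambda>x. (x, \<sigma> x)) ` D"
    using partial_iso_imp_diff_embedding[OF G(1) inv_closed const] by blast
  interpret D: diff_embedding R D \<sigma> by fact
  have ext: "x \<in> D \<and> \<sigma> x = \<theta> x" if "x \<in> L" for x using G(2) that unfolding G_eq by force
  have "D = carrier R"
  proof (rule tower_induct[OF D.dom])
    show "F \<subseteq> D" using \<open>F \<subseteq> L\<close> ext by blast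
    fix n a y i
    assume Fi: "Fs i \<subseteq> D" and a: "\<And>k. k < n \<Longrightarrow> a k \<in> Fs i"
      and y: "y \<in> lin_diff_solutions R (carrier R) n a"
    have aD: "a k \<in> D" if "k < n" for k using a[OF that] Fi by blast
    show "y \<in> D"
    proof (rule ccontr)
      assume "y \<notin> D"
      have "\<exists>z. fundamental_system n a z" by (rule fundamental_system_exists) (rule D.dom_closed[OF aD])
      then obtain z where z: "fundamental_system n a z" by (rule exE)
      have "\<exists>z. fundamental_system n (\<lambda>i. \<sigma> (a i)) z"
        by (rule fundamental_system_exists) (rule D.emb_closed[OF aD])
      then obtain z' where z': "fundamental_system n (\<lambda>i. \<sigma> (a i)) z'" by (rule exE)
      obtain u v where uv: "u \<in> lin_diff_solutions R (carrier R) n a"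
        "v \<in> lin_diff_solutions R (carrier R) n (\<lambda>i. \<sigma> (a i))" "u \<notin> D"
        "\<forall>p. set_pexp p \<subseteq> D \<longrightarrow> (ev (jet n u) p = \<zero> \<longleftrightarrow> ev (jet n v) (map_pexp \<sigma> p) = \<zero>)"
      proof -
        have "\<exists>u \<in> lin_diff_solutions R (carrier R) n a.
          \<exists>v \<in> lin_diff_solutions R (carrier R) n (\<lambda>i. \<sigma> (a i)). u \<notin> D \<and>
          (\<forall>p. set_pexp p \<subseteq> D \<longrightarrow> (ev (jet n u) p = \<zero> \<longleftrightarrow> ev (jet n v) (map_pexp \<sigma> p) = \<zero>))"
          by (rule D.corresponding_solutions[OF alg aD z z' y \<open>y \<notin> D\<close>])
        then show thesis by (elim bexE conjE) (rule that)
      qed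
      let ?g = "\<lambda>p. (ev (jet n u) p, ev (jet n v) (map_pexp \<sigma> p))"
      have "partial_iso (?g ` {p. set_pexp p \<subseteq> D})"
        by (rule D.partial_iso_adjoin_solution[OF aD uv(1,2)]) (use uv(4) in auto)
      moreover have "G \<subseteq> ?g ` {p. set_pexp p \<subseteq> D}"
      proof
        fix q assume "q \<in> G"
        then obtain x where "x \<in> D" "q = (x, \<sigma> x)" by (auto simp: G_eq)
        then show "q \<in> ?g ` {p. set_pexp p \<subseteq> D}" by (intro image_eqI[of _ _ "Const x"]) auto
      qed
      ultimately have eq: "?g ` {p. set_pexp p \<subseteq> D} = G" using G(3) by blast
      \<comment> \<open>The variable \<open>Var 0\<close> has the value \<open>u\<close> only if there is at least one variable.\<close>
      have "n \<noteq> 0"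
      proof
        assume "n = 0"
        then have "u = \<zero>" using uv(1) by (auto simp: lin_diff_solutions_def)
        then show False using uv(3) D.dom_ops(1) by simp
      qed
      then have "?g (Var 0) = (u, v)" by (simp add: jet_def)
      moreover have "?g (Var 0) \<in> ?g ` {p. set_pexp p \<subseteq> D}" by (intro imageI) simp
      ultimately have "(u, v) \<in> G" using eq by simp
      then show False using uv(3) by (auto simp: G_eq)
    qed
  qed
  then have \<sigma>: "diff_embedding R (carrier R) \<sigma>" using D by simp
  have \<sigma>_F: "\<sigma> x = x" if "x \<in> F" for x using ext \<open>F \<subseteq> L\<close> fix_F that by auto
  have "\<sigma> ` carrier R = carrier R" by (rule embedding_of_carrier_surjective[OF \<sigma> \<sigma>_F])
  then have "\<sigma> \<in> ring_iso R R"
    using D.hom D.inj \<open>D = carrier R\<close> by (simp add: ring_iso_def bij_betw_def)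
  then have "\<sigma> \<in> diff_automorphisms_over R F"
    using \<sigma>_F D.emb_deriv \<open>D = carrier R\<close> by (simp add: diff_automorphisms_over_def)
  then show ?thesis using ext by blast
qed

end

section \<open>Automorphism-stable subextensions\<close>

context picard_vessiot_tower
begin

text \<open>
  Extend \<open>t = g\<inverse> \<circ> f\<close> from \<open>M\<close> to an automorphism \<open>\<sigma>\<close>, which maps \<open>E\<close> to itself, so that \<open>g \<circ> \<sigma>\<close> is
  another embedding of \<open>E\<close> that agrees with \<open>f\<close> on \<open>M\<close>. It carries a fundamental system of the equation
  that defines \<open>N\<close> to one of the transported equation. As \<open>K\<close> has no new constants, the solutions that
  \<open>f\<close> produces are combinations of this system with coefficients in \<open>g ` E\<close>.
\<close>

lemma stable_image_step:
  fixes K :: "('k, 'l) diff_ring_scheme"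
  assumes stable: "automorphism_stable R F E" and E: "diff_subfield E R" "F \<subseteq> E"
    and K: "differential_field K" "constants K (carrier K) = j ` constants R F"
    and f: "f \<in> diff_embeddings_over R F E K j" and g: "g \<in> diff_embeddings_over R F E K j"
    and M: "diff_subfield M R" "F \<subseteq> M" "M \<subseteq> E" "f ` M \<subseteq> g ` E"
    and pv: "picard_vessiot_extension R M N" and "N \<subseteq> E"
  shows "f ` N \<subseteq> g ` E"
proof -
  interpret K: differential_field K by fact
  interpret f: diff_field_hom R K E f
    by (intro diff_field_hom.intro diff_field_hom_axioms.intro differential_field_axioms K E)
      (use f in \<open>simp add: diff_embeddings_over_def\<close>)
  interpret g: diff_field_hom R K E g
    by (intro diff_field_hom.intro diff_field_hom_axioms.intro differential_field_axioms K E)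
      (use g in \<open>simp add: diff_embeddings_over_def\<close>)
  have fF: "f x = j x" and gF: "g x = j x" if "x \<in> F" for x
    using f g that by (auto simp: diff_embeddings_over_def)
  have CF: "constants R (carrier R) \<subseteq> F" by (auto simp: constants_carrier) (simp add: constants_def)
  have CK: "constants K (carrier K) = g ` constants R (carrier R)"
    unfolding K(2) constants_carrier using gF by (intro image_cong) (auto simp: constants_def)
  define t where "t x = inv_into E g (f x)" for x
  have t: "t x \<in> E" "g (t x) = f x" if "x \<in> M" for x
  proof -
    have "f x \<in> g ` E" using M(4) that by blast
    then show "t x \<in> E" "g (t x) = f x"
      unfolding t_def by (rule inv_into_into, rule f_inv_into_f)
  qed
  have ME: "x \<in> E" if "x \<in> M" for x using that M(3) by blast
  have t_unique: "t x = y" if "x \<in> M" "y \<in> E" "g y = f x" for x y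
    using inj_onD[OF g.inj, of "t x" y] t[OF that(1)] that(2,3) by simp
  have subM: "subring M R" and dM: "\<And>x. x \<in> M \<Longrightarrow> \<partial> x \<in> M"
    using M(1) subfieldE(1) by (auto simp: diff_subfield_def)
  note M_ops = subringE(2,3,5,6,7)[OF subM]
  have t_emb: "t \<in> diff_embeddings R M R"
    unfolding diff_embeddings_def
  proof (intro CollectI conjI ballI)
    show "t \<in> ring_hom (R\<lparr>carrier := M\<rparr>) R"
    proof (rule ring_hom_memI)
      fix x assume "x \<in> carrier (R\<lparr>carrier := M\<rparr>)"
      then have x: "x \<in> M" by simp
      show "t x \<in> carrier R" using t(1)[OF x] by (rule g.dom_closed)
      fix y assume "y \<in> carrier (R\<lparr>carrier := M\<rparr>)"
      then have y: "y \<in> M" by simp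
      have "t (x \<otimes> y) = t x \<otimes> t y"
        using M_ops(4)[OF x y] t[OF x] t[OF y] g.dom_ops(4) ME[OF x] ME[OF y]
        by (intro t_unique) (simp_all add: g.emb_mult f.emb_mult)
      then show "t (x \<otimes>\<^bsub>R\<lparr>carrier := M\<rparr>\<^esub> y) = t x \<otimes> t y" by simp
      have "t (x \<oplus> y) = t x \<oplus> t y"
        using M_ops(5)[OF x y] t[OF x] t[OF y] g.dom_ops(5) ME[OF x] ME[OF y]
        by (intro t_unique) (simp_all add: g.emb_add f.emb_add)
      then show "t (x \<oplus>\<^bsub>R\<lparr>carrier := M\<rparr>\<^esub> y) = t x \<oplus> t y" by simp
    next
      have "g \<one> = f \<one>" using ring_hom_one[OF f.hom] ring_hom_one[OF g.hom] by simp
      then have "t \<one> = \<one>" using M_ops(2) g.dom_ops(2) by (intro t_unique)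
      then show "t \<one>\<^bsub>R\<lparr>carrier := M\<rparr>\<^esub> = \<one>" by simp
    qed
    show "inj_on t M"
    proof (rule inj_onI)
      fix x y assume xy: "x \<in> M" "y \<in> M" "t x = t y"
      then have "f x = f y" using t(2)[OF xy(1)] t(2)[OF xy(2)] by simp
      then show "x = y" using inj_onD[OF f.inj] ME xy(1,2) by blast
    qed
    show "t (\<partial> x) = \<partial> (t x)" if x: "x \<in> M" for x
      using dM[OF x] t[OF x] g.dom_deriv ME[OF x] by (intro t_unique) (simp_all add: g.emb_deriv f.emb_deriv)
  qed
  have tF: "t x = x" if "x \<in> F" for x
    using that M(2) E(2) fF gF by (intro t_unique) auto
  have t_diff: "diff_embedding R M t"
    using t_emb M(1,2) CF tF
    by (intro diff_embeddingI) auto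
  have "\<exists>\<sigma> \<in> diff_automorphisms_over R F. \<forall>x\<in>M. \<sigma> x = t x"
    by (rule extend_to_automorphism[OF t_diff M(2)]) (rule tF)
  then obtain \<sigma> where \<sigma>: "\<sigma> \<in> diff_automorphisms_over R F" "\<forall>x\<in>M. \<sigma> x = t x"
    by (elim bexE)
  have \<sigma>E: "\<sigma> x \<in> E" if "x \<in> E" for x
    using stable \<sigma>(1) that by (auto simp: automorphism_stable_def)
  have g\<sigma>: "g (\<sigma> x) = f x" if "x \<in> M" for x
    using \<sigma>(2) t(2)[OF that] that by simp
  have "\<sigma> \<in> diff_embeddings R (carrier R) R"
    using \<sigma>(1) by (auto simp: diff_automorphisms_over_def diff_embeddings_def ring_iso_def bij_betw_def)
  then interpret \<sigma>: diff_field_hom R R "carrier R" \<sigma>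
    by (intro diff_field_hom.intro diff_field_hom_axioms.intro differential_field_axioms)
      (simp_all add: diff_subfield_def carrier_is_subfield deriv_closed)
  have C\<sigma>: "constants R (carrier R) = \<sigma> ` constants R (carrier R)"
    using CF \<sigma>(1) by (force simp: diff_automorphisms_over_def)
  obtain n a where a: "\<forall>i<n. a i \<in> M" and full: "full_set_of_solutions R N n a"
    and N: "N = diff_field_generated R (M \<union> lin_diff_solutions R N n a)"
    and N_sub: "diff_subfield N R" "M \<subseteq> N" "constants R N = constants R M"
    using pv by (auto simp: picard_vessiot_extension_def no_new_constants_subext_def)
  have NR: "N \<subseteq> carrier R" using N_sub(1) subfieldE(3) by (auto simp: diff_subfield_def)
  have "constants R M = constants R (carrier R)"
    using M(2) CF \<open>M \<subseteq> N\<close> NR by (auto simp: constants_def)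
  then obtain z where z: "fundamental_system n a z" "\<forall>k<n. z k \<in> lin_diff_solutions R N n a"
    using full_set_imp_fundamental_system[OF _ NR full] N_sub(3) by auto
  have zE: "z k \<in> E" if "k < n" for k using z(2) that \<open>N \<subseteq> E\<close> by (auto simp: lin_diff_solutions_def)
  have aE: "a i \<in> E" if "i < n" for i using a that M(3) by blast
  have "fundamental_system n (\<lambda>i. \<sigma> (a i)) (\<lambda>k. \<sigma> (z k))"
    using zE aE g.dom_closed C\<sigma> by (intro \<sigma>.image_fundamental_system[OF z(1)]) (auto simp: constants_def)
  then have gz: "K.fundamental_system n (\<lambda>i. g (\<sigma> (a i))) (\<lambda>k. g (\<sigma> (z k)))"
    using zE aE \<sigma>E CF E(2) CK by (intro g.image_fundamental_system) auto
  \<comment> \<open>On the coefficients, \<open>g \<circ> \<sigma>\<close> is \<open>f\<close>.\<close>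
  have gz: "K.fundamental_system n (\<lambda>i. f (a i)) (\<lambda>k. g (\<sigma> (z k)))"
    by (rule K.fundamental_system_cong[OF gz]) (use a g\<sigma> f.emb_closed aE in auto)
  have gE: "diff_subfield (g ` E) K" by (rule g.image_diff_subfield)
  have sol: "f y \<in> g ` E" if y: "y \<in> lin_diff_solutions R N n a" for y
  proof -
    have yE: "y \<in> E" using y \<open>N \<subseteq> E\<close> by (auto simp: lin_diff_solutions_def)
    have fy: "f y \<in> lin_diff_solutions K (carrier K) n (\<lambda>i. f (a i))"
      by (rule f.image_solution[OF yE y aE])
    obtain c where c: "\<forall>k. c k \<in> constants K (carrier K)"
      "f y = (\<Oplus>\<^bsub>K\<^esub>k\<in>{..<n}. c k \<otimes>\<^bsub>K\<^esub> g (\<sigma> (z k)))"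
      using K.solution_in_span_of_fundamental_system[OF gz _ fy] f.emb_closed[OF aE] by auto
    have "\<forall>k. \<exists>d. d \<in> constants R (carrier R) \<and> c k = g d" using c(1) CK by blast
    then obtain d where d: "\<forall>k. d k \<in> constants R (carrier R) \<and> c k = g (d k)" by (rule choice[THEN exE])
    have dE: "d k \<in> E" for k using d CF E(2) by blast
    have s: "(\<Oplus>\<^bsub>R\<^esub>k\<in>{..<n}. d k \<otimes>\<^bsub>R\<^esub> \<sigma> (z k)) \<in> E"
      "g (\<Oplus>\<^bsub>R\<^esub>k\<in>{..<n}. d k \<otimes>\<^bsub>R\<^esub> \<sigma> (z k)) = (\<Oplus>\<^bsub>K\<^esub>k\<in>{..<n}. g (d k \<otimes>\<^bsub>R\<^esub> \<sigma> (z k)))"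
      using g.emb_finsum[of n "\<lambda>k. d k \<otimes>\<^bsub>R\<^esub> \<sigma> (z k)"] dE zE \<sigma>E g.dom_ops(4) by auto
    have "(\<Oplus>\<^bsub>K\<^esub>k\<in>{..<n}. g (d k \<otimes>\<^bsub>R\<^esub> \<sigma> (z k))) = (\<Oplus>\<^bsub>K\<^esub>k\<in>{..<n}. c k \<otimes>\<^bsub>K\<^esub> g (\<sigma> (z k)))"
      using dE zE \<sigma>E d by (intro K.finsum_cong') (auto simp: g.emb_mult g.emb_closed)
    then have "f y = g (\<Oplus>\<^bsub>R\<^esub>k\<in>{..<n}. d k \<otimes>\<^bsub>R\<^esub> \<sigma> (z k))" using c(2) s(2) by simp
    then show ?thesis using s(1) by (rule image_eqI)
  qed
  have "diff_subfield {x \<in> N. f x \<in> g ` E} R"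
    by (rule f.vimage_diff_subfield[OF N_sub(1) \<open>N \<subseteq> E\<close> gE])
  moreover have "M \<union> lin_diff_solutions R N n a \<subseteq> {x \<in> N. f x \<in> g ` E}"
    using M(4) \<open>M \<subseteq> N\<close> sol by (auto simp: lin_diff_solutions_def)
  ultimately have "N \<subseteq> {x \<in> N. f x \<in> g ` E}"
    by (subst N) (rule diff_field_generated_least)
  then show ?thesis by blast
qed

text \<open>
  Every element of \<open>E\<close> is reached by a finite tower of Picard--Vessiot extensions inside \<open>E\<close>, along which
  the inclusion propagates.
\<close>

lemma stable_image_subset:
  fixes K :: "('k, 'l) diff_ring_scheme"
  assumes stable: "automorphism_stable R F E" and E: "locally_iterated_picard_vessiot R F E"
    and K: "no_new_constants_extension R F K j"
    and f: "f \<in> diff_embeddings_over R F E K j" and g: "g \<in> diff_embeddings_over R F E K j"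
  shows "f ` E \<subseteq> g ` E"
proof
  fix w assume "w \<in> f ` E"
  then obtain x where x: "x \<in> E" "w = f x" by blast
  have E': "diff_subfield E R" "F \<subseteq> E" "diff_subfield F R"
    using E by (auto simp: locally_iterated_picard_vessiot_def)
  have K': "differential_field K" "constants K (carrier K) = j ` constants R F"
    using K by (auto simp: no_new_constants_extension_def)
  have "\<exists>L. iterated_picard_vessiot R F L \<and> {x} \<subseteq> L \<and> L \<subseteq> E"
  proof -
    have "\<forall>S. finite S \<and> S \<subseteq> E \<longrightarrow> (\<exists>L. iterated_picard_vessiot R F L \<and> S \<subseteq> L \<and> L \<subseteq> E)"
      using E by (simp add: locally_iterated_picard_vessiot_def)
    from spec[OF this, of "{x}"] show ?thesis using x(1) by simp
  qed
  then obtain L where L: "iterated_picard_vessiot R F L" "x \<in> L" "L \<subseteq> E" by auto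
  obtain m Es where Es: "Es 0 = F" "Es m = L"
    "\<forall>i<m. picard_vessiot_extension R (Es i) (Es (Suc i))"
    using L(1) unfolding iterated_picard_vessiot_def by (elim conjE exE)
  have mono: "Es i \<subseteq> Es (Suc i) \<and> diff_subfield (Es (Suc i)) R" if "i < m" for i
    using Es(3) that by (simp add: picard_vessiot_extension_def no_new_constants_subext_def)
  have sub_L: "Es i \<subseteq> L" if "i \<le> m" for i
    using that
  proof (induction rule: inc_induct)
    case (step i)
    have "Es i \<subseteq> Es (Suc i)" using mono[OF step.hyps(2)] by simp
    then show ?case using step.IH by (rule subset_trans)
  qed (simp add: Es(2))
  have "F \<subseteq> Es i \<and> diff_subfield (Es i) R \<and> f ` Es i \<subseteq> g ` E" if "i \<le> m" for i
    using that
  proof (induction i)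
    case 0
    have "f x = g x" if "x \<in> F" for x using f g that by (simp add: diff_embeddings_over_def)
    then show ?case using E' by (auto simp: Es(1))
  next
    case (Suc i)
    then have IH: "F \<subseteq> Es i" "diff_subfield (Es i) R" "f ` Es i \<subseteq> g ` E" and i: "i < m" by auto
    have "f ` Es (Suc i) \<subseteq> g ` E"
      by (rule stable_image_step[OF stable E'(1,2) K' f g IH(2,1) _ IH(3)])
        (use Es(3) i sub_L[of i] sub_L[of "Suc i"] L(3) in auto)
    then show ?case using mono[OF i] IH(1) by auto
  qed
  from this[OF order_refl] show "w \<in> g ` E" using L(2) x(2) Es(2) by blast
qed

theorem stable_imp_same_image:
  assumes "automorphism_stable R F E" "locally_iterated_picard_vessiot R F E"
  shows "embeddings_have_same_image R F E TYPE('k)"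
  unfolding embeddings_have_same_image_def
proof (intro allI impI ballI equalityI)
  fix K :: "'k diff_ring" and j f g
  assume K: "no_new_constants_extension R F K j"
    and f: "f \<in> diff_embeddings_over R F E K j" and g: "g \<in> diff_embeddings_over R F E K j"
  show "f ` E \<subseteq> g ` E" by (rule stable_image_subset[OF assms K f g])
  show "g ` E \<subseteq> f ` E" by (rule stable_image_subset[OF assms K g f])
qed

theorem same_image_imp_stable:
  assumes E: "E \<subseteq> carrier R" and same: "\<And>f g. f \<in> diff_embeddings_over R F E R (\<lambda>x. x) \<Longrightarrow>
    g \<in> diff_embeddings_over R F E R (\<lambda>x. x) \<Longrightarrow> f ` E = g ` E"
  shows "automorphism_stable R F E"
  unfolding automorphism_stable_def
proof
  fix \<sigma> assume \<sigma>: "\<sigma> \<in> diff_automorphisms_over R F"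
  have id: "(\<lambda>x. x) \<in> diff_embeddings_over R F E R (\<lambda>x. x)"
    using E by (auto simp: diff_embeddings_over_def diff_embeddings_def intro!: ring_hom_memI inj_onI)
  have hom: "\<sigma> \<in> ring_hom R R" and bij: "bij_betw \<sigma> (carrier R) (carrier R)"
    using \<sigma> by (auto simp: diff_automorphisms_over_def ring_iso_def)
  have "\<sigma> \<in> ring_hom (R\<lparr>carrier := E\<rparr>) R"
    using E ring_hom_closed[OF hom] ring_hom_mult[OF hom] ring_hom_add[OF hom] ring_hom_one[OF hom]
    by (intro ring_hom_memI) (auto simp: subset_iff)
  moreover have "inj_on \<sigma> E" using bij E by (auto simp: bij_betw_def intro: inj_on_subset)
  ultimately have "\<sigma> \<in> diff_embeddings_over R F E R (\<lambda>x. x)"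
    using \<sigma> E by (auto simp: diff_embeddings_over_def diff_embeddings_def diff_automorphisms_over_def)
  from same[OF this id] show "\<sigma> ` E = E" by simp
qed

lemma carrier_no_new_constants_extension:
  "no_new_constants_extension R F R (\<lambda>x. x)"
proof -
  have "F \<subseteq> carrier R" using Fs_carrier[of 0] by (simp add: Fs_0)
  then have "(\<lambda>x. x) \<in> diff_embeddings R F R"
    by (auto simp: diff_embeddings_def intro!: ring_hom_memI inj_onI)
  then show ?thesis
    using differential_field_axioms by (simp add: no_new_constants_extension_def constants_carrier)
qed

end

theorem theorem4:
  fixes Finf :: "'a diff_ring" and F E C :: "'a set"
  assumes "differential_field Finf"
    and "diff_subfield F Finf"
    and "C = constants Finf F"
    and "algebraically_closed (Finf\<lparr>carrier := C\<rparr>)"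
    and "complete_picard_vessiot_closure Finf F"
    and "locally_iterated_picard_vessiot Finf F E"
  shows "(automorphism_stable Finf F E \<longleftrightarrow> embeddings_have_same_image Finf F E TYPE('a)) \<and>
         (automorphism_stable Finf F E \<longrightarrow> embeddings_have_same_image Finf F E TYPE('k))"
proof -
  obtain Fs :: "nat \<Rightarrow> 'a set" where Fs: "Fs 0 = F"
    "\<forall>i. picard_vessiot_closure Finf (Fs i) (Fs (Suc i))" "carrier Finf = (\<Union>i. Fs i)"
    using assms(5) unfolding complete_picard_vessiot_closure_def by (elim exE conjE)
  interpret picard_vessiot_tower Finf F Fs
    by (intro picard_vessiot_tower.intro picard_vessiot_tower_axioms.intro assms(1))
      (use Fs assms(3,4) in simp_all)
  have "E \<subseteq> carrier Finf"
    using assms(6) subfieldE(3)[of E Finf]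
    by (simp add: locally_iterated_picard_vessiot_def diff_subfield_def)
  then have "automorphism_stable Finf F E" if "embeddings_have_same_image Finf F E TYPE('a)"
    using that carrier_no_new_constants_extension
    unfolding embeddings_have_same_image_def by (intro same_image_imp_stable) blast+
  moreover have "embeddings_have_same_image Finf F E TYPE('a)" if "automorphism_stable Finf F E"
    by (rule stable_imp_same_image[OF that assms(6)])
  moreover have "embeddings_have_same_image Finf F E TYPE('k)" if "automorphism_stable Finf F E"
    by (rule stable_imp_same_image[OF that assms(6)])
  ultimately show ?thesis by (intro conjI iffI impI)
qed

end
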